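(* Under the standing assumptions below, for any set $A\subseteq V_G$ that is strongly compressed and slice-compressed there exists a set $B\subseteq V_G$ that is strongly compressed and block-compressed, with $|B|=|A|$ and $|I_G(A)|\le|I_G(B)|$.
   Context: All graphs are finite and simple. For $G=(V,E)$ and $A,B\subseteq V$, $I_G(A,B)$ is the set of edges with one end in $A$ and the other in $B$, $I_G(A)=I_G(A,A)$, $I_G(m)=\max_{|S|=m}|I_G(S)|$. A total order on $G$ is a bijection $\mathcal O:V\to\{1,\dots,|V|\}$, $\mathcal O[k,l]=\mathcal O^{-1}(\{k,\dots,l\})$, $\mathcal O[k]=\mathcal O[1,k]$; it is optimal if $|I_G(\mathcal O[k])|=I_G(k)$ for all $k$; $G$ is isoperimetric if it has an optimal order. $\delta_G(1)=0$, $\delta_G(m)=I_G(m)-I_G(m-1)$ ($m\ge2$). Cartesian product $G_1\square\cdots\square G_d$: vertices are tuples, adjacent iff they differ in exactly one coordinate, where they are adjacent. Lexicographic order on $\mathbb R^k$: $x<y$ iff for some $i$, $x_1=y_1,\dots,x_i=y_i$, $x_{i+1}<y_{i+1}$. For $\pi\in\mathfrak S_k$, domination order $\mathcal D^{\pi,k}$: compare $(x_{\pi(1)},\dots,x_{\pi(k)})$ lexicographically. Orders on $\mathbb R^k$ induce orders on products of ordered sets by comparing the tuples of ranks. Isoperimetric partition of an isoperimetric $G$ with optimal order $\mathcal O_G$: partition $\{\mathcal O_G[a_1,b_1],\dots,\mathcal O_G[a_k,b_k]\}$ of $V$ into consecutive intervals such that each part induces an isoperimetric subgraph for which the restriction of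 $\mathcal O_G$ is optimal, and for each $v\in\mathcal O_G[a_i,b_i]$, $|I_G(\mathcal O_G[a_1,b_{i-1}],\{v\})|=\delta_G(a_i)$. The first vertex of a part is its start. Non-decreasing: every part's induced subgraph has non-decreasing $\delta$-sequence. Regular: the first and last parts' induced subgraphs have equal $\delta$-sequences. Setup: $G_i$ ($i=1,\dots,d$) isoperimetric with fixed optimal orders $\mathcal O_{G_i}$ and isoperimetric partitions $\mathfrak P_{G_i}$; $G=G_1\square\cdots\square G_d$; for nonempty $S=\{i_1<\dots<i_k\}$, $G_S=G_{i_1}\square\cdots\square G_{i_k}$. A block of $G_S$ is $Z_{i_1}\times\cdots\times Z_{i_k}$ with $Z_{i_j}\in\mathfrak P_{G_{i_j}}$; its start is the tuple of starts. An order $\mathcal O$ on a product is consistent with an order $\mathcal O'$ on the subproduct over $S$ if $x<_{\mathcal O}y$ and $x_j=y_j$ ($j\notin S$) imply that the projections to $S$ satisfy the same inequality in $\mathcal O'$. Domination collection: to each block $B$ of each $G_S$ ($|S|=k$) is assigned $\pi_B\in\mathfrak S_k$ so that the order $\mathcal D_B$ induced on $B$ by $\mathcal D^{\pi_B,k}$ (coordinates ranked by the restrictions of the $\mathcal O_{G_{i_j}}$) is optimal for the subgraph induced by $B$, and for $S_1\subset S_2$, $\mathcal D_{B_2}$ is consistent with $\mathcal D_{B_1}$ whenever $B_1$ consists of the factors of $B_2$ indexed by $S_1$. Block-lexicographic order $\mathcal{BL}^k_{G_S}$: same block: compare by $\mathcal D_B$; different blocks: compare their starts lexicographically (coordinates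 ranked by $\mathcal O_{G_{i_j}}$). Regular domination collection: $\mathfrak P_{G_i}$ regular for $2\le i\le d-1$, and $\pi_{B_1}=\pi_{B_2}$ for $B_1$ (resp. $B_2$) the product of the first (resp. last) parts of $\mathfrak P_{G_2},\dots,\mathfrak P_{G_{d-1}}$. Standing assumptions: $d\ge3$; the $\mathfrak P_{G_i}$ form a regular domination collection; $\mathfrak P_{G_i}$ is non-decreasing for $i=1,\dots,d-1$; $\mathcal{BL}^2_{G_i\square G_j}$ is optimal for all $i<j$. Compression: for a nonempty proper $S\subset\{1,\dots,d\}$ with a total order on $G_S$, and $x\in V_{G_{\overline S}}$, the section $G_S(x)$ is the set of vertices of $G$ whose coordinates in $\overline S$ equal $x$, ordered via the isomorphism with $G_S$. The compression of $A$ replaces each $A\cap G_S(x)$ by the initial segment of $G_S(x)$ of the same size. $A$ is strongly compressed if it is unchanged by compression for every nonempty proper $S$ with respect to $\mathcal{BL}^{|S|}_{G_S}$. Blocks of $G$ are ordered by $\mathcal{BL}^d_G$ applied to their starts. Slices: with $s_1,s_2,\dots$ the starts of the parts of $\mathfrak P_{G_1}$ in increasing $\mathcal O_{G_1}$-order, $\mathrm{Slice}_G(q)$ is the union of blocks whose start has first coordinate $s_q$. $A$ is slice-compressed if for every slice with blocks $B_1<\dots<B_p$ and $r$ the largest index with $A\cap B_r\ne\emptyset$, $B_i\subseteq A$ for $i<r$. $A$ is block-compressed if, listing all blocks of $G$ as $B_1<\dots<B_p$ and letting $r$ be the largest index with $A\cap B_r\neq\emptyset$, $B_i\subseteq A$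 for all $i<r$. *)

theory Defs
  imports "HOL-Library.FuncSet" "HOL-Combinatorics.Permutations"
begin

section \<open>Finite simple graphs and the edge-isoperimetric problem\<close>

record 'a sgraph =
  verts :: "'a set"
  edges :: "'a set set"

definition simple_graph :: "'a sgraph \<Rightarrow> bool" where
  "simple_graph G \<longleftrightarrow> finite (verts G) \<and>
     edges G \<subseteq> {{u, v} |u v. u \<in> verts G \<and> v \<in> verts G \<and> u \<noteq> v}"

definition induced_subgraph :: "'a sgraph \<Rightarrow> 'a set \<Rightarrow> 'a sgraph" where
  "induced_subgraph G Z = \<lparr>verts = verts G \<inter> Z, edges = {e \<in> edges G. e \<subseteq> Z}\<rparr>"

definition edges_between :: "'a sgraph \<Rightarrow> 'a set \<Rightarrow> 'a set \<Rightarrow> 'a set set" where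
  "edges_between G A B = {e \<in> edges G. \<exists>u\<in>A. \<exists>v\<in>B. e = {u, v}}"

abbreviation inner_edges :: "'a sgraph \<Rightarrow> 'a set \<Rightarrow> 'a set set" where
  "inner_edges G A \<equiv> edges_between G A A"

text \<open>Only meaningful for \<open>m \<le> card (verts G)\<close>.\<close>

definition max_inner_edges :: "'a sgraph \<Rightarrow> nat \<Rightarrow> nat" where
  "max_inner_edges G m =
     Max ((\<lambda>A. card (inner_edges G A)) ` {A. A \<subseteq> verts G \<and> card A = m})"

definition delta :: "'a sgraph \<Rightarrow> nat \<Rightarrow> int" where
  "delta G m = (if m \<le> 1 then 0 else int (max_inner_edges G m) - int (max_inner_edges G (m - 1)))"

definition total_order_on_graph :: "'a sgraph \<Rightarrow> ('a \<Rightarrow> nat) \<Rightarrow> bool" where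
  "total_order_on_graph G r \<longleftrightarrow> bij_betw r (verts G) {1..card (verts G)}"

definition ord_interval :: "'a sgraph \<Rightarrow> ('a \<Rightarrow> nat) \<Rightarrow> nat \<Rightarrow> nat \<Rightarrow> 'a set" where
  "ord_interval G r k l = {v \<in> verts G. r v \<in> {k..l}}"

definition optimal_order :: "'a sgraph \<Rightarrow> ('a \<Rightarrow> nat) \<Rightarrow> bool" where
  "optimal_order G r \<longleftrightarrow> total_order_on_graph G r \<and>
     (\<forall>k\<in>{1..card (verts G)}. card (inner_edges G (ord_interval G r 1 k)) = max_inner_edges G k)"

definition isoperimetric :: "'a sgraph \<Rightarrow> bool" where
  "isoperimetric G \<longleftrightarrow> (\<exists>r. optimal_order G r)"

text \<open>The bijection onto \<open>{1..card V}\<close> that represents a strict total order \<open>lt\<close> on a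
  finite set \<open>V\<close>.\<close>

definition rank_in :: "('a \<Rightarrow> 'a \<Rightarrow> bool) \<Rightarrow> 'a set \<Rightarrow> 'a \<Rightarrow> nat" where
  "rank_in lt V v = card {u \<in> V. lt u v} + 1"

definition restrict_order :: "('a \<Rightarrow> nat) \<Rightarrow> 'a set \<Rightarrow> 'a \<Rightarrow> nat" where
  "restrict_order r Z = rank_in (\<lambda>u v. r u < r v) Z"


section \<open>Isoperimetric partitions\<close>

text \<open>A partition into consecutive intervals is given by the list of its parts in increasing
  order, indexed from 0; so the intervals are \<open>[a 0, b 0], \<dots>, [a (k - 1), b (k - 1)]\<close>.
  Since \<open>b (i - 1) = a i - 1\<close>, the vertices preceding part \<open>i\<close> are
  \<open>ord_interval G r 1 (a i - 1)\<close>, which is empty for \<open>i = 0\<close>.\<close>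

definition isoperimetric_partition :: "'a sgraph \<Rightarrow> ('a \<Rightarrow> nat) \<Rightarrow> 'a set list \<Rightarrow> bool" where
  "isoperimetric_partition G r P \<longleftrightarrow>
     (\<exists>(a :: nat \<Rightarrow> nat) b k. k = length P \<and> k \<ge> 1 \<and>
        a 0 = 1 \<and> b (k - 1) = card (verts G) \<and>
        (\<forall>i. i + 1 < k \<longrightarrow> a (i + 1) = b i + 1) \<and>
        (\<forall>i<k. a i \<le> b i \<and>
           P ! i = ord_interval G r (a i) (b i) \<and>
           isoperimetric (induced_subgraph G (P ! i)) \<and>
           optimal_order (induced_subgraph G (P ! i)) (restrict_order r (P ! i)) \<and>
           (\<forall>v\<in>P ! i.
              int (card (edges_between G (ord_interval G r 1 (a i - 1)) {v})) = delta G (a i))))"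

definition part_start :: "('a \<Rightarrow> nat) \<Rightarrow> 'a set \<Rightarrow> 'a" where
  "part_start r Z = arg_min_on r Z"

definition nondecreasing_delta :: "'a sgraph \<Rightarrow> bool" where
  "nondecreasing_delta G \<longleftrightarrow> mono_on {1..card (verts G)} (delta G)"

definition equal_delta :: "'a sgraph \<Rightarrow> 'a sgraph \<Rightarrow> bool" where
  "equal_delta G H \<longleftrightarrow> card (verts G) = card (verts H) \<and>
     (\<forall>m\<in>{1..card (verts G)}. delta G m = delta H m)"

definition nondecreasing_partition :: "'a sgraph \<Rightarrow> 'a set list \<Rightarrow> bool" where
  "nondecreasing_partition G P \<longleftrightarrow> (\<forall>Z\<in>set P. nondecreasing_delta (induced_subgraph G Z))"

definition regular_partition :: "'a sgraph \<Rightarrow> 'a set list \<Rightarrow> bool" where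
  "regular_partition G P \<longleftrightarrow>
     equal_delta (induced_subgraph G (hd P)) (induced_subgraph G (last P))"


section \<open>Cartesian products, lexicographic and domination orders\<close>

text \<open>A vertex of the product over the index set \<open>S\<close> is an extensional function on \<open>S\<close>.\<close>

definition cart_prod :: "(nat \<Rightarrow> 'a sgraph) \<Rightarrow> nat set \<Rightarrow> (nat \<Rightarrow> 'a) sgraph" where
  "cart_prod G S =
     \<lparr>verts = (\<Pi>\<^sub>E i\<in>S. verts (G i)),
      edges = {{x, y} |x y. x \<in> (\<Pi>\<^sub>E i\<in>S. verts (G i)) \<and> y \<in> (\<Pi>\<^sub>E i\<in>S. verts (G i)) \<and>
                 (\<exists>i\<in>S. {x i, y i} \<in> edges (G i) \<and> (\<forall>j\<in>S - {i}. x j = y j))}\<rparr>"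

text \<open>Orders on \<open>k\<close>-tuples, whose entries are indexed by \<open>1, \<dots>, k\<close>.\<close>

definition lex_less :: "nat \<Rightarrow> (nat \<Rightarrow> 'b::linorder) \<Rightarrow> (nat \<Rightarrow> 'b) \<Rightarrow> bool" where
  "lex_less k x y \<longleftrightarrow> (\<exists>i<k. (\<forall>j\<in>{1..i}. x j = y j) \<and> x (i + 1) < y (i + 1))"

definition domination_less ::
    "(nat \<Rightarrow> nat) \<Rightarrow> nat \<Rightarrow> (nat \<Rightarrow> 'b::linorder) \<Rightarrow> (nat \<Rightarrow> 'b) \<Rightarrow> bool" where
  "domination_less p k x y \<longleftrightarrow> lex_less k (\<lambda>j. x (p j)) (\<lambda>j. y (p j))"

text \<open>The element \<open>i\<^sub>j\<close> of \<open>S = {i\<^sub>1 < \<dots> < i\<^sub>k}\<close>, and the \<open>k\<close>-tuple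
  \<open>(r i\<^sub>1 (x i\<^sub>1), \<dots>, r i\<^sub>k (x i\<^sub>k))\<close> of ranks of the coordinates of \<open>x\<close>.\<close>

definition index_elem :: "nat set \<Rightarrow> nat \<Rightarrow> nat" where
  "index_elem S j = sorted_list_of_set S ! (j - 1)"

definition rank_tuple :: "(nat \<Rightarrow> 'a \<Rightarrow> nat) \<Rightarrow> nat set \<Rightarrow> (nat \<Rightarrow> 'a) \<Rightarrow> nat \<Rightarrow> nat" where
  "rank_tuple r S x j = r (index_elem S j) (x (index_elem S j))"


section \<open>Blocks and domination collections\<close>

text \<open>A block of the product over \<open>S\<close> is represented by the family \<open>Z\<close> of its factors
  (extensional on \<open>S\<close>); its vertex set is \<open>PiE S Z\<close>.  From here on, \<open>r i\<close> is the order on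
  \<open>G i\<close>, \<open>P i\<close> the partition of \<open>G i\<close>, and \<open>p S Z\<close> the permutation assigned to the block \<open>Z\<close>
  of the product over \<open>S\<close>.\<close>

definition blocks :: "(nat \<Rightarrow> 'a set list) \<Rightarrow> nat set \<Rightarrow> (nat \<Rightarrow> 'a set) set" where
  "blocks P S = (\<Pi>\<^sub>E i\<in>S. set (P i))"

definition block_start :: "(nat \<Rightarrow> 'a \<Rightarrow> nat) \<Rightarrow> nat set \<Rightarrow> (nat \<Rightarrow> 'a set) \<Rightarrow> nat \<Rightarrow> 'a" where
  "block_start r S Z = (\<lambda>i\<in>S. part_start (r i) (Z i))"

definition block_of :: "(nat \<Rightarrow> 'a set list) \<Rightarrow> nat set \<Rightarrow> (nat \<Rightarrow> 'a) \<Rightarrow> nat \<Rightarrow> 'a set" where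
  "block_of P S x = (\<lambda>i\<in>S. THE Z. Z \<in> set (P i) \<and> x i \<in> Z)"

type_synonym 'a perm_assignment = "nat set \<Rightarrow> (nat \<Rightarrow> 'a set) \<Rightarrow> nat \<Rightarrow> nat"

definition block_less ::
    "(nat \<Rightarrow> 'a \<Rightarrow> nat) \<Rightarrow> 'a perm_assignment \<Rightarrow> nat set \<Rightarrow> (nat \<Rightarrow> 'a set)
      \<Rightarrow> (nat \<Rightarrow> 'a) \<Rightarrow> (nat \<Rightarrow> 'a) \<Rightarrow> bool" where
  "block_less r p S Z x y \<longleftrightarrow>
     domination_less (p S Z) (card S)
       (rank_tuple (\<lambda>i. restrict_order (r i) (Z i)) S x)
       (rank_tuple (\<lambda>i. restrict_order (r i) (Z i)) S y)"

definition consistent_orders ::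
    "nat set \<Rightarrow> (nat \<Rightarrow> 'a) set \<Rightarrow> ((nat \<Rightarrow> 'a) \<Rightarrow> (nat \<Rightarrow> 'a) \<Rightarrow> bool)
      \<Rightarrow> nat set \<Rightarrow> ((nat \<Rightarrow> 'a) \<Rightarrow> (nat \<Rightarrow> 'a) \<Rightarrow> bool) \<Rightarrow> bool" where
  "consistent_orders T V lt S lt' \<longleftrightarrow>
     (\<forall>x\<in>V. \<forall>y\<in>V. lt x y \<and> (\<forall>j\<in>T - S. x j = y j) \<longrightarrow> lt' (restrict x S) (restrict y S))"

definition domination_collection ::
    "nat \<Rightarrow> (nat \<Rightarrow> 'a sgraph) \<Rightarrow> (nat \<Rightarrow> 'a \<Rightarrow> nat) \<Rightarrow> (nat \<Rightarrow> 'a set list)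
      \<Rightarrow> 'a perm_assignment \<Rightarrow> bool" where
  "domination_collection d G r P p \<longleftrightarrow>
     (\<forall>S Z. S \<noteq> {} \<and> S \<subseteq> {1..d} \<and> Z \<in> blocks P S \<longrightarrow>
        p S Z permutes {1..card S} \<and>
        optimal_order (induced_subgraph (cart_prod G S) (PiE S Z))
          (rank_in (block_less r p S Z) (PiE S Z))) \<and>
     (\<forall>S1 S2 Z. S1 \<noteq> {} \<and> S1 \<subset> S2 \<and> S2 \<subseteq> {1..d} \<and> Z \<in> blocks P S2 \<longrightarrow>
        consistent_orders S2 (PiE S2 Z) (block_less r p S2 Z) S1
          (block_less r p S1 (restrict Z S1)))"

definition regular_domination_collection ::
    "nat \<Rightarrow> (nat \<Rightarrow> 'a sgraph) \<Rightarrow> (nat \<Rightarrow> 'a \<Rightarrow> nat) \<Rightarrow> (nat \<Rightarrow> 'a set list)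
      \<Rightarrow> 'a perm_assignment \<Rightarrow> bool" where
  "regular_domination_collection d G r P p \<longleftrightarrow>
     domination_collection d G r P p \<and>
     (\<forall>i\<in>{2..d - 1}. regular_partition (G i) (P i)) \<and>
     p {2..d - 1} (\<lambda>i\<in>{2..d - 1}. hd (P i)) = p {2..d - 1} (\<lambda>i\<in>{2..d - 1}. last (P i))"


section \<open>The block-lexicographic order\<close>

definition block_lex_less ::
    "(nat \<Rightarrow> 'a \<Rightarrow> nat) \<Rightarrow> (nat \<Rightarrow> 'a set list) \<Rightarrow> 'a perm_assignment \<Rightarrow> nat set
      \<Rightarrow> (nat \<Rightarrow> 'a) \<Rightarrow> (nat \<Rightarrow> 'a) \<Rightarrow> bool" where
  "block_lex_less r P p S x y \<longleftrightarrow>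
     (if block_of P S x = block_of P S y
      then block_less r p S (block_of P S x) x y
      else lex_less (card S)
             (rank_tuple r S (block_start r S (block_of P S x)))
             (rank_tuple r S (block_start r S (block_of P S y))))"

definition block_lex_order ::
    "(nat \<Rightarrow> 'a sgraph) \<Rightarrow> (nat \<Rightarrow> 'a \<Rightarrow> nat) \<Rightarrow> (nat \<Rightarrow> 'a set list) \<Rightarrow> 'a perm_assignment
      \<Rightarrow> nat set \<Rightarrow> (nat \<Rightarrow> 'a) \<Rightarrow> nat" where
  "block_lex_order G r P p S = rank_in (block_lex_less r P p S) (verts (cart_prod G S))"


section \<open>Compression\<close>

definition graph_section ::
    "nat \<Rightarrow> (nat \<Rightarrow> 'a sgraph) \<Rightarrow> nat set \<Rightarrow> (nat \<Rightarrow> 'a) \<Rightarrow> (nat \<Rightarrow> 'a) set" where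
  "graph_section d G S x = {v \<in> verts (cart_prod G {1..d}). \<forall>j\<in>{1..d} - S. v j = x j}"

text \<open>Here \<open>q\<close> is a total order on \<open>cart_prod G S\<close>, transported to each section along
  \<open>v \<mapsto> restrict v S\<close>.\<close>

definition compression ::
    "nat \<Rightarrow> (nat \<Rightarrow> 'a sgraph) \<Rightarrow> nat set \<Rightarrow> ((nat \<Rightarrow> 'a) \<Rightarrow> nat) \<Rightarrow> (nat \<Rightarrow> 'a) set
      \<Rightarrow> (nat \<Rightarrow> 'a) set" where
  "compression d G S q A =
     (\<Union>x\<in>verts (cart_prod G ({1..d} - S)).
        {v \<in> graph_section d G S x. q (restrict v S) \<le> card (A \<inter> graph_section d G S x)})"

definition strongly_compressed ::
    "nat \<Rightarrow> (nat \<Rightarrow> 'a sgraph) \<Rightarrow> (nat \<Rightarrow> 'a \<Rightarrow> nat) \<Rightarrow> (nat \<Rightarrow> 'a set list)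
      \<Rightarrow> 'a perm_assignment \<Rightarrow> (nat \<Rightarrow> 'a) set \<Rightarrow> bool" where
  "strongly_compressed d G r P p A \<longleftrightarrow>
     (\<forall>S. S \<noteq> {} \<and> S \<subset> {1..d} \<longrightarrow> compression d G S (block_lex_order G r P p S) A = A)"

definition block_precedes ::
    "nat \<Rightarrow> (nat \<Rightarrow> 'a \<Rightarrow> nat) \<Rightarrow> (nat \<Rightarrow> 'a set list) \<Rightarrow> 'a perm_assignment
      \<Rightarrow> (nat \<Rightarrow> 'a set) \<Rightarrow> (nat \<Rightarrow> 'a set) \<Rightarrow> bool" where
  "block_precedes d r P p Z Z' \<longleftrightarrow>
     block_lex_less r P p {1..d} (block_start r {1..d} Z) (block_start r {1..d} Z')"

text \<open>If \<open>R\<close> is the last block of the family \<open>Bs\<close> that meets \<open>A\<close>, then \<open>A\<close> contains all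
  earlier blocks of \<open>Bs\<close>; no condition if \<open>A\<close> meets no block of \<open>Bs\<close>.\<close>

definition compressed_along ::
    "nat \<Rightarrow> (nat \<Rightarrow> 'a \<Rightarrow> nat) \<Rightarrow> (nat \<Rightarrow> 'a set list) \<Rightarrow> 'a perm_assignment
      \<Rightarrow> (nat \<Rightarrow> 'a set) set \<Rightarrow> (nat \<Rightarrow> 'a) set \<Rightarrow> bool" where
  "compressed_along d r P p Bs A \<longleftrightarrow>
     (\<forall>R\<in>Bs. A \<inter> PiE {1..d} R \<noteq> {} \<and>
        (\<forall>Z\<in>Bs. block_precedes d r P p R Z \<longrightarrow> A \<inter> PiE {1..d} Z = {}) \<longrightarrow>
        (\<forall>Z\<in>Bs. block_precedes d r P p Z R \<longrightarrow> PiE {1..d} Z \<subseteq> A))"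

text \<open>The blocks that make up the slice belonging to the \<open>q\<close>-th part (counted from 1) of \<open>P 1\<close>.\<close>

definition slice_blocks ::
    "nat \<Rightarrow> (nat \<Rightarrow> 'a \<Rightarrow> nat) \<Rightarrow> (nat \<Rightarrow> 'a set list) \<Rightarrow> nat \<Rightarrow> (nat \<Rightarrow> 'a set) set" where
  "slice_blocks d r P q =
     {Z \<in> blocks P {1..d}. block_start r {1..d} Z 1 = part_start (r 1) (P 1 ! (q - 1))}"

definition slice_compressed ::
    "nat \<Rightarrow> (nat \<Rightarrow> 'a \<Rightarrow> nat) \<Rightarrow> (nat \<Rightarrow> 'a set list) \<Rightarrow> 'a perm_assignment
      \<Rightarrow> (nat \<Rightarrow> 'a) set \<Rightarrow> bool" where
  "slice_compressed d r P p A \<longleftrightarrow>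
     (\<forall>q\<in>{1..length (P 1)}. compressed_along d r P p (slice_blocks d r P q) A)"

definition block_compressed ::
    "nat \<Rightarrow> (nat \<Rightarrow> 'a \<Rightarrow> nat) \<Rightarrow> (nat \<Rightarrow> 'a set list) \<Rightarrow> 'a perm_assignment
      \<Rightarrow> (nat \<Rightarrow> 'a) set \<Rightarrow> bool" where
  "block_compressed d r P p A \<longleftrightarrow> compressed_along d r P p (blocks P {1..d}) A"

end

theory Submission
  imports Defs
begin

text \<open>Identify vertices with tuples of ranks. In a set that is down-closed in every coordinate, count each
  edge at its upper end: the number of inner edges is the sum of the weights
  \<open>w x = (\<Sum>i. \<delta>\<^sub>i (x i))\<close> of its elements. Hence it suffices to show that no down-closed set of a given
  size has a larger weight than the initial segment of the block-lexicographic order, because initial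
  segments are strongly compressed and block-compressed.

  This is proved for all subproducts over at least two factors, by induction on the number of factors; two
  factors are the hypothesis. For a down-closed \<open>T\<close> that is not yet extremal one finds a set of the
  same size, of no smaller weight and with a smaller sum of positions in the order. If some sections with one
  coordinate fixed are not initial segments, compress them. Otherwise \<open>T\<close> is determined by the sizes
  \<open>s b\<close> of its sections over a coordinate \<open>j\<close>. Let \<open>t\<close> be a threshold at a boundary between blocks, and
  \<open>s b' < t < s b\<close>. The initial segment of length \<open>s b'\<close> together with the part of the one of length \<open>s b\<close>
  above \<open>t\<close> is down-closed, so by the induction hypothesis the elements above \<open>t\<close> in section \<open>b\<close> can
  be moved below \<open>t\<close> in section \<open>b'\<close> until one of the two sizes reaches \<open>t\<close>; the weight does not drop as long as
  \<open>\<delta>\<^sub>j b \<le> \<delta>\<^sub>j b'\<close>. If \<open>T\<close> has a gap in an earlier slice, \<open>j\<close> is an interior coordinate, \<open>b\<close> lies in the first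
  part and \<open>b'\<close> in the last part, and regularity and monotonicity of \<open>\<delta>\<^sub>j\<close> provide suitable moves; if the gap is in the
  same slice, \<open>j\<close> is the first coordinate and \<open>b\<close>, \<open>b'\<close> lie in the same part. When no move is left, \<open>T\<close> is
  block-compressed, and optimality of the domination order inside the last block finishes the proof.\<close>


section \<open>Counting edges in products\<close>

text \<open>Two constraints shape the moves. A move must leave the section sizes decreasing along
  the coordinate, so a single move goes from the last section longer than \<open>t\<close> to the
  first one shorter than \<open>t\<close>; the weights of just these two sections may be in the
  wrong order, and then a whole part is shifted at once. Moreover, the mixed set made of the short
  segment and the top of the long one is down-closed only if no element above \<open>t\<close>
  dominates a missing element below \<open>t\<close>. Such a pair is excluded by raising one
  coordinate of the lower element to its value in the upper one: the lower element stays outside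
  \<open>T\<close> and in an earlier block, but now both share a section, and sections are closed.
  That coordinate has to differ from the removed one and from the one that decides the comparison of
  blocks; this is where three factors enter. Thresholds at block boundaries make an element and its
  new place comparable by blocks alone, so every move lowers the sum of positions.\<close>

definition back_degree :: "'a sgraph \<Rightarrow> ('a \<Rightarrow> nat) \<Rightarrow> 'a \<Rightarrow> nat" where
  "back_degree H \<rho> v = card {u \<in> verts H. \<rho> u < \<rho> v \<and> {u, v} \<in> edges H}"

lemma finite_verts: "simple_graph H \<Longrightarrow> finite (verts H)"
  unfolding simple_graph_def by simp

lemma edgeD:
  assumes "simple_graph H" "{u, v} \<in> edges H"
  shows "u \<in> verts H" "v \<in> verts H" "u \<noteq> v"
  using assms unfolding simple_graph_def by (auto simp: doubleton_eq_iff)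

lemma finite_verts_cart_prod:
  assumes "finite S" "\<And>i. i \<in> S \<Longrightarrow> simple_graph (H i)"
  shows "finite (verts (cart_prod H S))"
  unfolding cart_prod_def using assms by (auto intro!: finite_PiE finite_verts)

lemma verts_cart_prod: "verts (cart_prod H S) = (\<Pi>\<^sub>E i\<in>S. verts (H i))"
  unfolding cart_prod_def by simp

lemma PiE_upd: "x \<in> PiE S F \<Longrightarrow> i \<in> S \<Longrightarrow> v \<in> F i \<Longrightarrow> x(i := v) \<in> PiE S F"
  unfolding PiE_iff extensional_def by auto

lemma card_inner_edges_down:
  fixes \<rho> :: "nat \<Rightarrow> 'a \<Rightarrow> nat"
  assumes fin: "finite S" and simple: "\<And>i. i \<in> S \<Longrightarrow> simple_graph (H i)"
    and inj: "\<And>i. i \<in> S \<Longrightarrow> inj_on (\<rho> i) (verts (H i))"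
    and A: "A \<subseteq> verts (cart_prod H S)"
    and down: "\<And>x i v. x \<in> A \<Longrightarrow> i \<in> S \<Longrightarrow> v \<in> verts (H i) \<Longrightarrow> \<rho> i v < \<rho> i (x i) \<Longrightarrow> x(i := v) \<in> A"
  shows "card (inner_edges (cart_prod H S) A) = (\<Sum>x\<in>A. \<Sum>i\<in>S. back_degree (H i) (\<rho> i) (x i))"
proof -
  define B where "B x i = {u \<in> verts (H i). \<rho> i u < \<rho> i (x i) \<and> {u, x i} \<in> edges (H i)}" for x i
  \<comment> \<open>A triple consists of an upper end, the changed coordinate and the smaller value
    there; \<open>\<phi>\<close> sends it to its edge.\<close>
  define D where "D = Sigma A (\<lambda>x. Sigma S (\<lambda>i. B x i))"
  define \<phi> where "\<phi> = (\<lambda>(x, i, u). {x, x(i := u)} :: (nat \<Rightarrow> 'a) set)"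
  have finA: "finite A" by (rule finite_subset[OF A finite_verts_cart_prod[OF fin simple]])
  have finB: "finite (B x i)" if "i \<in> S" for x i
    unfolding B_def using finite_verts[OF simple[OF that]] by simp
  have AV: "x \<in> (\<Pi>\<^sub>E i\<in>S. verts (H i))" if "x \<in> A" for x using A that unfolding verts_cart_prod by (rule subsetD)
  have "inj_on \<phi> D"
  proof (rule inj_onI)
    fix s t assume st: "s \<in> D" "t \<in> D" "\<phi> s = \<phi> t"
    obtain x i u where s: "s = (x, i, u)" by (cases s)
    obtain y j v where t: "t = (y, j, v)" by (cases t)
    have sx: "\<rho> i u < \<rho> i (x i)" and ty: "\<rho> j v < \<rho> j (y j)"
      using st unfolding s t D_def B_def by auto
    then have ne: "u \<noteq> x i" "v \<noteq> y j" by auto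
    have "{x, x(i := u)} = {y, y(j := v)}" using st(3) unfolding s t \<phi>_def by simp
    then consider "x = y" "x(i := u) = y(j := v)" | "x = y(j := v)" "x(i := u) = y"
      unfolding doubleton_eq_iff by blast
    then show "s = t"
    proof cases
      case 1
      have "(x(i := u)) i = (y(j := v)) i" "(x(i := u)) j = (y(j := v)) j" using 1(2) by simp_all
      then have "i = j" using ne 1(1) by (auto split: if_splits)
      then show ?thesis using 1 s t by (metis fun_upd_same)
    next
      \<comment> \<open>With the ends interchanged, each would be the upper end of the same
        edge.\<close>
      case 2
      have xj: "x j = v" using 2(1) by simp
      have yi: "y i = u" using 2(2) by (metis fun_upd_same)
      have "i = j"
      proof (rule ccontr)
        assume "i \<noteq> j"
        then have "x i = y i" using 2(1) by simp
        then show False using yi ne by simp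
      qed
      then show ?thesis using sx ty xj yi by simp
    qed
  qed
  moreover have "\<phi> ` D = inner_edges (cart_prod H S) A"
  proof
    show "\<phi> ` D \<subseteq> inner_edges (cart_prod H S) A"
    proof
      fix e assume "e \<in> \<phi> ` D"
      then obtain x i u where xiu: "x \<in> A" "i \<in> S" "u \<in> B x i" "e = {x, x(i := u)}"
        unfolding D_def \<phi>_def by auto
      define y where "y = x(i := u)"
      have u: "u \<in> verts (H i)" "\<rho> i u < \<rho> i (x i)" "{u, x i} \<in> edges (H i)" using xiu(3) unfolding B_def by auto
      have yA: "y \<in> A" unfolding y_def using down[OF xiu(1,2) u(1,2)] .
      have "{x i, y i} \<in> edges (H i) \<and> (\<forall>j\<in>S - {i}. x j = y j)"
        using u unfolding y_def by (simp add: insert_commute)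
      then have "e \<in> edges (cart_prod H S)"
        unfolding cart_prod_def xiu(4) y_def[symmetric] using AV[OF xiu(1)] AV[OF yA] xiu(2) by auto
      then show "e \<in> inner_edges (cart_prod H S) A"
        unfolding edges_between_def using xiu(1,4) yA y_def by auto
    qed
    show "inner_edges (cart_prod H S) A \<subseteq> \<phi> ` D"
    proof
      fix e assume e: "e \<in> inner_edges (cart_prod H S) A"
      then obtain u v where uv: "u \<in> A" "v \<in> A" "e = {u, v}" "e \<in> edges (cart_prod H S)"
        unfolding edges_between_def by auto
      from uv(4) obtain x y i where xy: "e = {x, y}" "i \<in> S" "{x i, y i} \<in> edges (H i)" "\<forall>j\<in>S - {i}. x j = y j"
        unfolding cart_prod_def by auto
      have xyA: "x \<in> A" "y \<in> A" using uv xy by (auto simp: doubleton_eq_iff)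
      have key: "e \<in> \<phi> ` D" if ab: "a \<in> A" "b \<in> A" "e = {a, b}" "{b i, a i} \<in> edges (H i)"
        "\<forall>j\<in>S - {i}. a j = b j" "\<rho> i (b i) < \<rho> i (a i)" for a b
      proof -
        have "b = a(i := b i)"
        proof
          fix j show "b j = (a(i := b i)) j"
            using ab(5) AV[OF ab(1)] AV[OF ab(2)] by (cases "j \<in> S") (auto simp: PiE_iff extensional_def)
        qed
        then have "e = \<phi> (a, i, b i)" using ab(3) unfolding \<phi>_def by simp
        moreover have "(a, i, b i) \<in> D"
          unfolding D_def B_def using ab xy(2) edgeD(1)[OF simple[OF xy(2)] ab(4)] by simp
        ultimately show ?thesis by blast
      qed
      have "\<rho> i (x i) \<noteq> \<rho> i (y i)"
        using edgeD[OF simple[OF xy(2)] xy(3)] inj[OF xy(2)] unfolding inj_on_def by blast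
      then consider "\<rho> i (x i) < \<rho> i (y i)" | "\<rho> i (y i) < \<rho> i (x i)" by linarith
      then show "e \<in> \<phi> ` D"
      proof cases
        case 1
        show ?thesis by (rule key[OF xyA(2,1)]) (use xy 1 in \<open>auto simp: insert_commute\<close>)
      next
        case 2
        show ?thesis by (rule key[OF xyA]) (use xy 2 in \<open>auto simp: insert_commute\<close>)
      qed
    qed
  qed
  ultimately have "card (inner_edges (cart_prod H S) A) = card D" by (metis card_image)
  also have "\<dots> = (\<Sum>x\<in>A. \<Sum>i\<in>S. card (B x i))"
    unfolding D_def using finA fin finB by simp
  finally show ?thesis unfolding B_def back_degree_def .
qed

text \<open>Lets the optimality of a domination order on a block, stated for an induced subgraph, be
  read in the product of the graphs induced by the parts.\<close>

lemma induced_cart_prod: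
  "induced_subgraph (cart_prod G S) (PiE S Z) = cart_prod (\<lambda>i. induced_subgraph (G i) (Z i)) S"
proof -
  have V: "(\<Pi>\<^sub>E i\<in>S. verts (G i)) \<inter> PiE S Z = (\<Pi>\<^sub>E i\<in>S. verts (G i) \<inter> Z i)"
    by (auto simp: PiE_iff)
  have E: "{e \<in> edges (cart_prod G S). e \<subseteq> PiE S Z} = edges (cart_prod (\<lambda>i. induced_subgraph (G i) (Z i)) S)"
  proof (rule set_eqI, rule iffI)
    fix e assume "e \<in> {e \<in> edges (cart_prod G S). e \<subseteq> PiE S Z}"
    then obtain x y i where xy: "e = {x, y}" "x \<in> (\<Pi>\<^sub>E i\<in>S. verts (G i))" "y \<in> (\<Pi>\<^sub>E i\<in>S. verts (G i))"
      "i \<in> S" "{x i, y i} \<in> edges (G i)" "\<forall>j\<in>S - {i}. x j = y j" "x \<in> PiE S Z" "y \<in> PiE S Z"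
      unfolding cart_prod_def by auto
    then have "x \<in> (\<Pi>\<^sub>E i\<in>S. verts (G i) \<inter> Z i)" "y \<in> (\<Pi>\<^sub>E i\<in>S. verts (G i) \<inter> Z i)"
      "{x i, y i} \<subseteq> Z i" using V by auto
    then show "e \<in> edges (cart_prod (\<lambda>i. induced_subgraph (G i) (Z i)) S)"
      unfolding cart_prod_def induced_subgraph_def using xy by auto
  next
    fix e assume "e \<in> edges (cart_prod (\<lambda>i. induced_subgraph (G i) (Z i)) S)"
    then obtain x y i where xy: "e = {x, y}" "x \<in> (\<Pi>\<^sub>E i\<in>S. verts (G i) \<inter> Z i)" "y \<in> (\<Pi>\<^sub>E i\<in>S. verts (G i) \<inter> Z i)"
      "i \<in> S" "{x i, y i} \<in> edges (G i)" "\<forall>j\<in>S - {i}. x j = y j"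
      unfolding cart_prod_def induced_subgraph_def by auto
    then show "e \<in> {e \<in> edges (cart_prod G S). e \<subseteq> PiE S Z}"
      unfolding cart_prod_def using V by auto
  qed
  show ?thesis
    unfolding induced_subgraph_def[of "cart_prod G S"] E
    using V by (simp add: cart_prod_def induced_subgraph_def)
qed

lemma simple_induced:
  assumes "simple_graph G"
  shows "simple_graph (induced_subgraph G Z)"
proof -
  have "e \<in> {{u, v} |u v. u \<in> verts G \<inter> Z \<and> v \<in> verts G \<inter> Z \<and> u \<noteq> v}"
    if e: "e \<in> edges G" "e \<subseteq> Z" for e
  proof -
    obtain u v where "e = {u, v}" "u \<in> verts G" "v \<in> verts G" "u \<noteq> v"
      using assms e unfolding simple_graph_def by auto
    then show ?thesis using e(2) by blast
  qed
  then show ?thesis using assms unfolding simple_graph_def induced_subgraph_def by simp blast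
qed

text \<open>\<open>rank_in\<close> is one more than the number of predecessors, which gives the
  non-strict comparison with the size of a set closed under predecessors.\<close>

lemma ord_interval_rank_in:
  assumes fin: "finite V" and V: "verts H = V" and B: "B \<subseteq> V"
    and irrefl: "\<And>x. x \<in> V \<Longrightarrow> \<not> lt x x"
    and total: "\<And>x y. x \<in> V \<Longrightarrow> y \<in> V \<Longrightarrow> x \<noteq> y \<Longrightarrow> lt x y \<or> lt y x"
    and closed: "\<And>x y. x \<in> B \<Longrightarrow> y \<in> V \<Longrightarrow> lt y x \<Longrightarrow> y \<in> B"
  shows "v \<in> V \<Longrightarrow> rank_in lt V v \<le> card B \<longleftrightarrow> v \<in> B"
    and "ord_interval H (rank_in lt V) 1 (card B) = B"
proof -
  have *: "rank_in lt V v \<le> card B \<longleftrightarrow> v \<in> B" if v: "v \<in> V" for v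
  proof
    assume "v \<in> B"
    then have "{u \<in> V. lt u v} \<subset> B" using closed irrefl v by blast
    then have "card {u \<in> V. lt u v} < card B" using fin B finite_subset by (intro psubset_card_mono) auto
    then show "rank_in lt V v \<le> card B" unfolding rank_in_def by simp
  next
    assume r: "rank_in lt V v \<le> card B"
    show "v \<in> B"
    proof (rule ccontr)
      assume "v \<notin> B"
      have "B \<subseteq> {u \<in> V. lt u v}"
      proof
        fix u assume u: "u \<in> B"
        then have "u \<in> V" "u \<noteq> v" "\<not> lt v u" using B \<open>v \<notin> B\<close> closed[OF u v] by auto
        then show "u \<in> {u \<in> V. lt u v}" using total[of u v] v by auto
      qed
      then have "card B \<le> card {u \<in> V. lt u v}" using fin by (intro card_mono) auto
      then show False using r unfolding rank_in_def by simp
    qed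
  qed
  then show "v \<in> V \<Longrightarrow> rank_in lt V v \<le> card B \<longleftrightarrow> v \<in> B" .
  have "1 \<le> rank_in lt V v" for v unfolding rank_in_def by simp
  then show "ord_interval H (rank_in lt V) 1 (card B) = B"
    unfolding ord_interval_def V using * B by auto
qed

lemma inner_edges_le_max:
  assumes "finite (verts H)" "A \<subseteq> verts H"
  shows "card (inner_edges H A) \<le> max_inner_edges H (card A)"
proof -
  let ?F = "{B. B \<subseteq> verts H \<and> card B = card A}"
  have "?F \<subseteq> Pow (verts H)" by blast
  then have fin: "finite ?F" using assms(1) by (simp add: finite_subset)
  have "A \<in> ?F" using assms(2) by simp
  then show ?thesis
    unfolding max_inner_edges_def by (intro Max_ge finite_imageI[OF fin] imageI)
qed

text \<open>\<open>B\<close> is an initial segment, so optimality bounds the edges of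
  \<open>A\<close> by those of \<open>B\<close>. As \<open>lt\<close> extends the coordinatewise
  order, \<open>B\<close> is down-closed as well, and both edge counts turn into weights.\<close>

lemma optimal_order_down:
  fixes \<rho> :: "nat \<Rightarrow> 'a \<Rightarrow> nat"
  assumes fin: "finite S" and simple: "\<And>i. i \<in> S \<Longrightarrow> simple_graph (H i)"
    and inj: "\<And>i. i \<in> S \<Longrightarrow> inj_on (\<rho> i) (verts (H i))"
    and V: "V = (\<Pi>\<^sub>E i\<in>S. verts (H i))"
    and opt: "optimal_order (cart_prod H S) (rank_in lt V)"
    and irrefl: "\<And>x. x \<in> V \<Longrightarrow> \<not> lt x x"
    and total: "\<And>x y. x \<in> V \<Longrightarrow> y \<in> V \<Longrightarrow> x \<noteq> y \<Longrightarrow> lt x y \<or> lt y x"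
    and mono: "\<And>x y. x \<in> V \<Longrightarrow> y \<in> V \<Longrightarrow> x \<noteq> y \<Longrightarrow> (\<And>i. i \<in> S \<Longrightarrow> \<rho> i (x i) \<le> \<rho> i (y i)) \<Longrightarrow> lt x y"
    and A: "A \<subseteq> V"
    and down: "\<And>x i v. x \<in> A \<Longrightarrow> i \<in> S \<Longrightarrow> v \<in> verts (H i) \<Longrightarrow> \<rho> i v < \<rho> i (x i) \<Longrightarrow> x(i := v) \<in> A"
    and B: "B \<subseteq> V" and closed: "\<And>x y. x \<in> B \<Longrightarrow> y \<in> V \<Longrightarrow> lt y x \<Longrightarrow> y \<in> B"
    and card: "card A = card B"
  shows "(\<Sum>x\<in>A. \<Sum>i\<in>S. back_degree (H i) (\<rho> i) (x i)) \<le> (\<Sum>x\<in>B. \<Sum>i\<in>S. back_degree (H i) (\<rho> i) (x i))"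
proof (cases "A = {}")
  case True
  then show ?thesis by simp
next
  case False
  have VV: "verts (cart_prod H S) = V" using verts_cart_prod V by simp
  have finV: "finite V" using finite_verts_cart_prod[of S H, OF fin simple] VV by simp
  have finA: "finite A" using A finV finite_subset by blast
  have k: "card A \<in> {1..card (verts (cart_prod H S))}"
    using False finA card_mono[OF finV A] VV by (auto simp: Suc_le_eq card_gt_0_iff)
  have downB: "x(i := v) \<in> B" if x: "x \<in> B" "i \<in> S" "v \<in> verts (H i)" "\<rho> i v < \<rho> i (x i)" for x i v
  proof (rule closed[OF x(1)])
    have xV: "x \<in> V" using x B by auto
    show V': "x(i := v) \<in> V" using xV x unfolding V by (intro PiE_upd) auto
    have "(x(i := v)) i \<noteq> x i" using x(4) by auto
    then have "x(i := v) \<noteq> x" by metis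
    then show "lt (x(i := v)) x" using x(4) by (intro mono V' xV) auto
  qed
  have "card (inner_edges (cart_prod H S) A) \<le> max_inner_edges (cart_prod H S) (card A)"
    using finV A VV by (intro inner_edges_le_max) auto
  also have "\<dots> = card (inner_edges (cart_prod H S) (ord_interval (cart_prod H S) (rank_in lt V) 1 (card A)))"
    using opt k unfolding optimal_order_def by simp
  also have "ord_interval (cart_prod H S) (rank_in lt V) 1 (card A) = B"
    unfolding card by (rule ord_interval_rank_in(2)[OF finV VV B irrefl total closed])
  finally have "card (inner_edges (cart_prod H S) A) \<le> card (inner_edges (cart_prod H S) B)" .
  moreover have "card (inner_edges (cart_prod H S) A) = (\<Sum>x\<in>A. \<Sum>i\<in>S. back_degree (H i) (\<rho> i) (x i))"
    by (rule card_inner_edges_down[OF fin simple inj _ down]) (use A VV in auto)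
  moreover have "card (inner_edges (cart_prod H S) B) = (\<Sum>x\<in>B. \<Sum>i\<in>S. back_degree (H i) (\<rho> i) (x i))"
    by (rule card_inner_edges_down[OF fin simple inj _ downB]) (use B VV in auto)
  ultimately show ?thesis by simp
qed

text \<open>The first \<open>m\<close> and the first \<open>m - 1\<close> vertices both attain the
  maximum, so \<delta> counts the edges gained when the vertex of rank \<open>m\<close> is
  added.\<close>

lemma delta_eq_back_degree:
  assumes simple: "simple_graph H" and opt: "optimal_order H \<rho>" and v: "v \<in> verts H"
  shows "delta H (\<rho> v) = int (back_degree H \<rho> v)"
proof -
  have bij: "bij_betw \<rho> (verts H) {1..card (verts H)}"
    using opt unfolding optimal_order_def total_order_on_graph_def by simp
  have fin: "finite (verts H)" by (rule finite_verts[OF simple])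
  have rng: "1 \<le> \<rho> u" "\<rho> u \<le> card (verts H)" if "u \<in> verts H" for u
    using bij that unfolding bij_betw_def by auto
  have inj: "\<rho> u = \<rho> w \<longleftrightarrow> u = w" if "u \<in> verts H" "w \<in> verts H" for u w
    using bij that unfolding bij_betw_def inj_on_def by auto
  define O' where "O' k = ord_interval H \<rho> 1 k" for k
  have O': "u \<in> O' k \<longleftrightarrow> u \<in> verts H \<and> \<rho> u \<le> k" for u k
    unfolding O'_def ord_interval_def using rng by auto
  show ?thesis
  proof (cases "\<rho> v \<le> 1")
    \<comment> \<open>The value 0 that \<open>delta\<close> takes at 1 by definition fits: the first
      vertex has no predecessors.\<close>
    case True
    then have *: "{u \<in> verts H. \<rho> u < \<rho> v \<and> {u, v} \<in> edges H} = {}" using rng by fastforce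
    show ?thesis using True unfolding delta_def back_degree_def * by simp
  next
    case False
    define m where "m = \<rho> v"
    have m: "2 \<le> m" "m \<le> card (verts H)" using False rng[OF v] unfolding m_def by auto
    define N where "N = {u \<in> verts H. \<rho> u < \<rho> v \<and> {u, v} \<in> edges H}"
    define E where "E = (\<lambda>u. {u, v}) ` N"
    have eq: "inner_edges H (O' m) = inner_edges H (O' (m - 1)) \<union> E"
    proof (rule set_eqI, rule iffI)
      fix e assume "e \<in> inner_edges H (O' m)"
      then obtain x y where e: "e = {x, y}" "e \<in> edges H" "x \<in> O' m" "y \<in> O' m"
        unfolding edges_between_def by auto
      have xy: "x \<noteq> y" using edgeD(3)[OF simple] e by blast
      have xV: "x \<in> verts H" "y \<in> verts H" "\<rho> x \<le> m" "\<rho> y \<le> m" using e O' by auto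
      have vm: "\<rho> w = m \<longleftrightarrow> w = v" if "w \<in> verts H" for w unfolding m_def using inj[OF that v] .
      consider "x = v" | "y = v" | "x \<noteq> v" "y \<noteq> v" by blast
      then show "e \<in> inner_edges H (O' (m - 1)) \<union> E"
      proof cases
        case 1
        have "\<rho> y < m" using xV vm[of y] 1 xy by force
        then have "y \<in> N" unfolding N_def using xV e 1 m_def by (simp add: insert_commute)
        then show ?thesis using e 1 unfolding E_def by (auto simp: insert_commute)
      next
        case 2
        have "\<rho> x < m" using xV vm[of x] 2 xy by force
        then have "x \<in> N" unfolding N_def using xV e 2 m_def by simp
        then show ?thesis using e 2 unfolding E_def by auto
      next
        case 3
        then have "\<rho> x \<noteq> m" "\<rho> y \<noteq> m" using vm xV by auto
        then have "x \<in> O' (m - 1)" "y \<in> O' (m - 1)" using O' xV by auto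
        then show ?thesis using e unfolding edges_between_def by auto
      qed
    next
      fix e assume "e \<in> inner_edges H (O' (m - 1)) \<union> E"
      then show "e \<in> inner_edges H (O' m)"
      proof
        assume "e \<in> inner_edges H (O' (m - 1))"
        moreover have "O' (m - 1) \<subseteq> O' m" using O' by auto
        ultimately show ?thesis unfolding edges_between_def by blast
      next
        assume "e \<in> E"
        then obtain u where u: "u \<in> verts H" "\<rho> u < \<rho> v" "{u, v} \<in> edges H" "e = {u, v}"
          unfolding E_def N_def by auto
        then have "u \<in> O' m" "v \<in> O' m" using O' v m_def by auto
        then show ?thesis using u unfolding edges_between_def by auto
      qed
    qed
    have disj: "inner_edges H (O' (m - 1)) \<inter> E = {}"
    proof (rule ccontr)
      assume "inner_edges H (O' (m - 1)) \<inter> E \<noteq> {}"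
      then obtain u x y where uxy: "{u, v} = {x, y}" "x \<in> O' (m - 1)" "y \<in> O' (m - 1)"
        unfolding E_def edges_between_def by auto
      have "v \<in> {x, y}" unfolding uxy(1)[symmetric] by simp
      then have "v \<in> O' (m - 1)" using uxy by auto
      then have "\<rho> v \<le> m - 1" using O' by simp
      then show False using m m_def by simp
    qed
    have "edges H \<subseteq> Pow (verts H)" using simple unfolding simple_graph_def by auto
    then have finE: "finite (edges H)" using fin finite_subset by blast
    have "finite (inner_edges H (O' (m - 1)))" "finite E"
      using finE fin unfolding edges_between_def E_def N_def by auto
    then have "card (inner_edges H (O' m)) = card (inner_edges H (O' (m - 1))) + card E"
      unfolding eq using disj by (rule card_Un_disjoint)
    moreover have "card E = card N"
      unfolding E_def
    proof (rule card_image, rule inj_onI)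
      fix u w assume "u \<in> N" "w \<in> N" "{u, v} = {w, v}"
      then show "u = w" by (auto simp: doubleton_eq_iff)
    qed
    moreover have mm: "m \<in> {1..card (verts H)}" "m - 1 \<in> {1..card (verts H)}" using m by auto
    moreover have "card (inner_edges H (O' m)) = max_inner_edges H m"
      "card (inner_edges H (O' (m - 1))) = max_inner_edges H (m - 1)"
      using opt mm unfolding optimal_order_def O'_def by blast+
    moreover have "delta H m = int (max_inner_edges H m) - int (max_inner_edges H (m - 1))"
      using m unfolding delta_def by simp
    moreover have "back_degree H \<rho> v = card N" unfolding back_degree_def N_def ..
    ultimately show ?thesis unfolding m_def[symmetric] by simp
  qed
qed


section \<open>Lexicographic orders and isoperimetric partitions\<close>

lemma lex_less_irrefl: "\<not> lex_less k x x"
  unfolding lex_less_def by simp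

lemma lex_less_trans:
  assumes "lex_less k x y" "lex_less k y z"
  shows "lex_less k x z"
proof -
  obtain i where i: "i < k" "\<forall>j\<in>{1..i}. x j = y j" "x (i + 1) < y (i + 1)"
    using assms(1) unfolding lex_less_def by blast
  obtain l where l: "l < k" "\<forall>j\<in>{1..l}. y j = z j" "y (l + 1) < z (l + 1)"
    using assms(2) unfolding lex_less_def by blast
  consider "i < l" | "l < i" | "i = l" by linarith
  then show ?thesis
  proof cases
    case 1
    then have "y (i + 1) = z (i + 1)" using l(2) by simp
    then show ?thesis unfolding lex_less_def using i l 1 by (intro exI[of _ i]) simp
  next
    case 2
    then have "x (l + 1) = y (l + 1)" using i(2) by simp
    then show ?thesis unfolding lex_less_def using i l 2 by (intro exI[of _ l]) simp
  next
    case 3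
    then have "x (i + 1) < z (i + 1)" using i(3) l(3) by simp
    then show ?thesis unfolding lex_less_def using i l 3 by (intro exI[of _ i]) simp
  qed
qed

lemma lex_less_total:
  assumes "j \<in> {1..k}" "x j \<noteq> y j"
  shows "lex_less k x y \<or> lex_less k y x"
proof -
  define m where "m = (LEAST j. j \<in> {1..k} \<and> x j \<noteq> y j)"
  have m: "m \<in> {1..k} \<and> x m \<noteq> y m" unfolding m_def by (rule LeastI[of _ j]) (use assms in simp)
  have lo: "x i = y i" if "i \<in> {1..m - 1}" for i
    using not_less_Least[of i "\<lambda>j. j \<in> {1..k} \<and> x j \<noteq> y j"] that m unfolding m_def[symmetric] by auto
  have m1: "m - 1 < k" "m - 1 + 1 = m" using m by auto
  consider "x m < y m" | "y m < x m" using m by (meson linorder_neqE)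
  then show ?thesis
  proof cases
    case 1
    then have "lex_less k x y" unfolding lex_less_def using m1 lo by (intro exI[of _ "m - 1"]) auto
    then show ?thesis ..
  next
    case 2
    then have "lex_less k y x" unfolding lex_less_def using m1 lo by (intro exI[of _ "m - 1"]) auto
    then show ?thesis ..
  qed
qed

lemma lex_less_mono:
  assumes le: "\<And>j. j \<in> {1..k} \<Longrightarrow> x j \<le> y j" and "j \<in> {1..k}" "x j \<noteq> y j"
  shows "lex_less k x y"
proof -
  have "\<not> lex_less k y x"
  proof
    assume "lex_less k y x"
    then obtain i where "i < k" "y (i + 1) < x (i + 1)" unfolding lex_less_def by blast
    then show False using le[of "i + 1"] by simp
  qed
  then show ?thesis using lex_less_total[of j k x y, OF assms(2,3)] by blast
qed

lemma lex_less_cong: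
  assumes "\<And>j. j \<in> {1..k} \<Longrightarrow> x j = x' j" "\<And>j. j \<in> {1..k} \<Longrightarrow> y j = y' j"
  shows "lex_less k x y \<longleftrightarrow> lex_less k x' y'"
proof -
  have "(\<forall>j\<in>{1..i}. x j = y j) \<longleftrightarrow> (\<forall>j\<in>{1..i}. x' j = y' j)" if "i < k" for i
    using assms that by (intro ball_cong) auto
  then show ?thesis unfolding lex_less_def using assms by (intro ex_cong1) auto
qed

lemma index_elem_bij:
  assumes "finite S"
  shows "bij_betw (index_elem S) {1..card S} S"
proof -
  have "bij_betw (\<lambda>i. sorted_list_of_set S ! i) {..<card S} S"
    using bij_betw_nth[of "sorted_list_of_set S" "{..<card S}" S] assms by simp
  moreover have "bij_betw (\<lambda>j. j - 1) {1..card S} {..<card S}"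
    by (rule bij_betwI[of _ _ _ Suc]) auto
  ultimately have "bij_betw ((\<lambda>i. sorted_list_of_set S ! i) \<circ> (\<lambda>j. j - 1)) {1..card S} S"
    by (rule bij_betw_trans[rotated])
  moreover have "(\<lambda>i. sorted_list_of_set S ! i) \<circ> (\<lambda>j. j - 1) = index_elem S"
    by (auto simp: index_elem_def)
  ultimately show ?thesis by simp
qed

lemma index_elem_mono:
  assumes "finite S" "1 \<le> i" "i < j" "j \<le> card S"
  shows "index_elem S i < index_elem S j"
  unfolding index_elem_def
  by (rule sorted_wrt_nth_less[of "(<)"]) (use assms in auto)

text \<open>\<open>index_elem\<close> lists \<open>S\<close> increasingly, so the first differing
  position of the tuples is the least differing element of \<open>S\<close>. Comparisons of block
  starts can then be stated over coordinates.\<close>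

lemma lex_less_index:
  assumes fin: "finite S"
  shows "lex_less (card S) (\<lambda>j. F (index_elem S j)) (\<lambda>j. F' (index_elem S j))
    \<longleftrightarrow> (\<exists>k\<in>S. F k < F' k \<and> (\<forall>i\<in>S. i < k \<longrightarrow> F i = F' i))" (is "?L \<longleftrightarrow> ?R")
proof -
  note b = index_elem_bij[OF fin]
  have idx: "index_elem S ` {1..card S} = S" using b by (simp add: bij_betw_def)
  have below: "{i \<in> S. i < index_elem S (m + 1)} = index_elem S ` {1..m}" if "m < card S" for m
  proof
    show "index_elem S ` {1..m} \<subseteq> {i \<in> S. i < index_elem S (m + 1)}"
    proof
      fix i assume "i \<in> index_elem S ` {1..m}"
      then obtain j where j: "j \<in> {1..m}" "i = index_elem S j" by blast
      then have "j \<in> {1..card S}" using that by simp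
      then have "index_elem S j \<in> index_elem S ` {1..card S}" by (rule imageI)
      then have "i \<in> S" unfolding idx j(2) .
      then show "i \<in> {i \<in> S. i < index_elem S (m + 1)}"
        using index_elem_mono[OF fin, of j "m + 1"] j that by simp
    qed
    show "{i \<in> S. i < index_elem S (m + 1)} \<subseteq> index_elem S ` {1..m}"
    proof
      fix i assume i: "i \<in> {i \<in> S. i < index_elem S (m + 1)}"
      then obtain j where j: "j \<in> {1..card S}" "i = index_elem S j" using idx by blast
      have "j \<le> m"
      proof (rule ccontr)
        assume "\<not> j \<le> m"
        then consider "j = m + 1" | "m + 1 < j" by linarith
        then show False
        proof cases
          case 1
          then show ?thesis using i j by simp
        next
          case 2
          then show ?thesis using index_elem_mono[OF fin, of "m + 1" j] i j by simp
        qed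
      qed
      then show "i \<in> index_elem S ` {1..m}" using j by simp
    qed
  qed
  show ?thesis
  proof
    assume ?L
    then obtain m where m: "m < card S" "\<forall>j\<in>{1..m}. F (index_elem S j) = F' (index_elem S j)"
      "F (index_elem S (m + 1)) < F' (index_elem S (m + 1))" unfolding lex_less_def by blast
    have "m + 1 \<in> {1..card S}" using m by simp
    then have "index_elem S (m + 1) \<in> S" using idx by blast
    moreover have "F i = F' i" if "i \<in> S" "i < index_elem S (m + 1)" for i
    proof -
      have "i \<in> index_elem S ` {1..m}" unfolding below[OF m(1), symmetric] using that by simp
      then obtain l where "l \<in> {1..m}" "i = index_elem S l" by (rule imageE)
      then show ?thesis using m(2) by simp
    qed
    ultimately show ?R using m(3) by (intro bexI[of _ "index_elem S (m + 1)"]) simp_all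
  next
    assume ?R
    then obtain k where k: "k \<in> S" "F k < F' k" "\<forall>i\<in>S. i < k \<longrightarrow> F i = F' i" by blast
    obtain j where j: "j \<in> {1..card S}" "k = index_elem S j" using idx k(1) by blast
    define m where "m = j - 1"
    have m: "m < card S" "j = m + 1" using j unfolding m_def by auto
    have "F (index_elem S i) = F' (index_elem S i)" if "i \<in> {1..m}" for i
    proof -
      have "index_elem S i \<in> {i \<in> S. i < index_elem S (m + 1)}"
        unfolding below[OF m(1)] using that by (rule imageI)
      then show ?thesis using k(3) j(2) m(2) by simp
    qed
    then show ?L unfolding lex_less_def using m k(2) j(2) by (intro exI[of _ m]) simp
  qed
qed

section \<open>Interval partitions of a single factor\<close>

definition part_of :: "'a set list \<Rightarrow> 'a \<Rightarrow> 'a set" where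
  "part_of Q v = (THE Z. Z \<in> set Q \<and> v \<in> Z)"

locale ordered_partition =
  fixes H :: "'a sgraph" and \<rho> :: "'a \<Rightarrow> nat" and Q :: "'a set list"
  assumes simple: "simple_graph H" and opt: "optimal_order H \<rho>"
    and part: "isoperimetric_partition H \<rho> Q"
begin

abbreviation "U \<equiv> verts H"
abbreviation "N \<equiv> card (verts H)"

text \<open>Encodes a part by a number: vertices share a part exactly if these numbers agree, and
  parts are ordered as the numbers are.\<close>

definition start :: "'a \<Rightarrow> nat" where
  "start v = \<rho> (part_start \<rho> (part_of Q v))"

lemma bij: "bij_betw \<rho> U {1..N}"
  using opt unfolding optimal_order_def total_order_on_graph_def by simp

lemma rank_range: "v \<in> U \<Longrightarrow> 1 \<le> \<rho> v \<and> \<rho> v \<le> N"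
  using bij unfolding bij_betw_def by auto

lemma rank_inj: "inj_on \<rho> U"
  using bij unfolding bij_betw_def by simp

lemma rank_eq: "u \<in> U \<Longrightarrow> v \<in> U \<Longrightarrow> \<rho> u = \<rho> v \<Longrightarrow> u = v"
  using rank_inj unfolding inj_on_def by blast

lemma finite_U: "finite U"
  by (rule finite_verts[OF simple])

text \<open>Opens the existential definition once for all users. Bounds and separation, which the
  definition gives only at the ends and between neighbours, are added by induction along the
  list.\<close>

lemma intervals:
  obtains a b where "0 < length Q" "a 0 = 1" "b (length Q - 1) = N"
    "\<And>i. i + 1 < length Q \<Longrightarrow> a (i + 1) = b i + 1"
    "\<And>i. i < length Q \<Longrightarrow> a i \<le> b i"
    "\<And>i. i < length Q \<Longrightarrow> Q ! i = {v \<in> U. a i \<le> \<rho> v \<and> \<rho> v \<le> b i}"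
    "\<And>i. i < length Q \<Longrightarrow> optimal_order (induced_subgraph H (Q ! i)) (restrict_order \<rho> (Q ! i))"
    "\<And>i v. i < length Q \<Longrightarrow> v \<in> Q ! i \<Longrightarrow> int (card (edges_between H {u \<in> U. \<rho> u < a i} {v})) = delta H (a i)"
    "\<And>i. i < length Q \<Longrightarrow> 1 \<le> a i \<and> b i \<le> N"
    "\<And>i j. i < j \<Longrightarrow> j < length Q \<Longrightarrow> b i < a j"
proof -
  obtain a b k where ab: "k = length Q" "1 \<le> k" "a 0 = 1" "b (k - 1) = N"
    "\<forall>i. i + 1 < k \<longrightarrow> a (i + 1) = b i + 1"
    "\<forall>i<k. a i \<le> b i \<and> Q ! i = ord_interval H \<rho> (a i) (b i) \<and>
       isoperimetric (induced_subgraph H (Q ! i)) \<and>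
       optimal_order (induced_subgraph H (Q ! i)) (restrict_order \<rho> (Q ! i)) \<and>
       (\<forall>v\<in>Q ! i. int (card (edges_between H (ord_interval H \<rho> 1 (a i - 1)) {v})) = delta H (a i))"
    using part unfolding isoperimetric_partition_def by blast
  have le: "a i \<le> b i" if "i < k" for i using ab(6) that by blast
  have lt: "b i < a j" if "i < j" "j < k" for i j
    using that
  proof (induction j)
    case (Suc j)
    have s: "a (Suc j) = b j + 1" using ab(5) Suc.prems(2) by simp
    show ?case
    proof (cases "i = j")
      case False
      then have "b i < a j" using Suc by simp
      then show ?thesis using s le[of j] Suc.prems(2) by simp
    qed (simp add: s)
  qed simp
  have a1: "1 \<le> a i" if "i < k" for i
    using that lt[of 0 i] ab(3) le[of 0] by (cases "i = 0") auto
  have bN: "b i \<le> N" if "i < k" for i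
  proof (cases "i = k - 1")
    case False
    then have "b i < a (k - 1)" using that by (intro lt) auto
    then show ?thesis using le[of "k - 1"] ab(2,4) by simp
  next
    case True
    then show ?thesis using ab(4) by simp
  qed
  \<comment> \<open>The truncated subtraction is harmless because \<open>a i\<close> is at least
    1.\<close>
  have oi: "ord_interval H \<rho> 1 (a i - 1) = {u \<in> U. \<rho> u < a i}" if "i < k" for i
    unfolding ord_interval_def using rank_range a1[OF that] by fastforce
  show thesis
  proof (rule that[of a b])
    show "Q ! i = {v \<in> U. a i \<le> \<rho> v \<and> \<rho> v \<le> b i}" if "i < length Q" for i
      using ab(1,6) that unfolding ord_interval_def by simp
    show "int (card (edges_between H {u \<in> U. \<rho> u < a i} {v})) = delta H (a i)"
      if "i < length Q" "v \<in> Q ! i" for i v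
    proof -
      have "i < k" using that ab(1) by simp
      then show ?thesis using ab(6) that(2) oi by simp
    qed
    show "optimal_order (induced_subgraph H (Q ! i)) (restrict_order \<rho> (Q ! i))" if "i < length Q" for i
      using ab(1,6) that by blast
    show "1 \<le> a i \<and> b i \<le> N" if "i < length Q" for i using a1 bN ab(1) that by simp
    show "b i < a j" if "i < j" "j < length Q" for i j using lt ab(1) that by simp
    show "a i \<le> b i" if "i < length Q" for i using le ab(1) that by simp
    show "a (i + 1) = b i + 1" if "i + 1 < length Q" for i using ab(1,5) that by blast
  qed (use ab in auto)
qed

lemma interval:
  assumes "Z \<in> set Q"
  obtains \<alpha> \<beta> where "1 \<le> \<alpha>" "\<alpha> \<le> \<beta>" "\<beta> \<le> N" "Z = {v \<in> U. \<alpha> \<le> \<rho> v \<and> \<rho> v \<le> \<beta>}"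
    "optimal_order (induced_subgraph H Z) (restrict_order \<rho> Z)"
    "\<And>v. v \<in> Z \<Longrightarrow> int (card (edges_between H {u \<in> U. \<rho> u < \<alpha>} {v})) = delta H \<alpha>"
proof -
  obtain i where i: "i < length Q" "Z = Q ! i" using assms by (metis in_set_conv_nth)
  show thesis
  proof (rule intervals)
    fix a b
    assume *: "\<And>i. i < length Q \<Longrightarrow> a i \<le> b i"
      "\<And>i. i < length Q \<Longrightarrow> Q ! i = {v \<in> U. a i \<le> \<rho> v \<and> \<rho> v \<le> b i}"
      "\<And>i. i < length Q \<Longrightarrow> optimal_order (induced_subgraph H (Q ! i)) (restrict_order \<rho> (Q ! i))"
      "\<And>i v. i < length Q \<Longrightarrow> v \<in> Q ! i \<Longrightarrow> int (card (edges_between H {u \<in> U. \<rho> u < a i} {v})) = delta H (a i)"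
      "\<And>i. i < length Q \<Longrightarrow> 1 \<le> a i \<and> b i \<le> N"
    show thesis
    proof (rule that)
      show "1 \<le> a i" "b i \<le> N" using *(5)[OF i(1)] by simp_all
      show "a i \<le> b i" by (rule *(1)[OF i(1)])
      show "Z = {v \<in> U. a i \<le> \<rho> v \<and> \<rho> v \<le> b i}" unfolding i(2) by (rule *(2)[OF i(1)])
      show "optimal_order (induced_subgraph H Z) (restrict_order \<rho> Z)" unfolding i(2) by (rule *(3)[OF i(1)])
      show "int (card (edges_between H {u \<in> U. \<rho> u < a i} {v})) = delta H (a i)" if "v \<in> Z" for v
        using that unfolding i(2) by (rule *(4)[OF i(1)])
    qed
  qed
qed

lemma cover:
  assumes v: "v \<in> U"
  shows "\<exists>Z\<in>set Q. v \<in> Z"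
proof (rule intervals)
  fix a b
  assume k: "0 < length Q" and a0: "a 0 = 1" and bN: "b (length Q - 1) = N"
    and a: "\<And>i. i + 1 < length Q \<Longrightarrow> a (i + 1) = b i + 1"
    and Q: "\<And>i. i < length Q \<Longrightarrow> Q ! i = {v \<in> U. a i \<le> \<rho> v \<and> \<rho> v \<le> b i}"
  \<comment> \<open>The intervals with indices up to \<open>i\<close> leave no rank up to
    \<open>b i\<close> uncovered, because the next one starts at \<open>b i + 1\<close>.\<close>
  have "\<exists>j\<le>i. a j \<le> m \<and> m \<le> b j" if "i < length Q" "1 \<le> m" "m \<le> b i" for i m
    using that
  proof (induction i)
    case 0
    then show ?case using a0 by auto
  next
    case (Suc i)
    show ?case
    proof (cases "m \<le> b i")
      case True
      then obtain j where "j \<le> i" "a j \<le> m \<and> m \<le> b j" using Suc by auto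
      then show ?thesis by (intro exI[of _ j]) auto
    next
      case False
      then show ?thesis using a[of i] Suc.prems by (intro exI[of _ "Suc i"]) auto
    qed
  qed
  from this[of "length Q - 1" "\<rho> v"] obtain j where "j \<le> length Q - 1" "a j \<le> \<rho> v" "\<rho> v \<le> b j"
    using diff_less[OF _ k, of 1] bN rank_range[OF v] by auto
  moreover from this(1) have jl: "j < length Q" using k by linarith
  ultimately have "v \<in> Q ! j" using Q[OF jl] v by simp
  then show ?thesis using nth_mem[OF jl] by blast
qed

lemma disjoint:
  assumes "Z \<in> set Q" "Z' \<in> set Q" "v \<in> Z" "v \<in> Z'"
  shows "Z = Z'"
proof (rule intervals)
  fix a b
  assume Q: "\<And>i. i < length Q \<Longrightarrow> Q ! i = {v \<in> U. a i \<le> \<rho> v \<and> \<rho> v \<le> b i}"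
    and lt: "\<And>i j. i < j \<Longrightarrow> j < length Q \<Longrightarrow> b i < a j"
  obtain i where i: "i < length Q" "Z = Q ! i" using assms(1) by (metis in_set_conv_nth)
  obtain j where j: "j < length Q" "Z' = Q ! j" using assms(2) by (metis in_set_conv_nth)
  have "a i \<le> \<rho> v" "\<rho> v \<le> b i" "a j \<le> \<rho> v" "\<rho> v \<le> b j"
    using Q[OF i(1)] Q[OF j(1)] i j assms by auto
  then have "\<not> i < j" "\<not> j < i" using lt[of i j] lt[of j i] i(1) j(1) by auto
  then show ?thesis using i j by simp
qed

lemma Q_ne: "Q \<noteq> []"
  by (rule intervals) auto

lemma N_pos: "1 \<le> N"
proof (rule intervals)
  fix a b :: "nat \<Rightarrow> nat"
  assume "0 < length Q" "\<And>i. i < length Q \<Longrightarrow> a i \<le> b i" "\<And>i. i < length Q \<Longrightarrow> 1 \<le> a i \<and> b i \<le> N"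
  from this(1) this(2)[of 0] this(3)[of 0] show ?thesis by simp
qed

lemma hd_interval: "v \<in> U \<Longrightarrow> \<rho> v = 1 \<Longrightarrow> v \<in> hd Q"
proof (rule intervals)
  fix a b
  assume v: "v \<in> U" "\<rho> v = 1" and k: "0 < length Q" and a0: "a 0 = 1" and le: "\<And>i. i < length Q \<Longrightarrow> a i \<le> b i"
    and Q: "\<And>i. i < length Q \<Longrightarrow> Q ! i = {v \<in> U. a i \<le> \<rho> v \<and> \<rho> v \<le> b i}"
  then have "hd Q = Q ! 0" by (intro hd_conv_nth) auto
  moreover have "v \<in> Q ! 0" using Q[of 0] le[of 0] v a0 k by simp
  ultimately show ?thesis by simp
qed

lemma last_interval: "v \<in> U \<Longrightarrow> \<rho> v = N \<Longrightarrow> v \<in> last Q"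
proof (rule intervals)
  fix a b
  assume v: "v \<in> U" "\<rho> v = N" and k: "0 < length Q" and bN: "b (length Q - 1) = N" and le: "\<And>i. i < length Q \<Longrightarrow> a i \<le> b i"
    and Q: "\<And>i. i < length Q \<Longrightarrow> Q ! i = {v \<in> U. a i \<le> \<rho> v \<and> \<rho> v \<le> b i}"
  then have "last Q = Q ! (length Q - 1)" by (intro last_conv_nth) auto
  moreover have "v \<in> Q ! (length Q - 1)" using Q[of "length Q - 1"] le[of "length Q - 1"] v bN k by simp
  ultimately show ?thesis by simp
qed

lemma part_subset: "Z \<in> set Q \<Longrightarrow> Z \<subseteq> U"
  by (rule interval) auto

lemma part_of_eq:
  assumes "Z \<in> set Q" "v \<in> Z"
  shows "part_of Q v = Z"
  unfolding part_of_def by (rule the_equality) (use assms disjoint in blast)+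

lemma part_of:
  assumes "v \<in> U"
  shows "part_of Q v \<in> set Q" "v \<in> part_of Q v"
  using cover[OF assms] part_of_eq by auto

lemma rank_ex:
  assumes "1 \<le> m" "m \<le> N"
  obtains v where "v \<in> U" "\<rho> v = m"
  using bij assms unfolding bij_betw_def by (metis atLeastAtMost_iff imageE)

lemma part_start:
  assumes "Z \<in> set Q"
  shows "part_start \<rho> Z \<in> Z" "v \<in> Z \<Longrightarrow> \<rho> (part_start \<rho> Z) \<le> \<rho> v"
proof -
  have fin: "finite Z" using part_subset[OF assms] finite_U finite_subset by blast
  have "Z \<noteq> {}"
  proof (rule interval[OF assms])
    fix \<alpha> \<beta> assume "1 \<le> \<alpha>" "\<alpha> \<le> \<beta>" "\<beta> \<le> N" and Z: "Z = {v \<in> U. \<alpha> \<le> \<rho> v \<and> \<rho> v \<le> \<beta>}"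
    then obtain w where "w \<in> U" "\<rho> w = \<alpha>" by (metis order_trans rank_ex)
    then have "w \<in> Z" using Z \<open>\<alpha> \<le> \<beta>\<close> by simp
    then show ?thesis by blast
  qed
  from arg_min_if_finite[OF fin this, of \<rho>]
  show "part_start \<rho> Z \<in> Z" "v \<in> Z \<Longrightarrow> \<rho> (part_start \<rho> Z) \<le> \<rho> v"
    unfolding part_start_def by (auto simp: not_less)
qed

lemma start_interval:
  assumes "v \<in> U"
  obtains \<beta> where "part_of Q v = {u \<in> U. start v \<le> \<rho> u \<and> \<rho> u \<le> \<beta>}" "start v \<le> \<beta>" "1 \<le> start v" "\<beta> \<le> N"
    "optimal_order (induced_subgraph H (part_of Q v)) (restrict_order \<rho> (part_of Q v))"
    "\<And>u. u \<in> part_of Q v \<Longrightarrow> int (card (edges_between H {w \<in> U. \<rho> w < start v} {u})) = delta H (start v)"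
proof (rule interval[OF part_of(1)[OF assms]])
  fix \<alpha> \<beta>
  assume \<alpha>: "1 \<le> \<alpha>" "\<alpha> \<le> \<beta>" "\<beta> \<le> N" "part_of Q v = {u \<in> U. \<alpha> \<le> \<rho> u \<and> \<rho> u \<le> \<beta>}"
    "optimal_order (induced_subgraph H (part_of Q v)) (restrict_order \<rho> (part_of Q v))"
    "\<And>u. u \<in> part_of Q v \<Longrightarrow> int (card (edges_between H {w \<in> U. \<rho> w < \<alpha>} {u})) = delta H \<alpha>"
  obtain w where w: "w \<in> U" "\<rho> w = \<alpha>" using \<alpha>(1-3) by (metis order_trans rank_ex)
  have "\<rho> (part_start \<rho> (part_of Q v)) \<le> \<alpha>"
    using part_start(2)[OF part_of(1)[OF assms], of w] w \<alpha> by simp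
  moreover have "\<alpha> \<le> \<rho> (part_start \<rho> (part_of Q v))"
    using part_start(1)[OF part_of(1)[OF assms]] unfolding \<alpha>(4) by simp
  ultimately have "start v = \<alpha>" unfolding start_def by simp
  then show thesis using that[of \<beta>] \<alpha> by simp
qed

lemma start_mono:
  assumes "u \<in> U" "v \<in> U" "\<rho> u \<le> \<rho> v"
  shows "start u \<le> start v"
proof (rule ccontr)
  assume less: "\<not> start u \<le> start v"
  obtain \<beta> where \<beta>: "part_of Q v = {u \<in> U. start v \<le> \<rho> u \<and> \<rho> u \<le> \<beta>}" by (rule start_interval[OF assms(2)])
  obtain \<beta>' where \<beta>': "part_of Q u = {w \<in> U. start u \<le> \<rho> w \<and> \<rho> w \<le> \<beta>'}" by (rule start_interval[OF assms(1)])
  have "start u \<le> \<rho> u" using part_of(2)[OF assms(1)] unfolding \<beta>' by simp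
  moreover have "\<rho> v \<le> \<beta>" using part_of(2)[OF assms(2)] unfolding \<beta> by simp
  ultimately have "u \<in> part_of Q v" unfolding \<beta> using assms less by simp
  then have "part_of Q u = part_of Q v" by (rule part_of_eq[OF part_of(1)[OF assms(2)]])
  then show False using less unfolding start_def by simp
qed

lemma start_eq_iff:
  assumes "u \<in> U" "v \<in> U"
  shows "start u = start v \<longleftrightarrow> part_of Q u = part_of Q v"
proof
  assume eq: "start u = start v"
  define s t where "s = part_start \<rho> (part_of Q u)" and "t = part_start \<rho> (part_of Q v)"
  have st: "s \<in> part_of Q u" "t \<in> part_of Q v"
    unfolding s_def t_def using part_start(1) part_of(1) assms by blast+
  then have "s \<in> U" "t \<in> U" using part_subset part_of(1) assms by blast+
  then have "s = t" using eq rank_eq unfolding start_def s_def t_def by blast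
  then show "part_of Q u = part_of Q v" using disjoint st part_of(1) assms by blast
qed (simp add: start_def)

text \<open>Lower neighbours outside the part lie in earlier parts, and the partition condition
  gives all vertices of a part the same number of these. Only the second summand varies within a
  part.\<close>

lemma back_degree_split:
  assumes v: "v \<in> U"
  shows "int (back_degree H \<rho> v) = delta H (start v) + int (back_degree (induced_subgraph H (part_of Q v)) \<rho> v)"
proof (rule start_interval[OF v])
  fix \<beta> assume \<beta>: "part_of Q v = {u \<in> U. start v \<le> \<rho> u \<and> \<rho> u \<le> \<beta>}"
    and e: "\<And>u. u \<in> part_of Q v \<Longrightarrow> int (card (edges_between H {w \<in> U. \<rho> w < start v} {u})) = delta H (start v)"
  have vb: "start v \<le> \<rho> v" "\<rho> v \<le> \<beta>" using part_of(2)[OF v] unfolding \<beta> by auto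
  define X where "X = {u \<in> U. \<rho> u < start v \<and> {u, v} \<in> edges H}"
  define Y where "Y = {u \<in> U. start v \<le> \<rho> u \<and> \<rho> u < \<rho> v \<and> {u, v} \<in> edges H}"
  have "{u \<in> U. \<rho> u < \<rho> v \<and> {u, v} \<in> edges H} = X \<union> Y" unfolding X_def Y_def using vb by auto
  moreover have "X \<inter> Y = {}" unfolding X_def Y_def by auto
  moreover have "finite X" "finite Y" using finite_U unfolding X_def Y_def by auto
  ultimately have "back_degree H \<rho> v = card X + card Y" unfolding back_degree_def by (simp add: card_Un_disjoint)
  moreover have "edges_between H {w \<in> U. \<rho> w < start v} {v} = (\<lambda>u. {u, v}) ` X"
    unfolding edges_between_def X_def by blast
  moreover have "inj_on (\<lambda>u. {u, v}) X" by (rule inj_onI) (auto simp: doubleton_eq_iff)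
  ultimately have "int (back_degree H \<rho> v) = delta H (start v) + int (card Y)"
    using e[OF part_of(2)[OF v]] by (simp add: card_image)
  moreover have "{u \<in> verts (induced_subgraph H (part_of Q v)). \<rho> u < \<rho> v \<and>
      {u, v} \<in> edges (induced_subgraph H (part_of Q v))} = Y"
    unfolding induced_subgraph_def Y_def using part_of(2)[OF v] vb unfolding \<beta> by auto
  ultimately show ?thesis unfolding back_degree_def by simp
qed

text \<open>Both ranks count from 1, so restriction subtracts \<open>start v - 1\<close>; the
  additive form avoids truncated subtraction.\<close>

lemma restrict_order_eq:
  assumes v: "v \<in> U" and u: "u \<in> part_of Q v"
  shows "restrict_order \<rho> (part_of Q v) u + start v = \<rho> u + 1"
proof (rule start_interval[OF v])
  fix \<beta> assume \<beta>: "part_of Q v = {u \<in> U. start v \<le> \<rho> u \<and> \<rho> u \<le> \<beta>}" and s: "1 \<le> start v"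
  have ub: "u \<in> U" "start v \<le> \<rho> u" "\<rho> u \<le> \<beta>" using u unfolding \<beta> by auto
  have "\<rho> ` {w \<in> part_of Q v. \<rho> w < \<rho> u} = {start v..<\<rho> u}"
  proof
    show "\<rho> ` {w \<in> part_of Q v. \<rho> w < \<rho> u} \<subseteq> {start v..<\<rho> u}" unfolding \<beta> by auto
    show "{start v..<\<rho> u} \<subseteq> \<rho> ` {w \<in> part_of Q v. \<rho> w < \<rho> u}"
    proof
      fix m assume m: "m \<in> {start v..<\<rho> u}"
      then obtain w where "w \<in> U" "\<rho> w = m" using rank_ex[of m] s rank_range[OF ub(1)] by auto
      then show "m \<in> \<rho> ` {w \<in> part_of Q v. \<rho> w < \<rho> u}" unfolding \<beta> using m ub by auto
    qed
  qed
  moreover have "inj_on \<rho> {w \<in> part_of Q v. \<rho> w < \<rho> u}"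
    using rank_inj by (rule inj_on_subset) (use \<beta> in auto)
  ultimately have "card {w \<in> part_of Q v. \<rho> w < \<rho> u} = \<rho> u - start v" by (metis card_image card_atLeastLessThan)
  then show ?thesis unfolding restrict_order_def rank_in_def using ub by simp
qed

text \<open>The restricted order is optimal on the part, so the inner summand is the value of the
  part's own \<delta>-sequence at the place of \<open>v\<close>.\<close>

lemma back_degree_delta:
  assumes v: "v \<in> U"
  shows "int (back_degree H \<rho> v) = delta H (start v) + delta (induced_subgraph H (part_of Q v)) (\<rho> v + 1 - start v)"
proof -
  define Z where "Z = part_of Q v"
  have vZ: "v \<in> Z" "Z \<subseteq> U" using part_of[OF v] part_subset unfolding Z_def by auto
  have K: "verts (induced_subgraph H Z) = Z" using vZ unfolding induced_subgraph_def by auto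
  have opt': "optimal_order (induced_subgraph H Z) (restrict_order \<rho> Z)"
    unfolding Z_def by (rule start_interval[OF v])
  have req: "restrict_order \<rho> Z u + start v = \<rho> u + 1" if "u \<in> Z" for u
    using restrict_order_eq[OF v] that unfolding Z_def by blast
  have "delta (induced_subgraph H Z) (restrict_order \<rho> Z v) = int (back_degree (induced_subgraph H Z) (restrict_order \<rho> Z) v)"
    by (rule delta_eq_back_degree[OF simple_induced[OF simple] opt']) (use K vZ in simp)
  moreover have "restrict_order \<rho> Z v = \<rho> v + 1 - start v" using req[OF vZ(1)] by simp
  moreover have "{u \<in> Z. restrict_order \<rho> Z u < restrict_order \<rho> Z v \<and> {u, v} \<in> edges (induced_subgraph H Z)}
      = {u \<in> Z. \<rho> u < \<rho> v \<and> {u, v} \<in> edges (induced_subgraph H Z)}"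
    using req req[OF vZ(1)] by (intro Collect_cong) force
  then have "back_degree (induced_subgraph H Z) (restrict_order \<rho> Z) v = back_degree (induced_subgraph H Z) \<rho> v"
    unfolding back_degree_def K by simp
  ultimately show ?thesis using back_degree_split[OF v] unfolding Z_def by simp
qed

text \<open>By the partition condition the value is a number of edges.\<close>

lemma delta_start_nonneg: "v \<in> U \<Longrightarrow> 0 \<le> delta H (start v)"
  by (rule start_interval, assumption) (metis of_nat_0_le_iff part_of(2))

lemma rank_start_le:
  assumes "v \<in> U"
  shows "1 \<le> start v" "start v \<le> \<rho> v"
proof -
  obtain \<beta> where \<beta>: "part_of Q v = {u \<in> U. start v \<le> \<rho> u \<and> \<rho> u \<le> \<beta>}" "1 \<le> start v"
    by (rule start_interval[OF assms])
  show "1 \<le> start v" by (rule \<beta>(2))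
  show "start v \<le> \<rho> v" using part_of(2)[OF assms] unfolding \<beta>(1) by simp
qed

lemma verts_induced_part:
  "Z \<in> set Q \<Longrightarrow> verts (induced_subgraph H Z) = Z"
  using part_subset unfolding induced_subgraph_def by auto

lemma rank_in_part:
  assumes "v \<in> U"
  shows "\<rho> v + 1 - start v \<in> {1..card (part_of Q v)}"
proof -
  have "optimal_order (induced_subgraph H (part_of Q v)) (restrict_order \<rho> (part_of Q v))"
    by (rule start_interval[OF assms])
  then have "restrict_order \<rho> (part_of Q v) v \<in> {1..card (part_of Q v)}"
    using part_of[OF assms] verts_induced_part[OF part_of(1)[OF assms]]
    unfolding optimal_order_def total_order_on_graph_def bij_betw_def by auto
  moreover have "restrict_order \<rho> (part_of Q v) v = \<rho> v + 1 - start v"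
    using restrict_order_eq[OF assms part_of(2)[OF assms]] by simp
  ultimately show ?thesis by simp
qed

lemma card_interval:
  assumes "1 \<le> \<alpha>" "\<beta> \<le> N"
  shows "card {u \<in> U. \<alpha> \<le> \<rho> u \<and> \<rho> u \<le> \<beta>} = \<beta> + 1 - \<alpha>"
proof -
  have "\<rho> ` {u \<in> U. \<alpha> \<le> \<rho> u \<and> \<rho> u \<le> \<beta>} = {\<alpha>..\<beta>}"
  proof
    show "{\<alpha>..\<beta>} \<subseteq> \<rho> ` {u \<in> U. \<alpha> \<le> \<rho> u \<and> \<rho> u \<le> \<beta>}"
    proof
      fix m assume m: "m \<in> {\<alpha>..\<beta>}"
      then obtain w where "w \<in> U" "\<rho> w = m" using rank_ex[of m] assms by auto
      then show "m \<in> \<rho> ` {u \<in> U. \<alpha> \<le> \<rho> u \<and> \<rho> u \<le> \<beta>}" using m by auto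
    qed
  qed auto
  moreover have "inj_on \<rho> {u \<in> U. \<alpha> \<le> \<rho> u \<and> \<rho> u \<le> \<beta>}"
    using rank_inj by (rule inj_on_subset) simp
  ultimately show ?thesis by (metis card_image card_atLeastAtMost Suc_eq_plus1)
qed

end


section \<open>Weighted down-sets in a grid\<close>

text \<open>A bijection matches \<open>X - Y\<close> with \<open>Y - X\<close>, and \<open>f\<close>
  increases along every matched pair. With a position for \<open>f\<close>, this makes the
  termination measure drop.\<close>

lemma sum_exchange_le:
  fixes f :: "'b \<Rightarrow> nat"
  assumes "finite X" "finite Y" "card X = card Y"
    and lt: "\<And>x y. x \<in> X - Y \<Longrightarrow> y \<in> Y - X \<Longrightarrow> f x < f y"
  shows "sum f X \<le> sum f Y" and "X \<noteq> Y \<Longrightarrow> sum f X < sum f Y"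
proof -
  have cX: "sum f X = sum f (X - Y) + sum f (X \<inter> Y)"
    using sum.Int_Diff[OF assms(1), of f Y] by simp
  have cY: "sum f Y = sum f (Y - X) + sum f (X \<inter> Y)"
    using sum.Int_Diff[OF assms(2), of f X] by (simp add: Int_commute)
  have cc: "card (X - Y) = card (Y - X)"
    using assms(1-3) by (metis card_Diff_subset_Int finite_Int Int_commute)
  obtain h where h: "bij_betw h (X - Y) (Y - X)"
    using finite_same_card_bij[of "X - Y" "Y - X"] assms(1,2) cc by auto
  have eq: "sum f (Y - X) = sum (\<lambda>x. f (h x)) (X - Y)"
    using sum.reindex_bij_betw[OF h, of f] by simp
  have lth: "f x < f (h x)" if "x \<in> X - Y" for x
    using lt[OF that] h that by (auto simp: bij_betw_def)
  show "sum f X \<le> sum f Y"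
    unfolding cX cY eq using lth by (intro add_right_mono sum_mono) (simp add: less_imp_le)
  assume "X \<noteq> Y"
  then have "X - Y \<noteq> {}" using cc assms(1-3)
    by (metis Diff_eq_empty_iff card_subset_eq)
  then show "sum f X < sum f Y"
    unfolding cX cY eq using lth assms(1) by (intro add_strict_right_mono sum_strict_mono) auto
qed

text \<open>The functions differ only at the paired places \<open>f k\<close> and
  \<open>g k\<close>, so a comparison pair by pair suffices. It serves for the sizes, in both
  directions, and for the weights.\<close>

lemma sum_two_fun_update_mono:
  fixes \<phi> \<psi> :: "'b \<Rightarrow> int"
  assumes "finite B" "finite K" "inj_on f K" "inj_on g K" "f ` K \<subseteq> B" "g ` K \<subseteq> B"
    and disj: "f ` K \<inter> g ` K = {}"
    and same: "\<And>b. b \<in> B - (f ` K \<union> g ` K) \<Longrightarrow> \<phi> b = \<psi> b"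
    and le: "\<And>k. k \<in> K \<Longrightarrow> \<phi> (f k) + \<phi> (g k) \<le> \<psi> (f k) + \<psi> (g k)"
  shows "sum \<phi> B \<le> sum \<psi> B"
proof -
  have split: "sum h B = (\<Sum>k\<in>K. h (f k) + h (g k)) + sum h (B - (f ` K \<union> g ` K))" for h :: "'b \<Rightarrow> int"
  proof -
    have "sum h B = sum h (f ` K \<union> g ` K) + sum h (B - (f ` K \<union> g ` K))"
      using assms(1,5,6) by (metis Un_least add.commute sum.subset_diff)
    also have "sum h (f ` K \<union> g ` K) = sum h (f ` K) + sum h (g ` K)"
      using assms(2) disj by (intro sum.union_disjoint) auto
    also have "\<dots> = (\<Sum>k\<in>K. h (f k) + h (g k))"
      using assms(3,4) by (simp add: sum.reindex sum.distrib)
    finally show ?thesis .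
  qed
  show ?thesis
    unfolding split[of \<phi>] split[of \<psi>]
    by (rule add_mono; rule sum_mono; use same le in force)
qed

text \<open>The problem after vertices are replaced by ranks: \<open>n i\<close> is the size of a
  factor, \<open>st i b\<close> the start of the part containing rank \<open>b\<close>,
  \<open>dl i b\<close> the number of lower neighbours, and \<open>lt S\<close> the
  block-lexicographic order over \<open>S\<close>. In \<open>regular\<close>, \<open>N\<close> is
  the common length of the first and last part, and \<open>l\<close> is the number of neighbours
  that a vertex of the last part has in earlier parts. The excluded coordinates are extremes of
  \<open>I\<close>, so an interior coordinate of a subset \<open>S\<close> inherits the
  conditions.\<close>

locale rank_grid =
  fixes I :: "nat set" and n :: "nat \<Rightarrow> nat" and st :: "nat \<Rightarrow> nat \<Rightarrow> nat"
    and dl :: "nat \<Rightarrow> nat \<Rightarrow> int"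
    and lt :: "nat set \<Rightarrow> (nat \<Rightarrow> nat) \<Rightarrow> (nat \<Rightarrow> nat) \<Rightarrow> bool"
  assumes finite_I: "finite I"
    and n_pos: "\<And>i. i \<in> I \<Longrightarrow> 1 \<le> n i"
    and st_mono: "\<And>i b c. i \<in> I \<Longrightarrow> 1 \<le> b \<Longrightarrow> b \<le> c \<Longrightarrow> c \<le> n i \<Longrightarrow> st i b \<le> st i c"
    and lt_irrefl: "\<And>S x. S \<subseteq> I \<Longrightarrow> S \<noteq> {} \<Longrightarrow> x \<in> (\<Pi>\<^sub>E i\<in>S. {1..n i}) \<Longrightarrow> \<not> lt S x x"
    and lt_trans: "\<And>S x y u. S \<subseteq> I \<Longrightarrow> S \<noteq> {} \<Longrightarrow> x \<in> (\<Pi>\<^sub>E i\<in>S. {1..n i}) \<Longrightarrow>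
          y \<in> (\<Pi>\<^sub>E i\<in>S. {1..n i}) \<Longrightarrow> u \<in> (\<Pi>\<^sub>E i\<in>S. {1..n i}) \<Longrightarrow> lt S x y \<Longrightarrow> lt S y u \<Longrightarrow> lt S x u"
    and lt_total: "\<And>S x y. S \<subseteq> I \<Longrightarrow> S \<noteq> {} \<Longrightarrow> x \<in> (\<Pi>\<^sub>E i\<in>S. {1..n i}) \<Longrightarrow>
          y \<in> (\<Pi>\<^sub>E i\<in>S. {1..n i}) \<Longrightarrow> x \<noteq> y \<Longrightarrow> lt S x y \<or> lt S y x"
    and lt_restrict: "\<And>S x y j. S \<subseteq> I \<Longrightarrow> j \<in> S \<Longrightarrow> S - {j} \<noteq> {} \<Longrightarrow> x \<in> (\<Pi>\<^sub>E i\<in>S. {1..n i}) \<Longrightarrow>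
          y \<in> (\<Pi>\<^sub>E i\<in>S. {1..n i}) \<Longrightarrow> x j = y j \<Longrightarrow> lt S x y \<Longrightarrow>
          lt (S - {j}) (restrict x (S - {j})) (restrict y (S - {j}))"
    and lt_mono: "\<And>S x y. S \<subseteq> I \<Longrightarrow> S \<noteq> {} \<Longrightarrow> x \<in> (\<Pi>\<^sub>E i\<in>S. {1..n i}) \<Longrightarrow>
          y \<in> (\<Pi>\<^sub>E i\<in>S. {1..n i}) \<Longrightarrow> x \<noteq> y \<Longrightarrow> (\<And>i. i \<in> S \<Longrightarrow> x i \<le> y i) \<Longrightarrow> lt S x y"
    and lt_block: "\<And>S x y k. S \<subseteq> I \<Longrightarrow> x \<in> (\<Pi>\<^sub>E i\<in>S. {1..n i}) \<Longrightarrow> y \<in> (\<Pi>\<^sub>E i\<in>S. {1..n i}) \<Longrightarrow>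
          k \<in> S \<Longrightarrow> st k (x k) < st k (y k) \<Longrightarrow> (\<And>i. i \<in> S \<Longrightarrow> i < k \<Longrightarrow> st i (x i) = st i (y i)) \<Longrightarrow> lt S x y"
    and nondecr: "\<And>j b c. j \<in> I \<Longrightarrow> j \<noteq> Max I \<Longrightarrow> 1 \<le> b \<Longrightarrow> b \<le> c \<Longrightarrow> c \<le> n j \<Longrightarrow>
          st j b = st j c \<Longrightarrow> dl j b \<le> dl j c"
    and regular: "\<And>j. j \<in> I \<Longrightarrow> j \<noteq> Min I \<Longrightarrow> j \<noteq> Max I \<Longrightarrow>
          \<exists>N l. N \<le> n j \<and> 0 \<le> l \<and> (\<forall>b\<in>{1..n j}. (st j b = st j 1 \<longleftrightarrow> b \<le> N) \<and> (st j b = st j (n j) \<longleftrightarrow> n j - N < b)) \<and>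
             (\<forall>b\<in>{1..N}. dl j (n j - N + b) = l + dl j b)"
    and block_opt: "\<And>S c X Y. S \<subseteq> I \<Longrightarrow> S \<noteq> {} \<Longrightarrow> c \<in> (\<Pi>\<^sub>E i\<in>S. {1..n i}) \<Longrightarrow>
          X \<subseteq> {x \<in> (\<Pi>\<^sub>E i\<in>S. {1..n i}). \<forall>i\<in>S. st i (x i) = st i (c i)} \<Longrightarrow>
          (\<And>x y. x \<in> X \<Longrightarrow> y \<in> (\<Pi>\<^sub>E i\<in>S. {1..n i}) \<Longrightarrow> \<forall>i\<in>S. st i (y i) = st i (c i) \<Longrightarrow>
             \<forall>i\<in>S. y i \<le> x i \<Longrightarrow> y \<in> X) \<Longrightarrow>
          Y \<subseteq> {x \<in> (\<Pi>\<^sub>E i\<in>S. {1..n i}). \<forall>i\<in>S. st i (x i) = st i (c i)} \<Longrightarrow>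
          (\<And>x y. x \<in> Y \<Longrightarrow> y \<in> (\<Pi>\<^sub>E i\<in>S. {1..n i}) \<Longrightarrow> \<forall>i\<in>S. st i (y i) = st i (c i) \<Longrightarrow>
             lt S y x \<Longrightarrow> y \<in> Y) \<Longrightarrow> card X = card Y \<Longrightarrow>
          (\<Sum>x\<in>X. \<Sum>i\<in>S. dl i (x i)) \<le> (\<Sum>x\<in>Y. \<Sum>i\<in>S. dl i (x i))"
    and pair_opt: "\<And>i j X Y. i \<in> I \<Longrightarrow> j \<in> I \<Longrightarrow> i < j \<Longrightarrow> X \<subseteq> (\<Pi>\<^sub>E i\<in>{i, j}. {1..n i}) \<Longrightarrow>
          (\<And>x y. x \<in> X \<Longrightarrow> y \<in> (\<Pi>\<^sub>E i\<in>{i, j}. {1..n i}) \<Longrightarrow> y i \<le> x i \<Longrightarrow> y j \<le> x j \<Longrightarrow> y \<in> X) \<Longrightarrow>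
          Y \<subseteq> (\<Pi>\<^sub>E i\<in>{i, j}. {1..n i}) \<Longrightarrow>
          (\<And>x y. x \<in> Y \<Longrightarrow> y \<in> (\<Pi>\<^sub>E i\<in>{i, j}. {1..n i}) \<Longrightarrow> lt {i, j} y x \<Longrightarrow> y \<in> Y) \<Longrightarrow> card X = card Y \<Longrightarrow>
          (\<Sum>x\<in>X. \<Sum>k\<in>{i, j}. dl k (x k)) \<le> (\<Sum>x\<in>Y. \<Sum>k\<in>{i, j}. dl k (x k))"
begin

definition V :: "nat set \<Rightarrow> (nat \<Rightarrow> nat) set" where
  "V S = (\<Pi>\<^sub>E i\<in>S. {1..n i})"

text \<open>Counted from 0, so that \<open>init S k\<close> has \<open>k\<close> elements whenever
  the grid has that many.\<close>

definition pos :: "nat set \<Rightarrow> (nat \<Rightarrow> nat) \<Rightarrow> nat" where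
  "pos S x = card {y \<in> V S. lt S y x}"

definition init :: "nat set \<Rightarrow> nat \<Rightarrow> (nat \<Rightarrow> nat) set" where
  "init S k = {x \<in> V S. pos S x < k}"

definition W :: "nat set \<Rightarrow> (nat \<Rightarrow> nat) set \<Rightarrow> int" where
  "W S X = (\<Sum>x\<in>X. \<Sum>i\<in>S. dl i (x i))"

definition down :: "nat set \<Rightarrow> (nat \<Rightarrow> nat) set \<Rightarrow> bool" where
  "down S X \<longleftrightarrow> X \<subseteq> V S \<and> (\<forall>x\<in>X. \<forall>y\<in>V S. (\<forall>i\<in>S. y i \<le> x i) \<longrightarrow> y \<in> X)"

text \<open>The share of \<open>lt S\<close> that compares different blocks. It reads only
  \<open>st\<close> on \<open>S\<close>, so it also applies to tuples over a larger index
  set.\<close>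

definition blt :: "nat set \<Rightarrow> (nat \<Rightarrow> nat) \<Rightarrow> (nat \<Rightarrow> nat) \<Rightarrow> bool" where
  "blt S x y \<longleftrightarrow> (\<exists>k\<in>S. st k (x k) < st k (y k) \<and> (\<forall>i\<in>S. i < k \<longrightarrow> st i (x i) = st i (y i)))"

definition opt :: "nat set \<Rightarrow> bool" where
  "opt S \<longleftrightarrow> (\<forall>X. down S X \<longrightarrow> W S X \<le> W S (init S (card X)))"

lemma finite_V [simp]: "S \<subseteq> I \<Longrightarrow> finite (V S)"
  unfolding V_def using finite_I by (intro finite_PiE) (auto intro: finite_subset)

lemma V_D: "x \<in> V S \<Longrightarrow> i \<in> S \<Longrightarrow> 1 \<le> x i \<and> x i \<le> n i"
  unfolding V_def by auto

lemma restrict_V: "x \<in> V S \<Longrightarrow> R \<subseteq> S \<Longrightarrow> restrict x R \<in> V R"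
  unfolding V_def by (auto simp: PiE_iff)

lemma upd_V: "j \<in> S \<Longrightarrow> v \<in> V (S - {j}) \<Longrightarrow> b \<in> {1..n j} \<Longrightarrow> v(j := b) \<in> V S"
  unfolding V_def PiE_iff extensional_def by auto

lemma upd_V': "x \<in> V S \<Longrightarrow> j \<in> S \<Longrightarrow> 1 \<le> b \<Longrightarrow> b \<le> n j \<Longrightarrow> x(j := b) \<in> V S"
  unfolding V_def PiE_iff extensional_def by auto

lemma restrict_V_self [simp]: "v \<in> V R \<Longrightarrow> restrict v R = v"
  unfolding V_def by (rule PiE_restrict)

lemma restrict_upd_V [simp]: "v \<in> V (S - {j}) \<Longrightarrow> restrict (v(j := b)) (S - {j}) = v"
  unfolding V_def PiE_iff extensional_def by (auto simp: restrict_def)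

lemma upd_restrict [simp]: "x \<in> V S \<Longrightarrow> (restrict x (S - {j}))(j := x j) = x"
  unfolding V_def PiE_iff extensional_def by (auto simp: restrict_def)

lemma lt_asym: "S \<subseteq> I \<Longrightarrow> S \<noteq> {} \<Longrightarrow> x \<in> V S \<Longrightarrow> y \<in> V S \<Longrightarrow> lt S x y \<Longrightarrow> \<not> lt S y x"
  using lt_irrefl lt_trans unfolding V_def by blast

text \<open>Consistency is one direction; totality of one order and asymmetry of the other turn it
  into an equivalence.\<close>

lemma lt_restrict_iff:
  assumes "S \<subseteq> I" "j \<in> S" "S - {j} \<noteq> {}" "x \<in> V S" "y \<in> V S" "x j = y j"
  shows "lt S x y \<longleftrightarrow> lt (S - {j}) (restrict x (S - {j})) (restrict y (S - {j}))"
proof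
  assume "lt S x y"
  then show "lt (S - {j}) (restrict x (S - {j})) (restrict y (S - {j}))"
    using lt_restrict assms unfolding V_def by blast
next
  assume r: "lt (S - {j}) (restrict x (S - {j})) (restrict y (S - {j}))"
  have R: "S - {j} \<subseteq> I" using assms by auto
  have "restrict x (S - {j}) \<noteq> restrict y (S - {j})"
    using r lt_irrefl[OF R assms(3)] restrict_V[OF assms(4)] restrict_V[OF assms(5)]
    unfolding V_def by (metis Diff_subset)
  then have ne: "x \<noteq> y" by auto
  show "lt S x y"
  proof (rule ccontr)
    assume "\<not> lt S x y"
    then have "lt S y x" using lt_total[of S x y] ne assms unfolding V_def by blast
    then have "lt (S - {j}) (restrict y (S - {j})) (restrict x (S - {j}))"
      using lt_restrict assms unfolding V_def by (metis (full_types))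
    then show False
      using r lt_asym[OF R assms(3) restrict_V[OF assms(4)] restrict_V[OF assms(5)]] by auto
  qed
qed

lemma lt_upd:
  assumes "S \<subseteq> I" "j \<in> S" "S - {j} \<noteq> {}" "u \<in> V (S - {j})" "v \<in> V (S - {j})" "b \<in> {1..n j}"
  shows "lt S (u(j := b)) (v(j := b)) \<longleftrightarrow> lt (S - {j}) u v"
  using lt_restrict_iff[OF assms(1-3) upd_V[OF assms(2,4,6)] upd_V[OF assms(2,5,6)]] assms
  by simp

lemma blt_lt:
  assumes "S \<subseteq> I" "x \<in> V S" "y \<in> V S" "blt S x y"
  shows "lt S x y"
proof -
  obtain k where k: "k \<in> S" "st k (x k) < st k (y k)" "\<And>i. i \<in> S \<Longrightarrow> i < k \<Longrightarrow> st i (x i) = st i (y i)"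
    using assms(4) unfolding blt_def by blast
  show ?thesis
    using assms(2,3) lt_block[OF assms(1) _ _ k(1,2) k(3)] unfolding V_def by blast
qed

lemma pos_less_iff:
  assumes S: "S \<subseteq> I" "S \<noteq> {}" and x: "x \<in> V S" and y: "y \<in> V S"
  shows "lt S x y \<longleftrightarrow> pos S x < pos S y"
proof -
  have *: "pos S u < pos S v" if uv: "u \<in> V S" "v \<in> V S" "lt S u v" for u v
  proof -
    have "{w \<in> V S. lt S w u} \<subset> {w \<in> V S. lt S w v}"
      using uv S lt_trans[OF S] lt_irrefl[OF S] unfolding V_def by blast
    then show ?thesis
      unfolding pos_def using S by (intro psubset_card_mono) auto
  qed
  show ?thesis
    using *[OF x y] *[OF y x] lt_total[OF S] x y unfolding V_def by (metis less_asym less_irrefl)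
qed

lemma pos_less_card:
  assumes S: "S \<subseteq> I" "S \<noteq> {}" and x: "x \<in> V S"
  shows "pos S x < card (V S)"
proof -
  have "{w \<in> V S. lt S w x} \<subset> V S" using x lt_irrefl[OF S] unfolding V_def by blast
  then show ?thesis unfolding pos_def using S by (intro psubset_card_mono) auto
qed

lemma pos_inj: "S \<subseteq> I \<Longrightarrow> S \<noteq> {} \<Longrightarrow> inj_on (pos S) (V S)"
  using lt_total pos_less_iff unfolding inj_on_def V_def by (metis less_irrefl)

lemma pos_image:
  assumes S: "S \<subseteq> I" "S \<noteq> {}"
  shows "pos S ` V S = {..<card (V S)}"
  using pos_less_card[OF S] card_image[OF pos_inj[OF S]]
  by (intro card_subset_eq) auto

lemma card_init:
  assumes S: "S \<subseteq> I" "S \<noteq> {}" and k: "k \<le> card (V S)"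
  shows "card (init S k) = k"
proof -
  have "pos S ` init S k = {..<k}"
  proof
    show "pos S ` init S k \<subseteq> {..<k}" unfolding init_def by auto
    show "{..<k} \<subseteq> pos S ` init S k"
    proof
      fix m assume "m \<in> {..<k}"
      then have "m \<in> pos S ` V S" using pos_image[OF S] k by auto
      then show "m \<in> pos S ` init S k" using \<open>m \<in> {..<k}\<close> unfolding init_def by auto
    qed
  qed
  moreover have "inj_on (pos S) (init S k)"
    using pos_inj[OF S] by (rule inj_on_subset) (auto simp: init_def)
  ultimately show ?thesis by (metis card_image card_lessThan)
qed

lemma init_subset: "init S k \<subseteq> V S"
  unfolding init_def by auto

lemma init_mono: "k \<le> l \<Longrightarrow> init S k \<subseteq> init S l"
  unfolding init_def by auto

lemma init_unique:
  assumes S: "S \<subseteq> I" "S \<noteq> {}" and X: "X \<subseteq> V S"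
    and c: "\<And>x y. x \<in> X \<Longrightarrow> y \<in> V S \<Longrightarrow> lt S y x \<Longrightarrow> y \<in> X"
  shows "X = init S (card X)"
proof -
  have fin: "finite X" using X S finite_V finite_subset by blast
  have le: "card X \<le> card (V S)" using X S by (intro card_mono) auto
  have "X \<subseteq> init S (card X)"
  proof
    fix x assume x: "x \<in> X"
    have "{w \<in> V S. lt S w x} \<subset> X"
      using x X c[OF x] lt_irrefl[OF S, of x] unfolding V_def by blast
    then have "pos S x < card X" unfolding pos_def using fin by (intro psubset_card_mono) auto
    then show "x \<in> init S (card X)" using x X unfolding init_def by auto
  qed
  then show ?thesis
    using card_init[OF S le] S finite_V finite_subset[OF init_subset]
    by (intro card_subset_eq) auto
qed

lemma le_lt:
  assumes "S \<subseteq> I" "S \<noteq> {}" "x \<in> V S" "y \<in> V S" "x \<noteq> y" "\<And>i. i \<in> S \<Longrightarrow> x i \<le> y i"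
  shows "lt S x y"
  using lt_mono[OF assms(1,2) _ _ assms(5,6)] assms(3,4) unfolding V_def by blast

lemma init_closed:
  assumes "S \<subseteq> I" "S \<noteq> {}" "x \<in> init S k" "y \<in> V S" "lt S y x"
  shows "y \<in> init S k"
  using assms pos_less_iff[OF assms(1,2,4)] unfolding init_def by auto

lemma down_init:
  assumes "S \<subseteq> I" "S \<noteq> {}"
  shows "down S (init S k)"
  unfolding down_def using le_lt[OF assms] init_closed[OF assms] init_subset by (metis subsetD)

lemma downD: "down S T \<Longrightarrow> x \<in> T \<Longrightarrow> y \<in> V S \<Longrightarrow> (\<And>i. i \<in> S \<Longrightarrow> y i \<le> x i) \<Longrightarrow> y \<in> T"
  unfolding down_def by blast

lemma down_V: "down S T \<Longrightarrow> T \<subseteq> V S"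
  unfolding down_def by blast

end

declare FuncSet.restrict_upd [simp del] \<comment> \<open>rewrites the left-hand side of \<open>upd_restrict\<close>\<close>

section \<open>Sections over one coordinate and exchanges between them\<close>

context rank_grid begin

definition sect :: "nat set \<Rightarrow> nat \<Rightarrow> nat \<Rightarrow> (nat \<Rightarrow> nat) set \<Rightarrow> (nat \<Rightarrow> nat) set" where
  "sect S j b T = {v \<in> V (S - {j}). v(j := b) \<in> T}"

text \<open>Compression over \<open>S - {j}\<close> produces sets of this form; the exchanges below
  change only the function \<open>s\<close>.\<close>

definition slab :: "nat set \<Rightarrow> nat \<Rightarrow> (nat \<Rightarrow> nat) \<Rightarrow> (nat \<Rightarrow> nat) set" where
  "slab S j s = {x \<in> V S. restrict x (S - {j}) \<in> init (S - {j}) (s (x j))}"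

definition section_closed :: "nat set \<Rightarrow> nat \<Rightarrow> (nat \<Rightarrow> nat) set \<Rightarrow> bool" where
  "section_closed S j T \<longleftrightarrow> (\<forall>x\<in>T. \<forall>y\<in>V S. y j = x j \<longrightarrow> lt S y x \<longrightarrow> y \<in> T)"

text \<open>The strict condition is on positions, since a move may leave the weight unchanged; it
  makes repeated replacement terminate.\<close>

definition better :: "nat set \<Rightarrow> (nat \<Rightarrow> nat) set \<Rightarrow> (nat \<Rightarrow> nat) set \<Rightarrow> bool" where
  "better S T T' \<longleftrightarrow> down S T' \<and> card T' = card T \<and> W S T \<le> W S T' \<and> sum (pos S) T' < sum (pos S) T"

lemma sum_sections:
  assumes "S \<subseteq> I" "j \<in> S" "T \<subseteq> V S"
  shows "sum f T = (\<Sum>b\<in>{1..n j}. \<Sum>v\<in>sect S j b T. f (v(j := b)))"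
proof -
  have R: "S - {j} \<subseteq> I" using assms(1) by auto
  have fin: "finite (sect S j b T)" for b
    unfolding sect_def using finite_V[OF R] by auto
  have "(\<Sum>b\<in>{1..n j}. \<Sum>v\<in>sect S j b T. f (v(j := b)))
      = (\<Sum>(b, v)\<in>Sigma {1..n j} (\<lambda>b. sect S j b T). f (v(j := b)))"
    using fin by (intro sum.Sigma) auto
  also have "\<dots> = sum f T"
  proof (rule sum.reindex_bij_witness[of _ "\<lambda>x. (x j, restrict x (S - {j}))" "\<lambda>(b, v). v(j := b)"])
    fix x assume "x \<in> T"
    then have x: "x \<in> V S" using assms(3) by auto
    show "(x j, restrict x (S - {j})) \<in> Sigma {1..n j} (\<lambda>b. sect S j b T)"
      using x \<open>x \<in> T\<close> V_D[OF x assms(2)] restrict_V[OF x, of "S - {j}"] upd_restrict[OF x, of j]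
      unfolding sect_def by auto
  qed (use assms(3) in \<open>auto simp: sect_def\<close>)
  finally show ?thesis by simp
qed

lemma card_sections:
  assumes "S \<subseteq> I" "j \<in> S" "T \<subseteq> V S"
  shows "card T = (\<Sum>b\<in>{1..n j}. card (sect S j b T))"
  using sum_sections[OF assms, of "\<lambda>_. 1::nat"] by simp

text \<open>On a section coordinate \<open>j\<close> is fixed and contributes \<open>dl j b\<close>
  once per element; the rest is a weight in the smaller product.\<close>

lemma W_sections:
  assumes "S \<subseteq> I" "j \<in> S" "T \<subseteq> V S"
  shows "W S T = (\<Sum>b\<in>{1..n j}. W (S - {j}) (sect S j b T) + dl j b * int (card (sect S j b T)))"
proof -
  have fin: "finite S" using assms(1) finite_I finite_subset by blast
  have "(\<Sum>i\<in>S. dl i ((v(j := b)) i)) = dl j b + (\<Sum>i\<in>S - {j}. dl i (v i))" for v b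
    using fin assms(2) by (simp add: sum.remove[of S j])
  then have "W S T = (\<Sum>b\<in>{1..n j}. \<Sum>v\<in>sect S j b T. dl j b + (\<Sum>i\<in>S - {j}. dl i (v i)))"
    unfolding W_def using sum_sections[OF assms, of "\<lambda>x. \<Sum>i\<in>S. dl i (x i)"] by simp
  then show ?thesis unfolding W_def by (simp add: sum.distrib algebra_simps)
qed

lemma slab_subset: "slab S j s \<subseteq> V S"
  unfolding slab_def by auto

lemma sect_slab:
  assumes "j \<in> S" "b \<in> {1..n j}"
  shows "sect S j b (slab S j s) = init (S - {j}) (s b)"
  unfolding sect_def slab_def using upd_V[OF assms(1) _ assms(2)] init_subset[of "S - {j}"] restrict_upd_V
  by (auto simp: subset_iff)

text \<open>Decreasing sizes take care of a lower value in coordinate \<open>j\<close>, down-closed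
  initial segments of all other coordinates.\<close>

lemma down_slab:
  assumes "S \<subseteq> I" "j \<in> S" "S - {j} \<noteq> {}"
    and anti: "\<And>b c. 1 \<le> b \<Longrightarrow> b \<le> c \<Longrightarrow> c \<le> n j \<Longrightarrow> s c \<le> s b"
  shows "down S (slab S j s)"
  unfolding down_def
proof (intro conjI slab_subset ballI impI)
  fix x y assume x: "x \<in> slab S j s" and y: "y \<in> V S" and le: "\<forall>i\<in>S. y i \<le> x i"
  have R: "S - {j} \<subseteq> I" using assms(1) by auto
  have xV: "x \<in> V S" using x slab_def by auto
  have "restrict x (S - {j}) \<in> init (S - {j}) (s (y j))"
    using x anti[of "y j" "x j"] le assms(2) V_D[OF xV assms(2)] V_D[OF y assms(2)]
      init_mono[of "s (x j)" "s (y j)"] unfolding slab_def by auto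
  then have "restrict y (S - {j}) \<in> init (S - {j}) (s (y j))"
    using downD[OF down_init[OF R assms(3)]] restrict_V[OF y, of "S - {j}"] le by auto
  then show "y \<in> slab S j s" using y unfolding slab_def by auto
qed

lemma sect_antimono:
  assumes "down S T" "j \<in> S" "1 \<le> b" "b \<le> c" "c \<le> n j"
  shows "sect S j c T \<subseteq> sect S j b T"
proof
  fix v assume v: "v \<in> sect S j c T"
  then have "v(j := b) \<in> V S" using assms unfolding sect_def by (intro upd_V) auto
  then have "v(j := b) \<in> T"
    using downD[OF assms(1), of "v(j := c)" "v(j := b)"] v assms unfolding sect_def by auto
  then show "v \<in> sect S j b T" using v unfolding sect_def by auto
qed

lemma down_sect:
  assumes "down S T" "j \<in> S" "b \<in> {1..n j}"
  shows "down (S - {j}) (sect S j b T)"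
  unfolding down_def
proof (intro conjI ballI impI)
  show "sect S j b T \<subseteq> V (S - {j})" unfolding sect_def by auto
  fix x y assume x: "x \<in> sect S j b T" and y: "y \<in> V (S - {j})" and le: "\<forall>i\<in>S - {j}. y i \<le> x i"
  have "y(j := b) \<in> T"
    using downD[OF assms(1), of "x(j := b)" "y(j := b)"] x le upd_V[OF assms(2) y assms(3)]
    unfolding sect_def by auto
  then show "y \<in> sect S j b T" using y unfolding sect_def by auto
qed

lemma card_sect_antimono:
  assumes "S \<subseteq> I" "down S T" "j \<in> S" "1 \<le> b" "b \<le> c" "c \<le> n j"
  shows "card (sect S j c T) \<le> card (sect S j b T)"
proof -
  have "S - {j} \<subseteq> I" using assms(1) by auto
  then have "finite (sect S j b T)" using finite_V unfolding sect_def by auto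
  then show ?thesis using sect_antimono[OF assms(2-6)] by (rule card_mono)
qed

lemma card_sect_le: "S \<subseteq> I \<Longrightarrow> card (sect S j b T) \<le> card (V (S - {j}))"
  unfolding sect_def by (intro card_mono finite_V) auto

lemma section_closed_sect:
  assumes "S \<subseteq> I" "j \<in> S" "S - {j} \<noteq> {}" "section_closed S j T" "b \<in> {1..n j}"
  shows "sect S j b T = init (S - {j}) (card (sect S j b T))"
proof (rule init_unique)
  fix x y assume x: "x \<in> sect S j b T" and y: "y \<in> V (S - {j})" and "lt (S - {j}) y x"
  then have "lt S (y(j := b)) (x(j := b))"
    using lt_upd[OF assms(1-3) y _ assms(5)] unfolding sect_def by auto
  then have "y(j := b) \<in> T"
    using assms(4) x upd_V[OF assms(2) y assms(5)] unfolding section_closed_def sect_def by auto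
  then show "y \<in> sect S j b T" using y unfolding sect_def by auto
qed (use assms in \<open>auto simp: sect_def\<close>)

lemma section_closed_slab:
  assumes "S \<subseteq> I" "j \<in> S" "S - {j} \<noteq> {}" "section_closed S j T" "T \<subseteq> V S"
  shows "T = slab S j (\<lambda>b. card (sect S j b T))"
proof -
  have *: "x \<in> T \<longleftrightarrow> restrict x (S - {j}) \<in> sect S j (x j) T" if "x \<in> V S" for x
    unfolding sect_def mem_Collect_eq upd_restrict[OF that] using restrict_V[OF that Diff_subset] by blast
  have "x \<in> T \<longleftrightarrow> x \<in> slab S j (\<lambda>b. card (sect S j b T))" for x
  proof (cases "x \<in> V S")
    case True
    then have "x j \<in> {1..n j}" using V_D[OF True assms(2)] by auto
    then have "sect S j (x j) T = init (S - {j}) (card (sect S j (x j) T))"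
      by (rule section_closed_sect[OF assms(1-4)])
    from arg_cong[OF this, of "\<lambda>X. restrict x (S - {j}) \<in> X"]
    show ?thesis using *[OF True] True unfolding slab_def by blast
  next
    case False
    then show ?thesis using assms(5) slab_subset by blast
  qed
  then show ?thesis by (rule set_eqI)
qed

text \<open>By \<open>opt (S - {j})\<close> no section loses weight, and the section sizes are kept,
  hence still decreasing. Replaced elements move to earlier positions because the order on a section
  agrees with the one on \<open>S - {j}\<close>.\<close>

lemma compress_better:
  assumes S: "S \<subseteq> I" "j \<in> S" "S - {j} \<noteq> {}" and T: "down S T" and o: "opt (S - {j})"
    and nc: "\<not> section_closed S j T"
  shows "better S T (slab S j (\<lambda>b. card (sect S j b T)))" (is "better S T ?T'")
proof -
  define R where "R = S - {j}"
  have R: "R \<subseteq> I" "R \<noteq> {}" using S R_def by auto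
  have S0: "S \<noteq> {}" using S by auto
  define s where "s b = card (sect S j b T)" for b
  have sT: "sect S j b ?T' = init R (s b)" if "b \<in> {1..n j}" for b
    using sect_slab[OF S(2) that] unfolding R_def s_def by auto
  have cs: "card (init R (s b)) = s b" for b
    using card_init[OF R] card_sect_le[OF S(1)] unfolding R_def s_def by auto
  have TV: "T \<subseteq> V S" using T down_V by blast
  have TV': "?T' \<subseteq> V S" by (rule slab_subset)
  have D: "down S ?T'"
    using card_sect_antimono[OF S(1) T S(2)] by (intro down_slab S) auto
  have C: "card ?T' = card T"
    unfolding card_sections[OF S(1,2) TV] card_sections[OF S(1,2) TV']
    using sT cs by (intro sum.cong) (auto simp: s_def)
  have w: "W S T \<le> W S ?T'"
    unfolding W_sections[OF S(1,2) TV] W_sections[OF S(1,2) TV']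
  proof (rule sum_mono)
    fix b assume b: "b \<in> {1..n j}"
    have "W R (sect S j b T) \<le> W R (init R (s b))"
      using o down_sect[OF T S(2) b] unfolding opt_def R_def s_def by auto
    then show "W (S - {j}) (sect S j b T) + dl j b * int (card (sect S j b T))
        \<le> W (S - {j}) (sect S j b ?T') + dl j b * int (card (sect S j b ?T'))"
      using sT[OF b] cs[of b] unfolding R_def s_def by auto
  qed
  have pos_lt: "pos S (u(j := b)) < pos S (v(j := b))"
    if b: "b \<in> {1..n j}" and u: "u \<in> init R (s b) - sect S j b T" and v: "v \<in> sect S j b T - init R (s b)"
    for b u v
  proof -
    have uv: "u \<in> V R" "v \<in> V R" using u v unfolding init_def sect_def R_def by auto
    have "pos R u < pos R v" using u v uv unfolding init_def by auto
    then have "lt R u v" using pos_less_iff[OF R uv] by auto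
    then have "lt S (u(j := b)) (v(j := b))" using lt_upd[OF S] uv b unfolding R_def by auto
    then show ?thesis
      using pos_less_iff[OF S(1) S0] upd_V[OF S(2) _ b] uv unfolding R_def by auto
  qed
  have fin: "finite (sect S j b T)" "finite (init R (s b))" for b
    using finite_V[OF R(1)] finite_subset[OF init_subset] unfolding sect_def R_def by auto
  have "sum (pos S) ?T' < sum (pos S) T"
    unfolding sum_sections[OF S(1,2) TV] sum_sections[OF S(1,2) TV']
  proof (rule sum_strict_mono_ex1)
    show "\<forall>b\<in>{1..n j}. (\<Sum>v\<in>sect S j b ?T'. pos S (v(j := b))) \<le> (\<Sum>v\<in>sect S j b T. pos S (v(j := b)))"
    proof
      fix b assume b: "b \<in> {1..n j}"
      show "(\<Sum>v\<in>sect S j b ?T'. pos S (v(j := b))) \<le> (\<Sum>v\<in>sect S j b T. pos S (v(j := b)))"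
        unfolding sT[OF b] using pos_lt[OF b] cs[of b] by (intro sum_exchange_le(1) fin) (auto simp: s_def)
    qed
    \<comment> \<open>A violation of closedness yields a section that really changes, which makes
      the inequality strict.\<close>
    obtain x y where xy: "x \<in> T" "y \<in> V S" "y j = x j" "lt S y x" "y \<notin> T"
      using nc unfolding section_closed_def by blast
    define b where "b = x j"
    have xV: "x \<in> V S" using xy TV by auto
    have b: "b \<in> {1..n j}" using V_D[OF xV S(2)] unfolding b_def by auto
    have "lt R (restrict y R) (restrict x R)"
      using lt_restrict_iff[OF S xy(2) xV xy(3)] xy(4) unfolding R_def by auto
    moreover have "restrict x R \<in> sect S j b T" "restrict y R \<notin> sect S j b T" "restrict y R \<in> V R"
      using xy xV restrict_V[of _ S R] upd_restrict[OF xV, of j] upd_restrict[OF xy(2), of j]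
      unfolding sect_def b_def R_def by auto
    ultimately have "sect S j b T \<noteq> init R (s b)"
      using init_closed[OF R] by blast
    then have "(\<Sum>v\<in>sect S j b ?T'. pos S (v(j := b))) < (\<Sum>v\<in>sect S j b T. pos S (v(j := b)))"
      unfolding sT[OF b] using pos_lt[OF b] cs[of b] by (intro sum_exchange_le(2) fin) (auto simp: s_def)
    then show "\<exists>b\<in>{1..n j}. (\<Sum>v\<in>sect S j b ?T'. pos S (v(j := b))) < (\<Sum>v\<in>sect S j b T. pos S (v(j := b)))"
      using b by blast
  qed auto
  then show ?thesis unfolding better_def using D C w by auto
qed

text \<open>The first \<open>q\<close> elements together with those at positions \<open>t\<close> to
  \<open>p - 1\<close> form a set of size \<open>p + q - t\<close>; \<open>free\<close> makes it
  down-closed, so \<open>opt R\<close> bounds its weight. The \<open>max\<close> and the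
  \<open>min\<close> are \<open>t\<close> and \<open>p + q - t\<close> in some order.\<close>

lemma exchange:
  assumes R: "R \<subseteq> I" "R \<noteq> {}" and o: "opt R" and qt: "q \<le> t" "t \<le> p" "p \<le> card (V R)"
    and free: "\<And>x y. x \<in> V R \<Longrightarrow> y \<in> V R \<Longrightarrow> t \<le> pos R x \<Longrightarrow> pos R x < p \<Longrightarrow> q \<le> pos R y \<Longrightarrow> pos R y < t
          \<Longrightarrow> \<exists>i\<in>R. x i < y i"
  shows "W R (init R p) + W R (init R q) \<le> W R (init R (max t (p + q - t))) + W R (init R (min t (p + q - t)))"
proof -
  define E where "E = init R q \<union> (init R p - init R t)"
  have fin: "finite (init R k)" for k using finite_V[OF R(1)] finite_subset[OF init_subset] by blast
  have sub: "init R q \<subseteq> init R t" "init R t \<subseteq> init R p" using qt init_mono by auto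
  have disj: "init R q \<inter> (init R p - init R t) = {}" using sub by auto
  have "down R E"
    unfolding down_def
  proof (intro conjI ballI impI)
    show "E \<subseteq> V R" unfolding E_def using init_subset by blast
    fix x y assume x: "x \<in> E" and y: "y \<in> V R" and le: "\<forall>i\<in>R. y i \<le> x i"
    show "y \<in> E"
    proof (cases "x \<in> init R q")
      case True
      then show ?thesis using downD[OF down_init[OF R] True y] le unfolding E_def by auto
    next
      case False
      then have x': "x \<in> init R p" "x \<notin> init R t" using x unfolding E_def by auto
      then have "y \<in> init R p" using downD[OF down_init[OF R] x'(1) y] le by auto
      moreover have "\<not> (q \<le> pos R y \<and> pos R y < t)"
        using free[of x y] x' y le unfolding init_def by force
      ultimately show ?thesis unfolding E_def init_def by auto
    qed
  qed
  have "card E = q + (p - t)"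
    unfolding E_def using disj fin sub card_init[OF R] qt
    by (subst card_Un_disjoint) (auto simp: card_Diff_subset)
  then have "card E = p + q - t" using qt by auto
  then have 1: "W R E \<le> W R (init R (p + q - t))" using o \<open>down R E\<close> unfolding opt_def by metis
  have "W R E = W R (init R q) + (W R (init R p) - W R (init R t))"
    unfolding E_def W_def using disj fin sub
    by (subst sum.union_disjoint) (auto simp: sum_diff)
  then show ?thesis using 1 by (cases "t \<le> p + q - t") (auto simp: max_def min_def)
qed

text \<open>Each \<open>k\<close> pairs a donor section \<open>f k\<close> with a receiver
  \<open>g k\<close>. Elements pass from above \<open>t\<close> to below \<open>t\<close> until the
  donor has shrunk to \<open>t\<close> or the receiver has grown to \<open>t\<close>;
  \<open>max\<close> and \<open>min\<close> cover both outcomes. Weight inside the sections is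
  controlled by \<open>exchange\<close>, that of coordinate \<open>j\<close> by \<open>dl\<close>.
  The condition \<open>before\<close> mixes different pairs \<open>k\<close> and \<open>l\<close>
  because all moves together enter one comparison of positions.\<close>

lemma shift_better:
  assumes S: "S \<subseteq> I" "j \<in> S" "S - {j} \<noteq> {}" and o: "opt (S - {j})"
    and T: "T = slab S j s" and s_le: "\<And>b. s b \<le> card (V (S - {j}))"
    and K: "finite K" "inj_on f K" "inj_on g K" "f ` K \<subseteq> {1..n j}" "g ` K \<subseteq> {1..n j}" "f ` K \<inter> g ` K = {}"
    and t: "\<And>k. k \<in> K \<Longrightarrow> s (g k) \<le> t \<and> t \<le> s (f k)"
    and s'f: "\<And>k. k \<in> K \<Longrightarrow> s' (f k) = max t (s (f k) + s (g k) - t)"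
    and s'g: "\<And>k. k \<in> K \<Longrightarrow> s' (g k) = min t (s (f k) + s (g k) - t)"
    and s'o: "\<And>b. b \<in> {1..n j} \<Longrightarrow> b \<notin> f ` K \<Longrightarrow> b \<notin> g ` K \<Longrightarrow> s' b = s b"
    and anti: "\<And>b c. 1 \<le> b \<Longrightarrow> b \<le> c \<Longrightarrow> c \<le> n j \<Longrightarrow> s' c \<le> s' b"
    and dl: "\<And>k. k \<in> K \<Longrightarrow> dl j (f k) \<le> dl j (g k)"
    and free: "\<And>k x y. k \<in> K \<Longrightarrow> x \<in> V (S - {j}) \<Longrightarrow> y \<in> V (S - {j}) \<Longrightarrow> t \<le> pos (S - {j}) x \<Longrightarrow>
         pos (S - {j}) y < t \<Longrightarrow> x(j := f k) \<in> T \<Longrightarrow> y(j := g k) \<notin> T \<Longrightarrow> \<exists>i\<in>S - {j}. x i < y i"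
    and before: "\<And>k l x y. k \<in> K \<Longrightarrow> l \<in> K \<Longrightarrow> x \<in> V (S - {j}) \<Longrightarrow> y \<in> V (S - {j}) \<Longrightarrow> t \<le> pos (S - {j}) x \<Longrightarrow>
         pos (S - {j}) y < t \<Longrightarrow> lt S (y(j := g l)) (x(j := f k))"
    and ex: "k0 \<in> K" "s (g k0) < t" "t < s (f k0)"
  shows "better S T (slab S j s')" (is "better S T ?T'")
proof -
  define R where "R = S - {j}"
  have R: "R \<subseteq> I" "R \<noteq> {}" using S R_def by auto
  have S0: "S \<noteq> {}" using S by auto
  have fg: "f k \<in> {1..n j}" "g k \<in> {1..n j}" if "k \<in> K" for k using K that by auto
  have s'_le: "s' b \<le> card (V R)" if "b \<in> {1..n j}" for b
  proof -
    consider k where "k \<in> K" "b = f k" | k where "k \<in> K" "b = g k" | "b \<notin> f ` K" "b \<notin> g ` K" by auto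
    then show ?thesis
    proof cases
      case (1 k)
      then show ?thesis using s'f[of k] t[of k] s_le[of "f k"] s_le[of "g k"] unfolding R_def by auto
    next
      case (2 k)
      then show ?thesis using s'g[of k] t[of k] s_le[of "f k"] unfolding R_def by auto
    next
      case 3
      then show ?thesis using s'o[OF that] s_le[of b] unfolding R_def by auto
    qed
  qed
  have sec: "sect S j b T = init R (s b)" "sect S j b ?T' = init R (s' b)" if "b \<in> {1..n j}" for b
    using sect_slab[OF S(2) that] unfolding R_def T by auto
  have cs: "card (init R (s b)) = s b" "card (init R (s' b)) = s' b" if "b \<in> {1..n j}" for b
    using card_init[OF R] s_le[of b] s'_le[OF that] unfolding R_def by auto
  have TV: "T \<subseteq> V S" "?T' \<subseteq> V S" using slab_subset T by auto
  have D: "down S ?T'" by (intro down_slab S anti)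
  have sums: "int (s' (f k)) + int (s' (g k)) = int (s (f k)) + int (s (g k))" if "k \<in> K" for k
    using s'f[OF that] s'g[OF that] t[OF that] by (auto simp: max_def min_def)
  have "(\<Sum>b\<in>{1..n j}. int (s b)) \<le> (\<Sum>b\<in>{1..n j}. int (s' b))"
    using s'o sums by (intro sum_two_fun_update_mono[OF _ K]) auto
  moreover have "(\<Sum>b\<in>{1..n j}. int (s' b)) \<le> (\<Sum>b\<in>{1..n j}. int (s b))"
    using s'o sums by (intro sum_two_fun_update_mono[OF _ K]) auto
  ultimately have "(\<Sum>b\<in>{1..n j}. s' b) = (\<Sum>b\<in>{1..n j}. s b)"
    by (metis of_nat_eq_iff of_nat_sum order_antisym)
  then have C: "card ?T' = card T"
    unfolding card_sections[OF S(1,2) TV(1)] card_sections[OF S(1,2) TV(2)] using sec cs by simp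
  define \<phi> where "\<phi> u b = W R (init R (u b)) + dl j b * int (u b)" for u b
  have W\<phi>: "W S T = sum (\<phi> s) {1..n j}" "W S ?T' = sum (\<phi> s') {1..n j}"
    unfolding W_sections[OF S(1,2) TV(1)] W_sections[OF S(1,2) TV(2)] \<phi>_def R_def[symmetric]
    using sec cs by (auto intro!: sum.cong)
  have w: "W S T \<le> W S ?T'"
    unfolding W\<phi>
  proof (rule sum_two_fun_update_mono[OF _ K])
    fix k assume k: "k \<in> K"
    define p q where "p = s (f k)" and "q = s (g k)"
    have pq: "q \<le> t" "t \<le> p" "p \<le> card (V R)" using t[OF k] s_le unfolding p_def q_def R_def by auto
    have "W R (init R p) + W R (init R q) \<le> W R (init R (max t (p + q - t))) + W R (init R (min t (p + q - t)))"
    proof (rule exchange[OF R _ pq])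
      show "opt R" using o R_def by simp
      fix x y assume xy: "x \<in> V R" "y \<in> V R" "t \<le> pos R x" "pos R x < p" "q \<le> pos R y" "pos R y < t"
      have "x \<in> sect S j (f k) T" "y \<notin> sect S j (g k) T"
        using sec fg[OF k] xy unfolding init_def p_def q_def by auto
      then show "\<exists>i\<in>R. x i < y i"
        using free[OF k, of x y] xy unfolding R_def sect_def by auto
    qed
    moreover have "dl j (f k) * int p + dl j (g k) * int q
        \<le> dl j (f k) * int (s' (f k)) + dl j (g k) * int (s' (g k))"
    proof -
      \<comment> \<open>The second factor is the number of elements that leave section
        \<open>f k\<close> for section \<open>g k\<close>.\<close>
      have "0 \<le> (dl j (g k) - dl j (f k)) * (int p - int (s' (f k)))"
        using dl[OF k] s'f[OF k] t[OF k] unfolding p_def by (intro mult_nonneg_nonneg) auto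
      moreover have "int q = int (s' (f k)) + int (s' (g k)) - int p"
        using sums[OF k] unfolding p_def q_def by auto
      ultimately show ?thesis by (simp only:) (simp add: algebra_simps)
    qed
    ultimately show "\<phi> s (f k) + \<phi> s (g k) \<le> \<phi> s' (f k) + \<phi> s' (g k)"
      unfolding \<phi>_def s'f[OF k] s'g[OF k] p_def q_def by linarith
  qed (use s'o in \<open>auto simp: \<phi>_def\<close>)
  have mem: "x \<in> slab S j u \<longleftrightarrow> pos R (restrict x R) < u (x j)" if "x \<in> V S" for x u
    using that restrict_V[OF that, of R] unfolding slab_def init_def R_def by auto
  have "sum (pos S) ?T' < sum (pos S) T"
  proof (rule sum_exchange_le(2))
    show "finite ?T'" "finite T" using TV finite_V[OF S(1)] finite_subset by blast+
    show "card ?T' = card T" by (rule C)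
    \<comment> \<open>The pair \<open>k0\<close> moves at least one element, so the set really
      changes.\<close>
    have "s (g k0) < s' (g k0)" using s'g[OF ex(1)] ex by auto
    then have "card (sect S j (g k0) T) \<noteq> card (sect S j (g k0) ?T')"
      using sec fg[OF ex(1)] cs by auto
    then show "?T' \<noteq> T" by auto
    fix x y assume x: "x \<in> ?T' - T" and y: "y \<in> T - ?T'"
    have xV: "x \<in> V S" and yV: "y \<in> V S" using x y TV by auto
    have xj: "x j \<in> {1..n j}" and yj: "y j \<in> {1..n j}" using V_D[OF xV S(2)] V_D[OF yV S(2)] by auto
    have px: "s (x j) \<le> pos R (restrict x R)" "pos R (restrict x R) < s' (x j)"
      using x mem[OF xV] T by auto
    have py: "s' (y j) \<le> pos R (restrict y R)" "pos R (restrict y R) < s (y j)"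
      using y mem[OF yV] T by auto
    have "\<exists>l\<in>K. x j = g l"
    proof (rule ccontr)
      assume no: "\<not> (\<exists>l\<in>K. x j = g l)"
      show False
      proof (cases "x j \<in> f ` K")
        case True
        then obtain k where k: "k \<in> K" "x j = f k" by auto
        then show False using px s'f[OF k(1)] t[OF k(1)] by auto
      next
        case False
        then show False using px no s'o[OF xj] by auto
      qed
    qed
    then obtain l where l: "l \<in> K" "x j = g l" by auto
    have "\<exists>k\<in>K. y j = f k"
    proof (rule ccontr)
      assume no: "\<not> (\<exists>k\<in>K. y j = f k)"
      show False
      proof (cases "y j \<in> g ` K")
        case True
        then obtain k where k: "k \<in> K" "y j = g k" by auto
        then show False using py s'g[OF k(1)] t[OF k(1)] by auto
      next
        case False
        then show False using py no s'o[OF yj] by auto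
      qed
    qed
    then obtain k where k: "k \<in> K" "y j = f k" by auto
    have "pos R (restrict x R) < t" using px s'g[OF l(1)] l by auto
    moreover have "t \<le> pos R (restrict y R)" using py s'f[OF k(1)] k by auto
    ultimately have "lt S ((restrict x R)(j := g l)) ((restrict y R)(j := f k))"
      using before[OF k(1) l(1)] restrict_V[OF xV, of R] restrict_V[OF yV, of R] unfolding R_def by auto
    then have "lt S x y" using l k xV yV upd_restrict[OF xV, of j] upd_restrict[OF yV, of j] unfolding R_def by auto
    then show "pos S x < pos S y" using pos_less_iff[OF S(1) S0 xV yV] by auto
  qed
  then show ?thesis unfolding better_def using D C w by auto
qed

end

text \<open>Take the last index with value above \<open>t\<close> and the first with value below
  \<open>t\<close>. With these extreme choices, moving the two values towards \<open>t\<close> keeps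
  the sequence decreasing.\<close>

lemma antimono_crossing:
  fixes s :: "nat \<Rightarrow> nat"
  assumes anti: "\<And>b c. 1 \<le> b \<Longrightarrow> b \<le> c \<Longrightarrow> c \<le> m \<Longrightarrow> s c \<le> s b"
    and "1 \<le> c0" "c0 \<le> m" "t < s c0" "1 \<le> c1" "c1 \<le> m" "s c1 < t"
  obtains b0 b1 where "c0 \<le> b0" "b0 < b1" "b1 \<le> c1" "t < s b0" "s b1 < t"
    "\<And>b. b0 < b \<Longrightarrow> b \<le> m \<Longrightarrow> s b \<le> t" "\<And>b. 1 \<le> b \<Longrightarrow> b < b1 \<Longrightarrow> t \<le> s b"
proof -
  define B0 B1 where "B0 = {b \<in> {1..m}. t < s b}" and "B1 = {b \<in> {1..m}. s b < t}"
  have fin: "finite B0" "finite B1" unfolding B0_def B1_def by auto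
  have ne: "c0 \<in> B0" "c1 \<in> B1" using assms unfolding B0_def B1_def by auto
  define b0 b1 where "b0 = Max B0" and "b1 = Min B1"
  have mem: "b0 \<in> B0" "b1 \<in> B1"
    unfolding b0_def b1_def using fin ne by (auto intro!: Max_in Min_in)
  have le: "c0 \<le> b0" "b1 \<le> c1" unfolding b0_def b1_def using fin ne by auto
  have "b0 < b1"
  proof (rule ccontr)
    assume "\<not> b0 < b1"
    then have "s b0 \<le> s b1" using anti[of b1 b0] mem unfolding B0_def B1_def by auto
    then show False using mem unfolding B0_def B1_def by auto
  qed
  moreover have "s b \<le> t" if "b0 < b" "b \<le> m" for b
  proof (rule ccontr)
    assume "\<not> s b \<le> t"
    then have "b \<in> B0" using that unfolding B0_def by auto
    then show False using that Max_ge[OF fin(1)] unfolding b0_def by (metis not_le)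
  qed
  moreover have "t \<le> s b" if "1 \<le> b" "b < b1" for b
  proof (rule ccontr)
    assume "\<not> t \<le> s b"
    then have "b \<in> B1" using that mem(2) unfolding B1_def by auto
    then show False using that Min_le[OF fin(2)] unfolding b1_def by (metis not_le)
  qed
  ultimately show ?thesis using that[of b0 b1] le mem unfolding B0_def B1_def by blast
qed

section \<open>Comparison of blocks and sets with closed sections\<close>

context rank_grid begin

lemma blt_cong:
  assumes "\<And>i. i \<in> S \<Longrightarrow> st i (x i) = st i (x' i)" "\<And>i. i \<in> S \<Longrightarrow> st i (y i) = st i (y' i)"
  shows "blt S x y \<longleftrightarrow> blt S x' y'"
  unfolding blt_def by (rule bex_cong) (use assms in auto)

lemma blt_trans:
  assumes "blt S x y" "blt S y u"
  shows "blt S x u"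
proof -
  obtain k where k: "k \<in> S" "st k (x k) < st k (y k)" "\<And>i. i \<in> S \<Longrightarrow> i < k \<Longrightarrow> st i (x i) = st i (y i)"
    using assms(1) unfolding blt_def by blast
  obtain l where l: "l \<in> S" "st l (y l) < st l (u l)" "\<And>i. i \<in> S \<Longrightarrow> i < l \<Longrightarrow> st i (y i) = st i (u i)"
    using assms(2) unfolding blt_def by blast
  consider "k < l" | "l < k" | "k = l" by linarith
  then show ?thesis
  proof cases
    case 1
    then show ?thesis unfolding blt_def using k l by (intro bexI[of _ k]) auto
  next
    case 2
    then show ?thesis unfolding blt_def using k l by (intro bexI[of _ l]) auto
  next
    case 3
    then show ?thesis unfolding blt_def using k l by (intro bexI[of _ k]) auto
  qed
qed

lemma blt_total:
  assumes "finite S"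
  shows "blt S x y \<or> blt S y x \<or> (\<forall>i\<in>S. st i (x i) = st i (y i))"
proof (cases "\<forall>i\<in>S. st i (x i) = st i (y i)")
  case False
  define D where "D = {i \<in> S. st i (x i) \<noteq> st i (y i)}"
  have D: "finite D" "D \<noteq> {}" using assms False unfolding D_def by auto
  define k where "k = Min D"
  have k: "k \<in> D" unfolding k_def using D by (rule Min_in)
  have lo: "st i (x i) = st i (y i)" if "i \<in> S" "i < k" for i
    using that Min_le[OF D(1), of i] unfolding k_def D_def by force
  have kS: "k \<in> S" and ne: "st k (x k) \<noteq> st k (y k)" using k unfolding D_def by auto
  show ?thesis
  proof (cases "st k (x k) < st k (y k)")
    case True
    then have "blt S x y" unfolding blt_def using kS lo by (intro bexI[of _ k]) auto
    then show ?thesis ..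
  next
    case False
    then have "st k (y k) < st k (x k)" using ne by simp
    then have "blt S y x" unfolding blt_def using kS lo by (intro bexI[of _ k] conjI) (auto simp: lo)
    then show ?thesis by simp
  qed
qed simp

lemma le_blt:
  assumes "finite S" "\<And>i. i \<in> S \<Longrightarrow> st i (x i) \<le> st i (y i)" "i \<in> S" "st i (x i) < st i (y i)"
  shows "blt S x y"
proof -
  have "\<not> blt S y x" unfolding blt_def using assms(2) by (meson not_le)
  then show ?thesis using blt_total[OF assms(1), of x y] assms(3,4) by auto
qed

text \<open>\<open>shift_better\<close> with one pair. The sizes stay decreasing by
  \<open>hi\<close> and \<open>lo\<close>: the value at \<open>b0\<close> does not fall below
  \<open>t\<close>, and the value at \<open>b1\<close> does not rise above it.\<close>

lemma single_shift:
  assumes S: "S \<subseteq> I" "j \<in> S" "S - {j} \<noteq> {}" and T: "down S T" and o: "opt (S - {j})"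
    and sc: "section_closed S j T"
    and s: "s = (\<lambda>b. card (sect S j b T))"
    and b: "1 \<le> b0" "b0 < b1" "b1 \<le> n j" "t < s b0" "s b1 < t"
    and hi: "\<And>b. b0 < b \<Longrightarrow> b \<le> n j \<Longrightarrow> s b \<le> t" and lo: "\<And>b. 1 \<le> b \<Longrightarrow> b < b1 \<Longrightarrow> t \<le> s b"
    and dl: "dl j b0 \<le> dl j b1"
    and free: "\<And>x y. x \<in> V (S - {j}) \<Longrightarrow> y \<in> V (S - {j}) \<Longrightarrow> t \<le> pos (S - {j}) x \<Longrightarrow>
         pos (S - {j}) y < t \<Longrightarrow> x(j := b0) \<in> T \<Longrightarrow> y(j := b1) \<notin> T \<Longrightarrow> \<exists>i\<in>S - {j}. x i < y i"
    and before: "\<And>x y. x \<in> V (S - {j}) \<Longrightarrow> y \<in> V (S - {j}) \<Longrightarrow> t \<le> pos (S - {j}) x \<Longrightarrow>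
         pos (S - {j}) y < t \<Longrightarrow> lt S (y(j := b1)) (x(j := b0))"
  shows "\<exists>T'. better S T T'"
proof -
  define s' where "s' = s(b0 := max t (s b0 + s b1 - t), b1 := min t (s b0 + s b1 - t))"
  have anti: "s c \<le> s b" if "1 \<le> b" "b \<le> c" "c \<le> n j" for b c
    unfolding s using that by (rule card_sect_antimono[OF S(1) T S(2)])
  have anti': "s' c \<le> s' b" if bc: "1 \<le> b" "b \<le> c" "c \<le> n j" for b c
  proof -
    have 1: "s b0 \<le> s b'" if "1 \<le> b'" "b' \<le> b0" for b' using anti[of b' b0] that b by auto
    have 2: "s c' \<le> s b1" if "b1 \<le> c'" "c' \<le> n j" for c' using anti[of b1 c'] that b by auto
    show ?thesis
      unfolding s'_def using 1[of b] 2[of c] hi[of c] lo[of b] anti[OF bc] bc b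
      by (auto simp: max_def min_def)
  qed
  have "better S T (slab S j s')"
  proof (rule shift_better[OF S o, of T s "{0::nat}" "\<lambda>_. b0" "\<lambda>_. b1" t s'])
    show "T = slab S j s" unfolding s by (rule section_closed_slab[OF S sc down_V[OF T]])
    show "s b \<le> card (V (S - {j}))" for b unfolding s by (rule card_sect_le[OF S(1)])
  qed (use b dl free before anti' in \<open>auto simp: s'_def\<close>)
  then show ?thesis by blast
qed

text \<open>Suppose \<open>x\<close> is outside the first part in coordinate \<open>j\<close>.
  Closedness over \<open>a\<close> then gives a tuple of \<open>T\<close> in the slice of
  \<open>x\<close> with the largest value in coordinate \<open>z\<close>. Raising \<open>y\<close>
  to that value puts both into one section over \<open>z\<close>, where the earlier slice has to
  come first. The claim about \<open>y\<close> is dual.\<close>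

lemma slice_ends:
  assumes S: "S \<subseteq> I" and a: "a = Min S" and z: "z = Max S" and j: "j \<in> S" "j \<noteq> a" "j \<noteq> z"
    and T: "down S T" and sca: "section_closed S a T" and scz: "section_closed S z T"
    and x: "x \<in> T" and y: "y \<in> V S" "y \<notin> T" and sl: "st a (y a) < st a (x a)"
  shows "st j (x j) = st j 1 \<and> st j (y j) = st j (n j)"
proof -
  have fin: "finite S" using S finite_I finite_subset by blast
  have az: "a \<in> S" "z \<in> S" unfolding a z using fin j(1) by (blast intro: Min_in Max_in)+
  have a_le: "a \<le> i" and z_ge: "i \<le> z" if "i \<in> S" for i unfolding a z using fin that by auto
  have lt: "a < j" "j < z" using a_le[OF j(1)] z_ge[OF j(1)] j by auto
  have n1: "1 \<le> n i" if "i \<in> S" for i using n_pos that S by auto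
  have xV: "x \<in> V S" using x down_V[OF T] by auto
  note xb = V_D[OF xV] and yb = V_D[OF y(1)]
  have memV: "(\<lambda>i\<in>S. u i) \<in> V S" if "\<And>i. i \<in> S \<Longrightarrow> 1 \<le> u i \<and> u i \<le> n i" for u
    using that unfolding V_def by auto
  \<comment> \<open>The contradiction aimed at: two tuples in one section over \<open>z\<close>,
    with the one from the earlier slice missing from \<open>T\<close>.\<close>
  have cross: False if uv: "u \<in> V S" "u \<notin> T" "v \<in> T" "u z = v z" "u a = y a" "v a = x a" for u v
  proof -
    have "blt S u v" unfolding blt_def
    proof (intro bexI[of _ a] conjI ballI impI)
      show "st a (u a) < st a (v a)" using sl uv by simp
      show "st i (u i) = st i (v i)" if "i \<in> S" "i < a" for i using a_le[OF that(1)] that(2) by simp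
    qed (rule az)
    then have "lt S u v" using blt_lt[OF S uv(1)] uv(3) down_V[OF T] by auto
    then show False using scz uv unfolding section_closed_def by blast
  qed
  have up: "u \<notin> T" if "\<And>i. i \<in> S \<Longrightarrow> y i \<le> u i" for u
    using downD[OF T _ y(1), of u] that y(2) by blast
  have along: "u \<in> T" if uv: "v \<in> T" "u \<in> V S" "u a = v a" "blt S u v" for u v
    using sca uv blt_lt[OF S uv(2) _ uv(4)] down_V[OF T] unfolding section_closed_def by blast
  show ?thesis
  proof (intro conjI; rule ccontr)
    assume ne: "st j (x j) \<noteq> st j 1"
    \<comment> \<open>\<open>x2\<close> gives up the excess of \<open>x1\<close> in coordinate
      \<open>j\<close> for the largest value in \<open>z\<close>; since \<open>j\<close> is compared
      before \<open>z\<close>, it precedes \<open>x1\<close>.\<close>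
    define x1 where "x1 = (\<lambda>i\<in>S. if i = a then x a else if i = j then x j else 1)"
    define x2 where "x2 = (\<lambda>i\<in>S. if i = a then x a else if i = z then n z else 1)"
    have V1: "x1 \<in> V S" "x2 \<in> V S" unfolding x1_def x2_def using xb n1 by (auto intro!: memV)
    have "x1 \<in> T" using xb by (intro downD[OF T x V1(1)]) (auto simp: x1_def)
    moreover have "blt S x2 x1"
      unfolding blt_def
    proof (intro bexI[of _ j] conjI ballI impI)
      show "st j (x2 j) < st j (x1 j)"
        using j ne st_mono[of j 1 "x j"] S xb[OF j(1)] by (auto simp: x1_def x2_def)
      show "st i (x2 i) = st i (x1 i)" if "i \<in> S" "i < j" for i
        using that lt by (auto simp: x1_def x2_def)
    qed (rule j)
    moreover have "x2 a = x1 a" using az by (simp add: x1_def x2_def)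
    ultimately have "x2 \<in> T" using along V1 by blast
    define y1 where "y1 = y(z := n z)"
    have y1: "y1 \<in> V S" unfolding y1_def using y az n1 by (intro upd_V') auto
    have "y1 \<notin> T"
    proof (rule up)
      show "y i \<le> y1 i" if "i \<in> S" for i using yb[OF that] that by (auto simp: y1_def)
    qed
    moreover have "y1 z = x2 z" "y1 a = y a" "x2 a = x a"
      using lt az by (simp_all add: y1_def x2_def)
    ultimately show False using cross y1 \<open>x2 \<in> T\<close> by blast
  next
    assume ne: "st j (y j) \<noteq> st j (n j)"
    \<comment> \<open>The dual choice: \<open>y1\<close> is as large as possible outside
      \<open>a\<close> and \<open>j\<close>, and \<open>y2\<close> gives up coordinate
      \<open>z\<close> in order to exceed it in \<open>j\<close>.\<close>
    define y1 where "y1 = (\<lambda>i\<in>S. if i = a then y a else if i = j then y j else n i)"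
    define y2 where "y2 = (\<lambda>i\<in>S. if i = a then y a else if i = z then 1 else n i)"
    have V1: "y1 \<in> V S" "y2 \<in> V S" unfolding y1_def y2_def using yb n1 by (auto intro!: memV)
    have "y1 \<notin> T"
    proof (rule up)
      show "y i \<le> y1 i" if "i \<in> S" for i using yb[OF that] that by (auto simp: y1_def)
    qed
    moreover have "blt S y1 y2"
      unfolding blt_def
    proof (intro bexI[of _ j] conjI ballI impI)
      show "st j (y1 j) < st j (y2 j)"
        using j ne st_mono[of j "y j" "n j"] S yb[OF j(1)] by (auto simp: y1_def y2_def)
      show "st i (y1 i) = st i (y2 i)" if "i \<in> S" "i < j" for i
        using that lt by (auto simp: y1_def y2_def)
    qed (rule j)
    moreover have "y1 a = y2 a" using az by (simp add: y1_def y2_def)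
    ultimately have "y2 \<notin> T" using along V1 by blast
    define x1 where "x1 = x(z := 1)"
    have x1: "x1 \<in> V S" unfolding x1_def using xV az n1 by (intro upd_V') auto
    have "x1 \<in> T" using xb by (intro downD[OF T x x1]) (auto simp: x1_def)
    moreover have "y2 z = x1 z" "y2 a = y a" "x1 a = x a"
      using lt az by (simp_all add: y2_def x1_def)
    ultimately show False using cross V1 \<open>y2 \<notin> T\<close> by blast
  qed
qed

text \<open>Recognises an initial segment by comparing blocks only; the size of such a set is a
  threshold at a block boundary.\<close>

lemma init_block:
  assumes S: "S \<subseteq> I" "S \<noteq> {}"
    and X: "X \<subseteq> V S" "\<And>u v. v \<in> X \<Longrightarrow> u \<in> V S \<Longrightarrow> u \<notin> X \<Longrightarrow> blt S v u"
  shows "X = init S (card X)"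
proof (rule init_unique[OF S X(1)])
  fix x y assume xy: "x \<in> X" "y \<in> V S" "lt S y x"
  show "y \<in> X"
  proof (rule ccontr)
    assume "y \<notin> X"
    then have "lt S x y" using X xy blt_lt[OF S(1)] by blast
    then show False using lt_asym[OF S] X(1) xy by blast
  qed
qed

lemma sect_pos:
  assumes "S \<subseteq> I" "j \<in> S" "S - {j} \<noteq> {}" "section_closed S j T" "x \<in> V S"
  shows "x \<in> T \<longleftrightarrow> pos (S - {j}) (restrict x (S - {j})) < card (sect S j (x j) T)"
proof -
  have "x j \<in> {1..n j}" using V_D[OF assms(5,2)] by auto
  from arg_cong[OF section_closed_sect[OF assms(1-4) this], of "\<lambda>X. restrict x (S - {j}) \<in> X"]
  show ?thesis
    using restrict_V[OF assms(5), of "S - {j}"] upd_restrict[OF assms(5), of j]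
    unfolding sect_def init_def by auto
qed

lemma upd_pos:
  assumes "S \<subseteq> I" "j \<in> S" "S - {j} \<noteq> {}" "section_closed S j T" "b \<in> {1..n j}" "v \<in> V (S - {j})"
  shows "v(j := b) \<in> T \<longleftrightarrow> pos (S - {j}) v < card (sect S j b T)"
  using sect_pos[OF assms(1-4) upd_V[OF assms(2,6,5)]] assms(6) by simp


text \<open>The threshold \<open>t\<close> counts the tuples over \<open>S - {j}\<close> in the
  slices up to that of \<open>y\<close>, so a tuple below \<open>t\<close> precedes one above
  \<open>t\<close> whatever values coordinate \<open>j\<close> takes. If the crossing pair
  \<open>b0\<close>, \<open>b1\<close> has its weights in the wrong order, regularity permits a
  simultaneous shift from the first part to the last.\<close>

lemma step_slices:
  assumes S: "S \<subseteq> I" and a: "a = Min S" and z: "z = Max S" and j: "j \<in> S" "j \<noteq> a" "j \<noteq> z"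
    and T: "down S T" and o: "opt (S - {j})"
    and sca: "section_closed S a T" and scz: "section_closed S z T" and scj: "section_closed S j T"
    and x: "x \<in> T" and y: "y \<in> V S" "y \<notin> T" and sl: "st a (y a) < st a (x a)"
  shows "\<exists>T'. better S T T'"
proof -
  have fin: "finite S" using S finite_I finite_subset by blast
  have az: "a \<in> S" "z \<in> S" unfolding a z using fin j(1) by (blast intro: Min_in Max_in)+
  have a_le: "a \<le> i" and z_ge: "i \<le> z" if "i \<in> S" for i unfolding a z using fin that by auto
  have lt': "a < j" "j < z" using a_le[OF j(1)] z_ge[OF j(1)] j by auto
  have jI: "j \<in> I" using j S by auto
  have fI: "finite I" by (rule finite_I)
  \<comment> \<open>Interior in \<open>S\<close> implies interior in \<open>I\<close>, for which
    \<open>nondecr\<close> and \<open>regular\<close> are stated.\<close>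
  have "Min I \<le> a" "z \<le> Max I" using fI az S by auto
  then have j_mid: "j \<noteq> Min I" "j \<noteq> Max I" using lt' by auto
  define R where "R = S - {j}"
  have R: "R \<subseteq> I" "R \<noteq> {}" using S az j R_def by auto
  have R0: "S - {j} \<noteq> {}" using R R_def by auto
  have aR: "a \<in> R" using az j R_def by auto
  have xV: "x \<in> V S" using x down_V[OF T] by auto
  define s where "s = (\<lambda>b. card (sect S j b T))"
  define q where "q = st a (y a)"
  define X where "X = {v \<in> V R. st a (v a) \<le> q}"
  define t where "t = card X"
  have XV: "X \<subseteq> V R" unfolding X_def by auto
  have bltI: "blt Q u v" if "Q \<subseteq> S" "a \<in> Q" "st a (u a) < st a (v a)" for Q u v
    unfolding blt_def
  proof (intro bexI[of _ a] conjI ballI impI)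
    show "st i (u i) = st i (v i)" if "i \<in> Q" "i < a" for i
      using a_le[of i] that \<open>Q \<subseteq> S\<close> by auto
  qed (use that in auto)
  have X: "X = init R t"
    unfolding t_def
  proof (rule init_block[OF R XV])
    fix u v assume "v \<in> X" "u \<in> V R" "u \<notin> X"
    then show "blt R v u" using aR unfolding X_def R_def by (intro bltI) auto
  qed
  have pos_t: "pos R v < t \<longleftrightarrow> st a (v a) \<le> q" if "v \<in> V R" for v
  proof -
    have "pos R v < t \<longleftrightarrow> v \<in> X" using that unfolding X init_def by simp
    then show ?thesis using that unfolding X_def by simp
  qed
  have anti: "s c \<le> s b" if "1 \<le> b" "b \<le> c" "c \<le> n j" for b c
    unfolding s_def using that by (rule card_sect_antimono[OF S T j(1)])
  have s_le: "s b \<le> card (V R)" for b unfolding s_def R_def by (rule card_sect_le[OF S])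
  have rV: "restrict x R \<in> V R" "restrict y R \<in> V R" using xV y by (auto intro!: restrict_V simp: R_def)
  have "pos R (restrict x R) < s (x j)"
    using sect_pos[OF S j(1) R0 scj xV] x unfolding s_def R_def by simp
  moreover have "t \<le> pos R (restrict x R)"
    using pos_t[OF rV(1)] sl aR unfolding q_def by (simp add: not_less[symmetric])
  ultimately have tx: "t < s (x j)" by simp
  have "s (y j) \<le> pos R (restrict y R)"
    using sect_pos[OF S j(1) R0 scj y(1)] y(2) unfolding s_def R_def by simp
  moreover have "pos R (restrict y R) < t"
    using pos_t[OF rV(2)] aR unfolding q_def by simp
  ultimately have ty: "s (y j) < t" by simp
  note xj = V_D[OF xV j(1)] and yj = V_D[OF y(1) j(1)]
  obtain b0 b1 where b: "x j \<le> b0" "b0 < b1" "b1 \<le> y j" "t < s b0" "s b1 < t"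
    "\<And>b. b0 < b \<Longrightarrow> b \<le> n j \<Longrightarrow> s b \<le> t" "\<And>b. 1 \<le> b \<Longrightarrow> b < b1 \<Longrightarrow> t \<le> s b"
    using antimono_crossing[of "n j" s "x j" t "y j"] anti tx ty xj yj by blast
  have br: "1 \<le> b0" "b0 \<le> n j" "1 \<le> b1" "b1 \<le> n j" using b xj yj by auto
  have memT: "v(j := c) \<in> T \<longleftrightarrow> pos R v < s c" if "v \<in> V R" "1 \<le> c" "c \<le> n j" for v c
    using upd_pos[OF S j(1) R0 scj, of c v] that unfolding s_def R_def by simp
  \<comment> \<open>Position \<open>t\<close> in section \<open>b0\<close> gives a member of
    \<open>T\<close>, position \<open>s b1\<close> in section \<open>b1\<close> a non-member; they
    lie on different sides of the threshold, so \<open>slice_ends\<close> applies.\<close>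
  have ends: "st j b0 = st j 1 \<and> st j b1 = st j (n j)"
  proof -
    have "t \<in> pos R ` V R" "s b1 \<in> pos R ` V R"
      using pos_image[OF R] b s_le[of b0] by auto
    then obtain u v where u: "u \<in> V R" "pos R u = t" and v: "v \<in> V R" "pos R v = s b1" by auto
    have 1: "u(j := b0) \<in> T" using memT[OF u(1), of b0] u br b by simp
    have 2: "v(j := b1) \<notin> T" using memT[OF v(1), of b1] v br by simp
    have 3: "v(j := b1) \<in> V S" using upd_V[OF j(1)] v br R_def by simp
    have "st a (v a) < st a (u a)" using pos_t[OF u(1)] pos_t[OF v(1)] u v b by simp
    then have "st a ((v(j := b1)) a) < st a ((u(j := b0)) a)" using j by simp
    from slice_ends[OF S a z j T sca scz 1 3 2 this] show ?thesis by simp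
  qed
  have sep: "st a (v a) < st a (u a)" if "u \<in> V R" "v \<in> V R" "t \<le> pos R u" "pos R v < t" for u v
    using pos_t[OF that(1)] pos_t[OF that(2)] that by simp
  have before: "lt S (v(j := c)) (u(j := b))"
    if "u \<in> V R" "v \<in> V R" "t \<le> pos R u" "pos R v < t" "b \<in> {1..n j}" "c \<in> {1..n j}" for u v b c
  proof (rule blt_lt[OF S])
    show "blt S (v(j := c)) (u(j := b))" using sep[OF that(1-4)] az j by (intro bltI) auto
  qed (use that upd_V[OF j(1)] R_def in auto)
  have free: "\<exists>i\<in>R. u i < v i"
    if uv: "u \<in> V R" "v \<in> V R" "t \<le> pos R u" "pos R v < t" "b \<in> {1..n j}" "c \<in> {1..n j}"
      "u(j := b) \<in> T" "v(j := c) \<notin> T" for u v b c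
  proof (rule ccontr)
    assume no: "\<not> (\<exists>i\<in>R. u i < v i)"
    \<comment> \<open>Raising coordinate \<open>z\<close> keeps \<open>v'\<close> outside
      \<open>T\<close> and in an earlier slice, and puts it into the section of \<open>u'\<close>
      over \<open>z\<close>.\<close>
    define u' v' where "u' = u(j := b)" and "v' = (v(j := c))(z := u z)"
    have zR: "z \<in> R" using az j R_def by auto
    have vV: "v(j := c) \<in> V S" "u' \<in> V S" unfolding u'_def using upd_V[OF j(1)] uv R_def by auto
    have v'V: "v' \<in> V S" unfolding v'_def using V_D[OF uv(1) zR] by (intro upd_V' vV az) auto
    have "v' \<notin> T"
    proof
      assume "v' \<in> T"
      have "v z \<le> u z" using no zR by (meson not_le)
      then have "(v(j := c)) i \<le> v' i" for i
        unfolding v'_def using j(3) by (cases "i = z") auto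
      then have "v(j := c) \<in> T" using downD[OF T \<open>v' \<in> T\<close> vV(1)] by blast
      then show False using uv(8) by simp
    qed
    moreover have "lt S v' u'"
    proof (rule blt_lt[OF S v'V vV(2)], rule bltI)
      show "st a (v' a) < st a (u' a)"
        using sep[OF uv(1-4)] j lt' unfolding u'_def v'_def by simp
    qed (use az in auto)
    moreover have "v' z = u' z" unfolding u'_def v'_def using j by simp
    ultimately show False using scz uv(7) v'V unfolding section_closed_def u'_def by blast
  qed
  show ?thesis
  proof (cases "dl j b0 \<le> dl j b1")
    case True
    show ?thesis
    proof (rule single_shift[OF S j(1) R0 T o scj s_def br(1) b(2) br(4) b(4,5) b(6,7) True])
      fix u v assume uv: "u \<in> V (S - {j})" "v \<in> V (S - {j})" "t \<le> pos (S - {j}) u" "pos (S - {j}) v < t"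
      show "lt S (v(j := b1)) (u(j := b0))"
        using uv br by (intro before) (simp_all add: R_def)
      assume "u(j := b0) \<in> T" "v(j := b1) \<notin> T"
      then show "\<exists>i\<in>S - {j}. u i < v i"
        using uv br free[of u v b0 b1] by (simp add: R_def)
    qed
  next
    case False
    obtain N l where N: "N \<le> n j" "0 \<le> l"
      and F: "\<And>b. 1 \<le> b \<Longrightarrow> b \<le> n j \<Longrightarrow> st j b = st j 1 \<longleftrightarrow> b \<le> N"
      and L: "\<And>b. 1 \<le> b \<Longrightarrow> b \<le> n j \<Longrightarrow> st j b = st j (n j) \<longleftrightarrow> n j - N < b"
      and dlN: "\<And>b. 1 \<le> b \<Longrightarrow> b \<le> N \<Longrightarrow> dl j (n j - N + b) = l + dl j b"
    proof -
      obtain N l where "N \<le> n j" "0 \<le> l"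
        "\<forall>b\<in>{1..n j}. (st j b = st j 1 \<longleftrightarrow> b \<le> N) \<and> (st j b = st j (n j) \<longleftrightarrow> n j - N < b)"
        "\<forall>b\<in>{1..N}. dl j (n j - N + b) = l + dl j b"
        using regular[OF jI j_mid] by blast
      then show thesis by (intro that[of N l]) simp_all
    qed
    define h where "h b = n j - N + b" for b
    have b0N: "b0 \<le> N" using F[of b0] ends br by simp
    have b1L: "n j - N < b1" using L[of b1] ends br by simp
    \<comment> \<open>If there were only one part, monotonicity would put the two weights in the
      right order; so the first and last part are disjoint here.\<close>
    have "st j 1 \<noteq> st j (n j)"
    proof
      assume "st j 1 = st j (n j)"
      then have "st j b0 = st j b1" using ends by simp
      then have "dl j b0 \<le> dl j b1" using nondecr[OF jI j_mid(2) br(1) _ br(4)] b(2) by simp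
      then show False using False by simp
    qed
    moreover have "st j N = st j 1" using F[of N] b0N br N by simp
    ultimately have NL: "N \<le> n j - N" using L[of N] b0N br N by simp
    define i1 where "i1 = b1 - (n j - N)"
    have i1: "1 \<le> i1" "i1 \<le> N" "h i1 = b1" unfolding i1_def h_def using b1L br N by auto
    \<comment> \<open>Otherwise monotonicity from \<open>b0\<close> to \<open>i1\<close> in the
      first part, followed by the offset \<open>l\<close>, would give the right order.\<close>
    have "i1 < b0"
    proof (rule ccontr)
      assume "\<not> i1 < b0"
      then have "dl j b0 \<le> dl j i1"
        using F[of b0] F[of i1] b0N br i1 N by (intro nondecr[OF jI j_mid(2)]) auto
      also have "\<dots> \<le> dl j b1" using dlN[of i1] i1 N unfolding h_def by simp
      finally show False using False by simp
    qed
    \<comment> \<open>Here \<open>b0\<close> has a larger index in the first part than \<open>b1\<close> has in the last part. Moving from the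
      \<open>i\<close>-th section of the first part to the \<open>i\<close>-th section of the last part, for all \<open>i\<close> at once, keeps
      the section sizes decreasing and does not lower the weight, by regularity.\<close>
    define s' where "s' b = (if b \<le> N then max t (s b + s (h b) - t)
        else if n j - N < b then min t (s (b - (n j - N)) + s b - t) else s b)" for b
    have h_range: "1 \<le> h b \<and> h b \<le> n j" if "1 \<le> b" "b \<le> N" for b using that N unfolding h_def by auto
    have hiF: "t \<le> s b" if "1 \<le> b" "b \<le> N" for b using b(7)[of b] that NL b1L by simp
    have loL: "s b \<le> t" if "n j - N < b" "b \<le> n j" for b using b(6)[of b] that NL b0N by simp
    \<comment> \<open>Such a section comes after \<open>b0\<close> and before \<open>b1\<close>,
      hence is neither longer nor shorter than \<open>t\<close>.\<close>
    have mid: "s b = t" if "N < b" "b \<le> n j - N" for b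
      using b(6)[of b] b(7)[of b] that b0N b1L by simp
    have anti': "s' c \<le> s' b" if bc: "1 \<le> b" "b \<le> c" "c \<le> n j" for b c
    proof -
      consider "c \<le> N" | "b \<le> N" "N < c" "c \<le> n j - N" | "b \<le> N" "n j - N < c"
        | "N < b" "c \<le> n j - N" | "N < b" "b \<le> n j - N" "n j - N < c" | "n j - N < b"
        using bc by linarith
      then show ?thesis
      proof cases
        case 1
        have "s c \<le> s b" "s (h c) \<le> s (h b)"
          using anti[of b c] anti[of "h b" "h c"] bc 1 h_range[of b] h_range[of c] by (auto simp: h_def)
        then have "s c + s (h c) - t \<le> s b + s (h b) - t" by (intro diff_le_mono add_mono)
        then show ?thesis using 1 bc unfolding s'_def by (auto simp: max_def)
      next
        case 2 then show ?thesis using mid[of c] unfolding s'_def by simp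
      next
        case 3 then show ?thesis using NL unfolding s'_def by simp
      next
        case 4 then show ?thesis using mid[of c] mid[of b] bc unfolding s'_def by simp
      next
        case 5 then show ?thesis using mid[of b] NL unfolding s'_def by simp
      next
        case 6
        have "s c \<le> s b" using anti[of b c] bc by simp
        moreover have "s (c - (n j - N)) \<le> s (b - (n j - N))"
          using bc 6 N by (intro anti) auto
        ultimately have "s (c - (n j - N)) + s c - t \<le> s (b - (n j - N)) + s b - t"
          by (intro diff_le_mono add_mono)
        then show ?thesis using 6 bc NL unfolding s'_def by (auto simp: min_def)
      qed
    qed
    have "better S T (slab S j s')"
    proof (rule shift_better[OF S j(1) R0 o, of T s "{1..N}" "\<lambda>b. b" h t s' i1])
      show "T = slab S j s" unfolding s_def by (rule section_closed_slab[OF S j(1) R0 scj down_V[OF T]])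
      show "s b \<le> card (V (S - {j}))" for b using s_le R_def by simp
      show "finite {1..N}" "inj_on (\<lambda>b. b) {1..N}" "inj_on h {1..N}" unfolding inj_on_def h_def by auto
      show "(\<lambda>b. b) ` {1..N} \<subseteq> {1..n j}" using N by auto
      show "h ` {1..N} \<subseteq> {1..n j}" using h_range by auto
      show "(\<lambda>b. b) ` {1..N} \<inter> h ` {1..N} = {}" using NL unfolding h_def by auto
      show "s (h k) \<le> t \<and> t \<le> s k" if "k \<in> {1..N}" for k
        using that hiF[of k] loL[of "h k"] h_range[of k] by (simp add: h_def)
      show "s' k = max t (s k + s (h k) - t)" if "k \<in> {1..N}" for k using that unfolding s'_def by simp
      show "s' (h k) = min t (s k + s (h k) - t)" if "k \<in> {1..N}" for k
      proof -
        have "\<not> h k \<le> N" "n j - N < h k" "h k - (n j - N) = k" using that NL unfolding h_def by auto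
        then show ?thesis unfolding s'_def by simp
      qed
      show "s' b = s b" if "b \<in> {1..n j}" "b \<notin> (\<lambda>b. b) ` {1..N}" "b \<notin> h ` {1..N}" for b
      proof -
        have "N < b" using that by auto
        moreover have "\<not> n j - N < b"
        proof
          assume c: "n j - N < b"
          then have "b - (n j - N) \<in> {1..N}" "b = h (b - (n j - N))" using that N unfolding h_def by auto
          then show False using that(3) by blast
        qed
        ultimately show ?thesis unfolding s'_def by simp
      qed
      show "dl j k \<le> dl j (h k)" if "k \<in> {1..N}" for k using dlN[of k] N that unfolding h_def by simp
      show "s' c \<le> s' b" if "1 \<le> b" "b \<le> c" "c \<le> n j" for b c using anti' that by blast
      show "\<exists>i\<in>S - {j}. u i < v i"
        if "k \<in> {1..N}" "u \<in> V (S - {j})" "v \<in> V (S - {j})" "t \<le> pos (S - {j}) u" "pos (S - {j}) v < t"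
          "u(j := k) \<in> T" "v(j := h k) \<notin> T" for k u v
        using free[of u v k "h k"] that h_range[of k] N by (simp add: R_def)
      show "lt S (v(j := h l)) (u(j := k))"
        if "k \<in> {1..N}" "l \<in> {1..N}" "u \<in> V (S - {j})" "v \<in> V (S - {j})" "t \<le> pos (S - {j}) u"
          "pos (S - {j}) v < t" for k l u v
        using before[of u v k "h l"] that h_range[of l] N by (simp add: R_def)
      \<comment> \<open>The pair with index \<open>i1\<close> really moves something: its receiver
        is \<open>b1\<close>, and its donor precedes \<open>b0\<close>, hence is longer than
        \<open>t\<close>.\<close>
      show "i1 \<in> {1..N}" using i1 by simp
      show "s (h i1) < t" using i1 b by simp
      show "t < s i1" using anti[of i1 b0] \<open>i1 < b0\<close> i1 br b(4) by simp
    qed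
    then show ?thesis by blast
  qed
qed


text \<open>Within one slice the sections are taken over the first coordinate, and the threshold
  separates the blocks over \<open>S - {a}\<close> up to that of \<open>y\<close> from the later
  ones. Both crossing indices lie between \<open>x a\<close> and \<open>y a\<close>, hence in one
  part, where weights are monotone.\<close>

lemma step_blocks:
  assumes S: "S \<subseteq> I" "3 \<le> card S" and a: "a = Min S"
    and T: "down S T" and o: "opt (S - {a})"
    and sc: "\<And>i. i \<in> S \<Longrightarrow> section_closed S i T"
    and x: "x \<in> T" and y: "y \<in> V S" "y \<notin> T" and sl: "st a (y a) = st a (x a)" and bl: "blt S y x"
  shows "\<exists>T'. better S T T'"
proof -
  have fin: "finite S" using S finite_I finite_subset by blast
  have "S \<noteq> {}" using S by auto
  then have aS: "a \<in> S" unfolding a using fin by (blast intro: Min_in)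
  have a_le: "a \<le> i" if "i \<in> S" for i unfolding a using fin that by auto
  define R where "R = S - {a}"
  have cR: "2 \<le> card R" using S(2) aS fin unfolding R_def by simp
  have R: "R \<subseteq> I" "R \<noteq> {}"
  proof -
    show "R \<subseteq> I" using S R_def by auto
    show "R \<noteq> {}"
    proof
      assume "R = {}"
      then show False using cR by simp
    qed
  qed
  have R0: "S - {a} \<noteq> {}" using R R_def by auto
  have finR: "finite R" using fin R_def by auto
  have aI: "a \<in> I" using aS S by auto
  have fI: "finite I" by (rule finite_I)
  \<comment> \<open>The least element of \<open>S\<close> is not the greatest of \<open>I\<close>,
    so \<open>nondecr\<close> applies to it.\<close>
  have aM: "a \<noteq> Max I"
  proof -
    obtain i where i: "i \<in> R" using R by auto
    then have "a < i" "i \<in> I" using a_le[of i] R R_def by auto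
    then show ?thesis using Max_ge[OF fI, of i] by simp
  qed
  have xV: "x \<in> V S" using x down_V[OF T] by auto
  define s where "s = (\<lambda>b. card (sect S a b T))"
  \<comment> \<open>Here \<open>y\<close> is a tuple over \<open>S\<close>, but \<open>blt R\<close>
    reads only its coordinates in \<open>R\<close>.\<close>
  define X where "X = {v \<in> V R. \<not> blt R y v}"
  define t where "t = card X"
  have XV: "X \<subseteq> V R" unfolding X_def by auto
  have X: "X = init R t"
    unfolding t_def
  proof (rule init_block[OF R XV])
    fix u v assume uv: "v \<in> X" "u \<in> V R" "u \<notin> X"
    then have "blt R y u" "\<not> blt R y v" unfolding X_def by auto
    then show "blt R v u"
      using blt_total[OF finR, of v y] blt_trans blt_cong[of R v y u u] by blast
  qed
  have pos_t: "pos R v < t \<longleftrightarrow> \<not> blt R y v" if "v \<in> V R" for v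
  proof -
    have "pos R v < t \<longleftrightarrow> v \<in> X" using that unfolding X init_def by simp
    then show ?thesis using that unfolding X_def by simp
  qed
  have anti: "s c \<le> s b" if "1 \<le> b" "b \<le> c" "c \<le> n a" for b c
    unfolding s_def using that by (rule card_sect_antimono[OF S(1) T aS])
  have s_le: "s b \<le> card (V R)" for b unfolding s_def R_def by (rule card_sect_le[OF S(1)])
  have rV: "restrict x R \<in> V R" "restrict y R \<in> V R" using xV y by (auto intro!: restrict_V simp: R_def)
  have blR: "blt R y (restrict x R)" "\<not> blt R y (restrict y R)"
  proof -
    have "blt R y x"
      using bl sl unfolding blt_def R_def by (metis DiffD1 DiffI nat_neq_iff singletonD)
    then show "blt R y (restrict x R)" using blt_cong[of R y y x "restrict x R"] by simp
    show "\<not> blt R y (restrict y R)" unfolding blt_def by auto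
  qed
  have "pos R (restrict x R) < s (x a)"
    using sect_pos[OF S(1) aS R0 sc[OF aS] xV] x unfolding s_def R_def by simp
  moreover have "t \<le> pos R (restrict x R)"
    using pos_t[OF rV(1)] blR by (simp add: not_less[symmetric])
  ultimately have tx: "t < s (x a)" by simp
  have "s (y a) \<le> pos R (restrict y R)"
    using sect_pos[OF S(1) aS R0 sc[OF aS] y(1)] y(2) unfolding s_def R_def by simp
  moreover have "pos R (restrict y R) < t"
    using pos_t[OF rV(2)] blR by simp
  ultimately have ty: "s (y a) < t" by simp
  note xj = V_D[OF xV aS] and yj = V_D[OF y(1) aS]
  obtain b0 b1 where b: "x a \<le> b0" "b0 < b1" "b1 \<le> y a" "t < s b0" "s b1 < t"
    "\<And>b. b0 < b \<Longrightarrow> b \<le> n a \<Longrightarrow> s b \<le> t" "\<And>b. 1 \<le> b \<Longrightarrow> b < b1 \<Longrightarrow> t \<le> s b"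
    using antimono_crossing[of "n a" s "x a" t "y a"] anti tx ty xj yj by blast
  have br: "1 \<le> b0" "b0 \<le> n a" "1 \<le> b1" "b1 \<le> n a" using b xj yj by auto
  have "st a (x a) \<le> st a b0" "st a b0 \<le> st a b1" "st a b1 \<le> st a (y a)"
    using st_mono[OF aI] b br xj yj by auto
  then have st_eq: "st a b0 = st a b1" using sl by simp
  have dl: "dl a b0 \<le> dl a b1" using nondecr[OF aI aM br(1) _ br(4) st_eq] b(2) by simp
  show ?thesis
  proof (rule single_shift[OF S(1) aS R0 T o sc[OF aS] s_def br(1) b(2) br(4) b(4,5) b(6,7) dl])
    fix u v assume "u \<in> V (S - {a})" "v \<in> V (S - {a})" "t \<le> pos (S - {a}) u" "pos (S - {a}) v < t"
    then have uv: "u \<in> V R" "v \<in> V R" "blt R y u" "\<not> blt R y v"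
      using pos_t[of u] pos_t[of v] unfolding R_def by auto
    have uvS: "u(a := b0) \<in> V S" "v(a := b1) \<in> V S"
      using upd_V[OF aS] uv br R_def by auto
    have "blt R v u"
      using uv(3,4) blt_total[OF finR, of v y] blt_trans blt_cong[of R v y u u] by blast
    then obtain k where k: "k \<in> R" "st k (v k) < st k (u k)" "\<And>i. i \<in> R \<Longrightarrow> i < k \<Longrightarrow> st i (v i) = st i (u i)"
      unfolding blt_def by blast
    have "blt S (v(a := b1)) (u(a := b0))"
      unfolding blt_def
    proof (intro bexI[of _ k] conjI ballI impI)
      show "st k ((v(a := b1)) k) < st k ((u(a := b0)) k)" "k \<in> S" using k R_def by auto
      show "st i ((v(a := b1)) i) = st i ((u(a := b0)) i)" if "i \<in> S" "i < k" for i
        using k(3)[of i] that st_eq R_def by (cases "i = a") auto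
    qed
    then show "lt S (v(a := b1)) (u(a := b0))" by (rule blt_lt[OF S(1) uvS(2,1)])
    assume uT: "u(a := b0) \<in> T" "v(a := b1) \<notin> T"
    show "\<exists>i\<in>S - {a}. u i < v i"
    proof (rule ccontr)
      assume no: "\<not> (\<exists>i\<in>S - {a}. u i < v i)"
      then have le: "v i \<le> u i" if "i \<in> R" for i using that R_def by (auto simp: not_less)
      \<comment> \<open>As \<open>S\<close> has at least three elements, \<open>R\<close> has a
        coordinate besides the deciding one \<open>k\<close>.\<close>
      have "\<not> R \<subseteq> {k}"
      proof
        assume "R \<subseteq> {k}"
        then have "card R \<le> card {k}" by (intro card_mono) auto
        then show False using cR by simp
      qed
      then obtain z where z: "z \<in> R" "z \<noteq> k" by auto
      have zS: "z \<in> S" "z \<noteq> a" using z R_def by auto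
      define v' where "v' = (v(a := b1))(z := u z)"
      have v'V: "v' \<in> V S" unfolding v'_def using V_D[OF uv(1) z(1)] by (intro upd_V' uvS zS) auto
      have le': "(v(a := b1)) i \<le> v' i" if "i \<in> S" for i
        using le[OF z(1)] zS unfolding v'_def by (cases "i = z") auto
      have "v' \<notin> T" using downD[OF T _ uvS(2)] le' uT(2) by blast
      \<comment> \<open>Raising coordinate \<open>z\<close> may change the block of
        \<open>v\<close>, so the comparison is obtained anew from coordinatewise inequalities that
        are strict at \<open>k\<close>.\<close>
      moreover have "blt S v' (u(a := b0))"
      proof (rule le_blt[OF fin, of _ _ k])
        show "st i (v' i) \<le> st i ((u(a := b0)) i)" if "i \<in> S" for i
        proof (cases "i = a \<or> i = z")
          case True
          then show ?thesis using st_eq zS unfolding v'_def by auto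
        next
          case False
          then have "i \<in> R" using that R_def by auto
          then have "st i (v i) \<le> st i (u i)"
            using le V_D[OF uv(1)] V_D[OF uv(2)] R by (intro st_mono) auto
          then show ?thesis using False unfolding v'_def by simp
        qed
        show "k \<in> S" using k R_def by auto
        show "st k (v' k) < st k ((u(a := b0)) k)" using k z R_def unfolding v'_def by auto
      qed
      then have "lt S v' (u(a := b0))" by (rule blt_lt[OF S(1) v'V uvS(1)])
      moreover have "v' z = (u(a := b0)) z" using zS unfolding v'_def by simp
      ultimately show False using sc[OF zS(1)] uT(1) v'V unfolding section_closed_def by blast
    qed
  qed
qed

text \<open>Cut at the block of the last element \<open>c\<close> of \<open>T\<close>: earlier
  blocks lie inside \<open>T\<close> and later ones outside. So \<open>T\<close> and the initial
  segment of its size differ only within that block, where \<open>block_opt\<close> compares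
  them.\<close>

lemma block_closed_le:
  assumes S: "S \<subseteq> I" "S \<noteq> {}" and T: "down S T"
    and bc: "\<And>x y. x \<in> T \<Longrightarrow> y \<in> V S \<Longrightarrow> y \<notin> T \<Longrightarrow> \<not> blt S y x"
  shows "W S T \<le> W S (init S (card T))"
proof (cases "T = {}")
  case True
  then show ?thesis by (simp add: init_def)
next
  case False
  have TV: "T \<subseteq> V S" using T down_V by blast
  have finT: "finite T" using TV S finite_subset finite_V by blast
  have fin: "finite S" using S finite_I finite_subset by blast
  have "pos S ` T \<noteq> {}" "finite (pos S ` T)" using False finT by auto
  then have "Max (pos S ` T) \<in> pos S ` T" by (rule Max_in[rotated])
  then obtain c where c: "c \<in> T" "pos S c = Max (pos S ` T)" by auto
  have cmax: "pos S x \<le> pos S c" if "x \<in> T" for x unfolding c(2) using finT that by auto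
  have cV: "c \<in> V S" using c TV by auto
  define L where "L = {v \<in> V S. blt S v c}"
  define B where "B = {v \<in> V S. \<forall>i\<in>S. st i (v i) = st i (c i)}"
  define Y where "Y = init S (card T) \<inter> B"
  have disj: "L \<inter> B = {}" unfolding L_def B_def blt_def by auto
  have LT: "L \<subseteq> T" using bc[OF c(1)] unfolding L_def by blast
  have TLB: "T \<subseteq> L \<union> B"
  proof
    fix v assume v: "v \<in> T"
    then have vV: "v \<in> V S" using TV by auto
    have "\<not> blt S c v"
      using blt_lt[OF S(1) cV vV] pos_less_iff[OF S cV vV] cmax[OF v] by auto
    then show "v \<in> L \<union> B" using blt_total[OF fin, of v c] vV unfolding L_def B_def by auto
  qed
  have L: "L = init S (card L)"
  proof (rule init_block[OF S])
    fix u v assume "v \<in> L" "u \<in> V S" "u \<notin> L"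
    then show "blt S v u"
      using blt_total[OF fin, of u c] blt_trans blt_cong[of S v v u c] unfolding L_def by blast
  qed (auto simp: L_def)
  have LB: "L \<union> B = init S (card (L \<union> B))"
  proof (rule init_block[OF S])
    fix u v assume uv: "v \<in> L \<union> B" "u \<in> V S" "u \<notin> L \<union> B"
    then have "blt S c u" using blt_total[OF fin, of u c] unfolding L_def B_def by auto
    then show "blt S v u"
      using uv(1) blt_trans blt_cong[of S v c u u] unfolding L_def B_def by blast
  qed (auto simp: L_def B_def)
  have finV: "finite (V S)" using finite_V S by auto
  have fLB: "finite L" "finite B" "finite (L \<union> B)" using finV unfolding L_def B_def by auto
  have cLT: "card L \<le> card T" using LT finT by (simp add: card_mono)
  have cTLB: "card T \<le> card (L \<union> B)" using TLB fLB by (simp add: card_mono)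
  have 1: "L \<subseteq> init S (card T)" using init_mono[OF cLT, of S] L by simp
  have 2: "init S (card T) \<subseteq> L \<union> B" using init_mono[OF cTLB, of S] LB by simp
  have T_eq: "T = L \<union> (T \<inter> B)" using LT TLB by auto
  have init_eq: "init S (card T) = L \<union> Y" unfolding Y_def using 1 2 by auto
  have "card T \<le> card (V S)" using TV finV by (simp add: card_mono)
  then have "card (init S (card T)) = card T" by (rule card_init[OF S])
  then have "card (L \<union> Y) = card (L \<union> (T \<inter> B))" using T_eq init_eq by simp
  moreover have "card (L \<union> Y) = card L + card Y"
    using disj fLB unfolding Y_def by (intro card_Un_disjoint) auto
  moreover have "card (L \<union> (T \<inter> B)) = card L + card (T \<inter> B)"
    using disj fLB by (intro card_Un_disjoint) auto
  ultimately have cY: "card (T \<inter> B) = card Y" by simp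
  have "(\<Sum>x\<in>T \<inter> B. \<Sum>i\<in>S. dl i (x i)) \<le> (\<Sum>x\<in>Y. \<Sum>i\<in>S. dl i (x i))"
  proof (rule block_opt[OF S, of c])
    show "c \<in> (\<Pi>\<^sub>E i\<in>S. {1..n i})" using cV V_def by simp
    show "T \<inter> B \<subseteq> {x \<in> \<Pi>\<^sub>E i\<in>S. {1..n i}. \<forall>i\<in>S. st i (x i) = st i (c i)}"
      "Y \<subseteq> {x \<in> \<Pi>\<^sub>E i\<in>S. {1..n i}. \<forall>i\<in>S. st i (x i) = st i (c i)}"
      unfolding Y_def B_def V_def by auto
    show "card (T \<inter> B) = card Y" by (rule cY)
  next
    fix x y assume xy: "x \<in> T \<inter> B" "y \<in> (\<Pi>\<^sub>E i\<in>S. {1..n i})" "\<forall>i\<in>S. st i (y i) = st i (c i)"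
      "\<forall>i\<in>S. y i \<le> x i"
    then have "y \<in> V S" unfolding V_def by simp
    then show "y \<in> T \<inter> B" using xy downD[OF T, of x y] unfolding B_def by blast
  next
    fix x y assume xy: "x \<in> Y" "y \<in> (\<Pi>\<^sub>E i\<in>S. {1..n i})" "\<forall>i\<in>S. st i (y i) = st i (c i)" "lt S y x"
    then have "y \<in> V S" unfolding V_def by simp
    then show "y \<in> Y" using xy init_closed[OF S, of x "card T" y] unfolding Y_def B_def by blast
  qed
  then have "W S (T \<inter> B) \<le> W S Y" unfolding W_def .
  moreover have "W S (L \<union> (T \<inter> B)) = W S L + W S (T \<inter> B)"
    unfolding W_def using disj fLB by (intro sum.union_disjoint) auto
  moreover have "W S (L \<union> Y) = W S L + W S Y"
    unfolding W_def using disj fLB unfolding Y_def by (intro sum.union_disjoint) auto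
  ultimately show ?thesis unfolding init_eq using T_eq by simp
qed

text \<open>When no better set exists, all sections are closed and neither kind of gap between
  blocks occurs, which leaves the situation of \<open>block_closed_le\<close>.\<close>

lemma opt_step:
  assumes S: "S \<subseteq> I" "3 \<le> card S" and o: "\<And>j. j \<in> S \<Longrightarrow> opt (S - {j})"
  shows "opt S"
  unfolding opt_def
proof (intro allI impI)
  have fin: "finite S" using S finite_I finite_subset by blast
  have S0: "S \<noteq> {}" using S by auto
  have Sj: "S - {j} \<noteq> {}" if "j \<in> S" for j
  proof
    assume "S - {j} = {}"
    then have "S = {j}" using that by auto
    then show False using S by simp
  qed
  have az: "Min S \<in> S" "Max S \<in> S" using fin S0 by auto
  \<comment> \<open>At least three coordinates provide an interior one for
    \<open>step_slices\<close>.\<close>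
  have "card {Min S, Max S} \<le> 2" by (simp add: card_insert_if)
  then have "\<not> S \<subseteq> {Min S, Max S}" using S(2) card_mono[of "{Min S, Max S}" S] by force
  then obtain j where j: "j \<in> S" "j \<noteq> Min S" "j \<noteq> Max S" by auto
  fix T assume "down S T"
  then show "W S T \<le> W S (init S (card T))"
  proof (induction "sum (pos S) T" arbitrary: T rule: less_induct)
    case less
    show ?case
    proof (cases "\<exists>T'. better S T T'")
      case True
      then obtain T' where "better S T T'" ..
      then show ?thesis using less.hyps[of T'] unfolding better_def by simp
    next
      case False
      have sc: "section_closed S i T" if "i \<in> S" for i
        using compress_better[OF S(1) that Sj[OF that] less.prems o[OF that]] False by blast
      have "\<not> blt S y x" if xy: "x \<in> T" "y \<in> V S" "y \<notin> T" for x y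
      proof
        assume bl: "blt S y x"
        have "\<not> st (Min S) (y (Min S)) < st (Min S) (x (Min S))"
          using step_slices[OF S(1) refl refl j less.prems o[OF j(1)] sc[OF az(1)] sc[OF az(2)] sc[OF j(1)] xy]
            False by blast
        moreover have "st (Min S) (y (Min S)) \<le> st (Min S) (x (Min S))"
        proof (rule ccontr)
          assume c: "\<not> st (Min S) (y (Min S)) \<le> st (Min S) (x (Min S))"
          have "blt S x y"
            unfolding blt_def
          proof (intro bexI[of _ "Min S"] conjI ballI impI)
            show "st i (x i) = st i (y i)" if "i \<in> S" "i < Min S" for i
              using Min_le[OF fin that(1)] that(2) by simp
          qed (use c az in auto)
          then have "blt S x x" using bl blt_trans by blast
          then show False unfolding blt_def by simp
        qed
        ultimately have "st (Min S) (y (Min S)) = st (Min S) (x (Min S))" by simp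
        then show False
          using step_blocks[OF S refl less.prems o[OF az(1)] sc xy _ bl] False by blast
      qed
      then show ?thesis by (rule block_closed_le[OF S(1) S0 less.prems])
    qed
  qed
qed

lemma opt_all: "S \<subseteq> I \<Longrightarrow> 2 \<le> card S \<Longrightarrow> opt S"
proof (induction "card S" arbitrary: S rule: less_induct)
  case less
  have fin: "finite S" using less.prems finite_I finite_subset by blast
  show ?case
  proof (cases "card S = 2")
    case False
    have "opt (S - {j})" if "j \<in> S" for j
      using less.prems False fin that by (intro less.hyps) auto
    then show ?thesis using opt_step[of S] less.prems False by auto
  next
    case True
    then obtain i j where ij: "S = {i, j}" "i < j"
      by (metis card_2_iff insert_commute linorder_neqE_nat)
    have S0: "S \<noteq> {}" using ij by auto
    show ?thesis
      unfolding opt_def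
    proof (intro allI impI)
      fix X assume X: "down S X"
      have XV: "X \<subseteq> V S" using X down_V by blast
      have "card X \<le> card (V S)" using XV less.prems by (intro card_mono finite_V) auto
      then have c: "card X = card (init S (card X))" using card_init[OF less.prems(1) S0] by simp
      show "W S X \<le> W S (init S (card X))"
        unfolding W_def ij(1)
      proof (rule pair_opt)
        show "i \<in> I" "j \<in> I" "i < j" using ij less.prems by auto
        show "X \<subseteq> (\<Pi>\<^sub>E i\<in>{i, j}. {1..n i})" "init {i, j} (card X) \<subseteq> (\<Pi>\<^sub>E i\<in>{i, j}. {1..n i})"
          using XV init_subset[of S] unfolding V_def ij(1) by auto
        show "card X = card (init {i, j} (card X))" using c ij by simp
      next
        fix x y assume "x \<in> X" "y \<in> (\<Pi>\<^sub>E i\<in>{i, j}. {1..n i})" "y i \<le> x i" "y j \<le> x j"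
        then show "y \<in> X" using downD[OF X, of x y] unfolding V_def ij(1) by blast
      next
        fix x y assume "x \<in> init {i, j} (card X)" "y \<in> (\<Pi>\<^sub>E i\<in>{i, j}. {1..n i})" "lt {i, j} y x"
        then show "y \<in> init {i, j} (card X)"
          using init_closed[OF less.prems(1) S0, of x "card X" y] unfolding V_def ij(1) by blast
      qed
    qed
  qed
qed

end


section \<open>Block-lexicographic orders on products\<close>

locale domination_setup =
  fixes d :: nat and G :: "nat \<Rightarrow> 'a sgraph" and r :: "nat \<Rightarrow> 'a \<Rightarrow> nat"
    and P :: "nat \<Rightarrow> 'a set list" and p :: "'a perm_assignment"
  assumes d3: "d \<ge> 3"
    and simple: "\<And>i. i \<in> {1..d} \<Longrightarrow> simple_graph (G i)"
    and optimal: "\<And>i. i \<in> {1..d} \<Longrightarrow> optimal_order (G i) (r i)"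
    and partition: "\<And>i. i \<in> {1..d} \<Longrightarrow> isoperimetric_partition (G i) (r i) (P i)"
    and collection: "regular_domination_collection d G r P p"
    and nondecreasing: "\<And>i. i \<in> {1..d - 1} \<Longrightarrow> nondecreasing_partition (G i) (P i)"
    and pairs: "\<And>i j. 1 \<le> i \<Longrightarrow> i < j \<Longrightarrow> j \<le> d \<Longrightarrow>
           optimal_order (cart_prod G {i, j}) (block_lex_order G r P p {i, j})"
begin

abbreviation "stv i \<equiv> ordered_partition.start (r i) (P i)"
abbreviation "VG S \<equiv> (\<Pi>\<^sub>E i\<in>S. verts (G i))"
abbreviation "blx \<equiv> block_lex_less r P p"

lemma factor: "i \<in> {1..d} \<Longrightarrow> ordered_partition (G i) (r i) (P i)"
  using simple optimal partition by (simp add: ordered_partition_def)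

lemma factor_in: "S \<subseteq> {1..d} \<Longrightarrow> i \<in> S \<Longrightarrow> ordered_partition (G i) (r i) (P i)"
  using factor by blast

lemma finite_index: "S \<subseteq> {1..d} \<Longrightarrow> finite S"
  using finite_subset by blast

lemma block_of_eq: "block_of P S x = (\<lambda>i\<in>S. part_of (P i) (x i))"
  unfolding block_of_def part_of_def ..

lemma same_block:
  assumes "S \<subseteq> {1..d}" "x \<in> VG S" "y \<in> VG S"
  shows "block_of P S x = block_of P S y \<longleftrightarrow> (\<forall>i\<in>S. stv i (x i) = stv i (y i))"
proof -
  have "stv i (x i) = stv i (y i) \<longleftrightarrow> part_of (P i) (x i) = part_of (P i) (y i)" if "i \<in> S" for i
    using ordered_partition.start_eq_iff[OF factor_in[OF assms(1) that]] assms(2,3) that by (simp add: PiE_iff)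
  then have "(\<forall>i\<in>S. stv i (x i) = stv i (y i)) \<longleftrightarrow> (\<forall>i\<in>S. part_of (P i) (x i) = part_of (P i) (y i))" by simp
  also have "\<dots> \<longleftrightarrow> block_of P S x = block_of P S y"
    unfolding block_of_eq by (metis (mono_tags, lifting) restrict_apply' restrict_ext)
  finally show ?thesis ..
qed

lemma block_start_rank:
  assumes "S \<subseteq> {1..d}" "i \<in> S"
  shows "r i (block_start r S (block_of P S x) i) = stv i (x i)"
  using ordered_partition.start_def[OF factor_in[OF assms]] assms(2)
  unfolding block_start_def block_of_eq by simp

text \<open>Replaces starts of blocks by the numbers \<open>stv i\<close>, so different blocks are
  compared at the least coordinate where these differ.\<close>

lemma blx_iff:
  assumes S: "S \<subseteq> {1..d}" and x: "x \<in> VG S" and y: "y \<in> VG S"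
  shows "blx S x y \<longleftrightarrow> (if \<forall>i\<in>S. stv i (x i) = stv i (y i) then block_less r p S (block_of P S x) x y
     else \<exists>k\<in>S. stv k (x k) < stv k (y k) \<and> (\<forall>i\<in>S. i < k \<longrightarrow> stv i (x i) = stv i (y i)))"
proof -
  define F where "F z k = r k (block_start r S (block_of P S z) k)" for z k
  have F: "F z k = stv k (z k)" if "k \<in> S" for z k unfolding F_def by (rule block_start_rank[OF S that])
  have "rank_tuple r S (block_start r S (block_of P S z)) = (\<lambda>j. F z (index_elem S j))" for z
    unfolding rank_tuple_def F_def ..
  then have "lex_less (card S) (rank_tuple r S (block_start r S (block_of P S x)))
      (rank_tuple r S (block_start r S (block_of P S y)))
      \<longleftrightarrow> (\<exists>k\<in>S. F x k < F y k \<and> (\<forall>i\<in>S. i < k \<longrightarrow> F x i = F y i))"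
    using lex_less_index[OF finite_index[OF S], of "F x" "F y"] by simp
  also have "\<dots> \<longleftrightarrow> (\<exists>k\<in>S. stv k (x k) < stv k (y k) \<and> (\<forall>i\<in>S. i < k \<longrightarrow> stv i (x i) = stv i (y i)))"
    using F by (intro bex_cong refl) simp
  finally show ?thesis
    unfolding block_lex_less_def using same_block[OF S x y] by simp
qed

lemma block_of_blocks:
  assumes "S \<subseteq> {1..d}" "x \<in> VG S"
  shows "block_of P S x \<in> blocks P S" "x \<in> PiE S (block_of P S x)"
proof -
  have "part_of (P i) (x i) \<in> set (P i) \<and> x i \<in> part_of (P i) (x i)" if "i \<in> S" for i
    using ordered_partition.part_of[OF factor_in[OF assms(1) that]] assms(2) that by (simp add: PiE_iff)
  then show "block_of P S x \<in> blocks P S" "x \<in> PiE S (block_of P S x)"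
    using assms(2) unfolding block_of_eq blocks_def by (auto simp: PiE_iff)
qed

lemma PiE_block_of:
  assumes S: "S \<subseteq> {1..d}" and x: "x \<in> VG S"
  shows "y \<in> PiE S (block_of P S x) \<longleftrightarrow> y \<in> VG S \<and> (\<forall>i\<in>S. stv i (y i) = stv i (x i))"
proof -
  have *: "y i \<in> part_of (P i) (x i) \<longleftrightarrow> y i \<in> verts (G i) \<and> stv i (y i) = stv i (x i)" if i: "i \<in> S" for i
  proof -
    interpret ordered_partition "G i" "r i" "P i" by (rule factor_in[OF S i])
    have xi: "x i \<in> verts (G i)" using x i by (simp add: PiE_iff)
    show ?thesis
    proof
      assume y: "y i \<in> part_of (P i) (x i)"
      then have yU: "y i \<in> verts (G i)" using part_subset[OF part_of(1)[OF xi]] by blast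
      then show "y i \<in> verts (G i) \<and> start (y i) = start (x i)"
        using part_of_eq[OF part_of(1)[OF xi] y] start_eq_iff[OF yU xi] by simp
    next
      assume y: "y i \<in> verts (G i) \<and> start (y i) = start (x i)"
      then have "part_of (P i) (y i) = part_of (P i) (x i)" using start_eq_iff[of "y i" "x i"] xi by simp
      then show "y i \<in> part_of (P i) (x i)" using part_of(2)[of "y i"] y by simp
    qed
  qed
  have "y \<in> PiE S (block_of P S x) \<longleftrightarrow> y \<in> extensional S \<and> (\<forall>i\<in>S. y i \<in> part_of (P i) (x i))"
    unfolding PiE_iff block_of_eq by auto
  also have "\<dots> \<longleftrightarrow> y \<in> extensional S \<and> (\<forall>i\<in>S. y i \<in> verts (G i) \<and> stv i (y i) = stv i (x i))"
    using * by simp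
  also have "\<dots> \<longleftrightarrow> y \<in> VG S \<and> (\<forall>i\<in>S. stv i (y i) = stv i (x i))"
    unfolding PiE_iff by blast
  finally show ?thesis .
qed

lemma collection_block:
  assumes "S \<noteq> {}" "S \<subseteq> {1..d}" "Z \<in> blocks P S"
  shows "p S Z permutes {1..card S}"
    "optimal_order (induced_subgraph (cart_prod G S) (PiE S Z)) (rank_in (block_less r p S Z) (PiE S Z))"
  using collection assms unfolding regular_domination_collection_def domination_collection_def by blast+

lemma collection_consistent:
  assumes "S1 \<noteq> {}" "S1 \<subset> S2" "S2 \<subseteq> {1..d}" "Z \<in> blocks P S2"
  shows "consistent_orders S2 (PiE S2 Z) (block_less r p S2 Z) S1 (block_less r p S1 (restrict Z S1))"
  using collection assms unfolding regular_domination_collection_def domination_collection_def by blast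

lemma block_less_irrefl: "\<not> block_less r p S Z x x"
  unfolding block_less_def domination_less_def by (rule lex_less_irrefl)

lemma block_less_trans: "block_less r p S Z x y \<Longrightarrow> block_less r p S Z y z \<Longrightarrow> block_less r p S Z x z"
  unfolding block_less_def domination_less_def by (rule lex_less_trans)

lemma restrict_order_block:
  assumes S: "S \<subseteq> {1..d}" and c: "c \<in> VG S" and i: "i \<in> S" and x: "x \<in> PiE S (block_of P S c)"
  shows "restrict_order (r i) (block_of P S c i) (x i) + stv i (c i) = r i (x i) + 1"
proof -
  interpret ordered_partition "G i" "r i" "P i" by (rule factor_in[OF S i])
  have "c i \<in> verts (G i)" using c i by (simp add: PiE_iff)
  moreover have "x i \<in> part_of (P i) (c i)" using x i unfolding block_of_eq by (simp add: PiE_iff)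
  ultimately show ?thesis using restrict_order_eq[of "c i" "x i"] i unfolding block_of_eq by simp
qed

text \<open>Inside a block, ranks within the parts are the ranks \<open>r\<close> shifted by a
  constant for each coordinate, so inequalities carry over to the permuted tuples \<open>F\<close>.
  The permutation reaches every coordinate, so a difference of \<open>x\<close> and \<open>y\<close>
  is visible in \<open>F\<close>.\<close>

lemma block_less_index:
  assumes S: "S \<subseteq> {1..d}" "S \<noteq> {}" and c: "c \<in> VG S"
    and x: "x \<in> PiE S (block_of P S c)" and y: "y \<in> PiE S (block_of P S c)" and ne: "x \<noteq> y"
  shows block_less_total: "block_less r p S (block_of P S c) x y \<or> block_less r p S (block_of P S c) y x"
    and block_less_mono: "(\<And>i. i \<in> S \<Longrightarrow> r i (x i) \<le> r i (y i)) \<Longrightarrow> block_less r p S (block_of P S c) x y"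
proof -
  define Z where "Z = block_of P S c"
  define q where "q = p S Z"
  define F where "F z j = rank_tuple (\<lambda>i. restrict_order (r i) (Z i)) S z (q j)" for z j
  have q: "q permutes {1..card S}"
    unfolding q_def Z_def by (rule collection_block(1)[OF S(2,1) block_of_blocks(1)[OF S(1) c]])
  have idx: "index_elem S ` {1..card S} = S" using index_elem_bij[OF finite_index[OF S(1)]] by (simp add: bij_betw_def)
  have q_img: "q ` {1..card S} = {1..card S}" using q by (rule permutes_image)
  have F_eq: "F z j + stv (index_elem S (q j)) (c (index_elem S (q j)))
      = r (index_elem S (q j)) (z (index_elem S (q j))) + 1 \<and> index_elem S (q j) \<in> S"
    if "j \<in> {1..card S}" "z \<in> PiE S Z" for j z
  proof -
    have "q j \<in> {1..card S}" using that(1) unfolding permutes_in_image[OF q] .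
    then have "index_elem S (q j) \<in> S" using idx by blast
    then show ?thesis
      using restrict_order_block[OF S(1) c _ that(2)[unfolded Z_def]] unfolding F_def rank_tuple_def Z_def by simp
  qed
  have bl: "block_less r p S Z u v \<longleftrightarrow> lex_less (card S) (F u) (F v)" for u v
    unfolding block_less_def domination_less_def F_def q_def ..
  have xZ: "x \<in> PiE S Z" "y \<in> PiE S Z" using x y unfolding Z_def by auto
  obtain i where i: "i \<in> S" "x i \<noteq> y i" using ne PiE_ext[OF x y] by blast
  obtain m where m: "m \<in> {1..card S}" "i = index_elem S m" using idx i(1) by blast
  obtain j where j: "j \<in> {1..card S}" "m = q j" using q_img m(1) by blast
  have "x i \<in> verts (G i)" "y i \<in> verts (G i)"
    using x y i(1) unfolding PiE_block_of[OF S(1) c] by (auto simp: PiE_iff)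
  then have "r i (x i) \<noteq> r i (y i)"
    using ordered_partition.rank_eq[OF factor_in[OF S(1) i(1)]] i(2) by blast
  then have Fne: "F x j \<noteq> F y j" using F_eq[OF j(1) xZ(1)] F_eq[OF j(1) xZ(2)] m j by auto
  show "block_less r p S (block_of P S c) x y \<or> block_less r p S (block_of P S c) y x"
    unfolding Z_def[symmetric] bl using lex_less_total[of j "card S" "F x" "F y", OF j(1) Fne] .
  assume le: "\<And>i. i \<in> S \<Longrightarrow> r i (x i) \<le> r i (y i)"
  have "F x l \<le> F y l" if "l \<in> {1..card S}" for l
    using F_eq[OF that xZ(1)] F_eq[OF that xZ(2)] le[of "index_elem S (q l)"] by linarith
  then show "block_less r p S (block_of P S c) x y"
    unfolding Z_def[symmetric] bl using lex_less_mono[of "card S" "F x" "F y" j] j(1) Fne by blast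
qed

lemma blx_irrefl:
  assumes "S \<subseteq> {1..d}" "x \<in> VG S"
  shows "\<not> blx S x x"
  using block_less_irrefl unfolding blx_iff[OF assms(1,2,2)] by simp

lemma key_less_total:
  fixes S :: "nat set" and F F' :: "nat \<Rightarrow> nat"
  assumes "finite S" "\<not> (\<forall>i\<in>S. F i = F' i)"
  shows "(\<exists>k\<in>S. F k < F' k \<and> (\<forall>i\<in>S. i < k \<longrightarrow> F i = F' i)) \<or> (\<exists>k\<in>S. F' k < F k \<and> (\<forall>i\<in>S. i < k \<longrightarrow> F' i = F i))"
proof -
  have idx: "index_elem S ` {1..card S} = S" using index_elem_bij[OF assms(1)] by (simp add: bij_betw_def)
  obtain i where i: "i \<in> S" "F i \<noteq> F' i" using assms(2) by blast
  then obtain j where j: "j \<in> {1..card S}" "i = index_elem S j" using idx by blast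
  have "lex_less (card S) (\<lambda>j. F (index_elem S j)) (\<lambda>j. F' (index_elem S j))
      \<or> lex_less (card S) (\<lambda>j. F' (index_elem S j)) (\<lambda>j. F (index_elem S j))"
    by (rule lex_less_total[OF j(1)]) (use i j in simp)
  then show ?thesis unfolding lex_less_index[OF assms(1)] .
qed

lemma blx_total:
  assumes S: "S \<subseteq> {1..d}" "S \<noteq> {}" and x: "x \<in> VG S" and y: "y \<in> VG S" and ne: "x \<noteq> y"
  shows "blx S x y \<or> blx S y x"
proof (cases "\<forall>i\<in>S. stv i (x i) = stv i (y i)")
  case True
  then have eq: "block_of P S y = block_of P S x" using same_block[OF S(1) x y] by simp
  have "y \<in> PiE S (block_of P S x)" "x \<in> PiE S (block_of P S x)"
    using block_of_blocks(2)[OF S(1)] x y eq by metis+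
  then have "block_less r p S (block_of P S x) x y \<or> block_less r p S (block_of P S x) y x"
    using block_less_total[OF S x _ _ ne] by blast
  then show ?thesis unfolding blx_iff[OF S(1) x y] blx_iff[OF S(1) y x] eq using True by simp
next
  case False
  then have F2: "\<not> (\<forall>i\<in>S. stv i (y i) = stv i (x i))" by metis
  show ?thesis
    unfolding blx_iff[OF S(1) x y] blx_iff[OF S(1) y x] if_not_P[OF False] if_not_P[OF F2]
    using key_less_total[OF finite_index[OF S(1)] False] .
qed

text \<open>Inside a block the domination order is transitive, between blocks the lexicographic
  order of the start tuples \<open>K\<close>. In the mixed cases a tuple is replaced by another from
  its block, which does not change \<open>K\<close>.\<close>

lemma blx_trans:
  assumes S: "S \<subseteq> {1..d}" and x: "x \<in> VG S" and y: "y \<in> VG S" and z: "z \<in> VG S"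
    and xy: "blx S x y" and yz: "blx S y z"
  shows "blx S x z"
proof -
  define K where "K u = (\<lambda>j. stv (index_elem S j) (u (index_elem S j)))" for u
  have lex: "(\<exists>k\<in>S. stv k (u k) < stv k (v k) \<and> (\<forall>i\<in>S. i < k \<longrightarrow> stv i (u i) = stv i (v i)))
      \<longleftrightarrow> lex_less (card S) (K u) (K v)" for u v
    unfolding K_def using lex_less_index[OF finite_index[OF S], of "\<lambda>k. stv k (u k)" "\<lambda>k. stv k (v k)"] by simp
  define E where "E u v \<longleftrightarrow> (\<forall>i\<in>S. stv i (u i) = stv i (v i))" for u v
  have idx: "index_elem S ` {1..card S} = S" using index_elem_bij[OF finite_index[OF S]] by (simp add: bij_betw_def)
  have KE: "K u j = K v j" if "E u v" "j \<in> {1..card S}" for u v j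
  proof -
    have "index_elem S j \<in> S" using that(2) idx by blast
    then show ?thesis using that(1) unfolding K_def E_def by simp
  qed
  have iff: "blx S u v \<longleftrightarrow> (if E u v then block_less r p S (block_of P S u) u v else lex_less (card S) (K u) (K v))"
    if "u \<in> VG S" "v \<in> VG S" for u v
    unfolding blx_iff[OF S that] E_def lex ..
  have E_ne: "\<not> E u v" if "lex_less (card S) (K u) (K v)" for u v
  proof
    assume "E u v"
    from KE[OF this] have "lex_less (card S) (K u) (K v) \<longleftrightarrow> lex_less (card S) (K v) (K v)"
      by (intro lex_less_cong) simp_all
    then show False using that lex_less_irrefl by blast
  qed
  show ?thesis
  proof (cases "E x y")
    case xyE: True
    then have bxy: "block_of P S x = block_of P S y" using same_block[OF S x y] unfolding E_def by simp
    show ?thesis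
    proof (cases "E y z")
      case True
      then have "E x z" using xyE unfolding E_def by simp
      then show ?thesis
        using xy yz xyE True block_less_trans bxy unfolding iff[OF x y] iff[OF y z] iff[OF x z] by metis
    next
      case False
      then have "lex_less (card S) (K y) (K z)" using yz unfolding iff[OF y z] by simp
      then have "lex_less (card S) (K x) (K z)"
        using lex_less_cong[of "card S" "K x" "K y" "K z" "K z"] KE[OF xyE] by simp
      then show ?thesis using E_ne unfolding iff[OF x z] by simp
    qed
  next
    case False
    then have 1: "lex_less (card S) (K x) (K y)" using xy unfolding iff[OF x y] by simp
    have "lex_less (card S) (K x) (K z)"
    proof (cases "E y z")
      case True
      then show ?thesis
        using 1 lex_less_cong[of "card S" "K x" "K x" "K y" "K z"] KE[OF True] by simp
    next
      case False
      then have "lex_less (card S) (K y) (K z)" using yz unfolding iff[OF y z] by simp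
      then show ?thesis using 1 lex_less_trans by blast
    qed
    then show ?thesis using E_ne unfolding iff[OF x z] by simp
  qed
qed

lemma blx_mono:
  assumes S: "S \<subseteq> {1..d}" "S \<noteq> {}" and x: "x \<in> VG S" and y: "y \<in> VG S" and ne: "x \<noteq> y"
    and le: "\<And>i. i \<in> S \<Longrightarrow> r i (x i) \<le> r i (y i)"
  shows "blx S x y"
proof (cases "\<forall>i\<in>S. stv i (x i) = stv i (y i)")
  case True
  then have eq: "block_of P S y = block_of P S x" using same_block[OF S(1) x y] by simp
  have "y \<in> PiE S (block_of P S x)" "x \<in> PiE S (block_of P S x)"
    using block_of_blocks(2)[OF S(1)] x y eq by metis+
  then have "block_less r p S (block_of P S x) x y" using block_less_mono[OF S x _ _ ne le] by blast
  then show ?thesis unfolding blx_iff[OF S(1) x y] using True by simp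
next
  case False
  have "stv i (x i) \<le> stv i (y i)" if "i \<in> S" for i
    using ordered_partition.start_mono[OF factor_in[OF S(1) that]] x y le[OF that] that by (simp add: PiE_iff)
  then have "\<not> (\<exists>k\<in>S. stv k (y k) < stv k (x k) \<and> (\<forall>i\<in>S. i < k \<longrightarrow> stv i (y i) = stv i (x i)))"
    by (meson not_le)
  then show ?thesis
    unfolding blx_iff[OF S(1) x y] if_not_P[OF False] using key_less_total[OF finite_index[OF S(1)] False] by blast
qed

text \<open>In one block this is the consistency of the domination orders. For different blocks the
  deciding coordinate belongs to \<open>R\<close>, because \<open>x\<close> and \<open>y\<close>
  agree outside.\<close>

lemma blx_restrict:
  assumes R: "R \<noteq> {}" "R \<subset> S" and S: "S \<subseteq> {1..d}" and x: "x \<in> VG S" and y: "y \<in> VG S"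
    and eq: "\<And>j. j \<in> S - R \<Longrightarrow> x j = y j" and xy: "blx S x y"
  shows "blx R (restrict x R) (restrict y R)"
proof -
  have RI: "R \<subseteq> {1..d}" using R S by blast
  have RS: "i \<in> S" if "i \<in> R" for i using that R by blast
  have V: "restrict x R \<in> VG R" "restrict y R \<in> VG R" using x y RS by (auto simp: PiE_iff)
  have st: "stv i (restrict x R i) = stv i (x i)" "stv i (restrict y R i) = stv i (y i)" if "i \<in> R" for i
    using that by simp_all
  show ?thesis
  proof (cases "\<forall>i\<in>S. stv i (x i) = stv i (y i)")
    case True
    define Z where "Z = block_of P S x"
    have "block_less r p S Z x y" using xy True unfolding blx_iff[OF S x y] Z_def by simp
    moreover have "x \<in> PiE S Z" "y \<in> PiE S Z"
      using x y True unfolding Z_def PiE_block_of[OF S x] by simp_all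
    ultimately have "block_less r p R (restrict Z R) (restrict x R) (restrict y R)"
      using collection_consistent[OF R S block_of_blocks(1)[OF S x]] eq
      unfolding consistent_orders_def Z_def[symmetric] by blast
    moreover have "restrict Z R = block_of P R (restrict x R)"
      unfolding Z_def block_of_eq using RS by (intro ext) (auto simp: restrict_def)
    moreover have "\<forall>i\<in>R. stv i (restrict x R i) = stv i (restrict y R i)" using True RS by simp
    ultimately show ?thesis unfolding blx_iff[OF RI V] by simp
  next
    case False
    then obtain k where k: "k \<in> S" "stv k (x k) < stv k (y k)" "\<forall>i\<in>S. i < k \<longrightarrow> stv i (x i) = stv i (y i)"
      using xy unfolding blx_iff[OF S x y] if_not_P[OF False] by blast
    have kR: "k \<in> R"
    proof (rule ccontr)
      assume "k \<notin> R"
      then have "x k = y k" using eq k(1) by blast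
      then show False using k(2) by simp
    qed
    have 1: "\<not> (\<forall>i\<in>R. stv i (restrict x R i) = stv i (restrict y R i))" using kR k(2) by (metis nat_less_le st)
    show ?thesis
      unfolding blx_iff[OF RI V] if_not_P[OF 1]
      using k kR RS by (intro bexI[of _ k]) auto
  qed
qed

lemma blx_restrict_iff:
  assumes R: "R \<noteq> {}" "R \<subset> S" and S: "S \<subseteq> {1..d}" and x: "x \<in> VG S" and y: "y \<in> VG S"
    and eq: "\<And>j. j \<in> S - R \<Longrightarrow> x j = y j"
  shows "blx R (restrict x R) (restrict y R) \<longleftrightarrow> blx S x y"
proof
  assume b: "blx R (restrict x R) (restrict y R)"
  have RI: "R \<subseteq> {1..d}" and S0: "S \<noteq> {}" using R S by blast+
  have V: "restrict x R \<in> VG R" "restrict y R \<in> VG R" using x y R by (auto simp: PiE_iff)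
  have "x \<noteq> y" using b blx_irrefl[OF RI V(1)] by auto
  moreover have "\<not> blx S y x"
  proof
    assume "blx S y x"
    then have "blx R (restrict y R) (restrict x R)" using blx_restrict[OF R S y x] eq by metis
    then have "blx R (restrict x R) (restrict x R)" using blx_trans[OF RI V(1,2,1) b] by blast
    then show False using blx_irrefl[OF RI V(1)] by blast
  qed
  ultimately show "blx S x y" using blx_total[OF S S0 x y] by blast
qed (rule blx_restrict[OF R S x y eq])


section \<open>Translation of vertices into ranks and of edges into weights\<close>

definition vx :: "nat \<Rightarrow> nat \<Rightarrow> 'a" where
  "vx i k = inv_into (verts (G i)) (r i) k"

definition vcount :: "nat \<Rightarrow> nat" where
  "vcount i = card (verts (G i))"

definition to_graph :: "nat set \<Rightarrow> (nat \<Rightarrow> nat) \<Rightarrow> nat \<Rightarrow> 'a" where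
  "to_graph S x = (\<lambda>i\<in>S. vx i (x i))"

definition start_rank :: "nat \<Rightarrow> nat \<Rightarrow> nat" where
  "start_rank i k = stv i (vx i k)"

definition weight :: "nat \<Rightarrow> nat \<Rightarrow> int" where
  "weight i k = int (back_degree (G i) (r i) (vx i k))"

definition rank_less :: "nat set \<Rightarrow> (nat \<Rightarrow> nat) \<Rightarrow> (nat \<Rightarrow> nat) \<Rightarrow> bool" where
  "rank_less S x y \<longleftrightarrow> blx S (to_graph S x) (to_graph S y)"

abbreviation "VN S \<equiv> (\<Pi>\<^sub>E i\<in>S. {1..vcount i})"

lemma vx:
  assumes "i \<in> {1..d}" "1 \<le> k" "k \<le> vcount i"
  shows "vx i k \<in> verts (G i)" "r i (vx i k) = k"
proof -
  have "k \<in> r i ` verts (G i)"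
    using ordered_partition.bij[OF factor[OF assms(1)]] assms(2,3) unfolding bij_betw_def vcount_def by simp
  then show "vx i k \<in> verts (G i)" "r i (vx i k) = k"
    unfolding vx_def by (rule inv_into_into, rule f_inv_into_f)
qed

lemma vx_rank:
  assumes "i \<in> {1..d}" "v \<in> verts (G i)"
  shows "vx i (r i v) = v" "1 \<le> r i v" "r i v \<le> vcount i"
  using ordered_partition.rank_inj[OF factor[OF assms(1)]] ordered_partition.rank_range[OF factor[OF assms(1)]] assms(2)
  unfolding vx_def vcount_def by (auto simp: inv_into_f_f)

lemma VN_range:
  assumes "x \<in> VN S" "i \<in> S"
  shows "1 \<le> x i" "x i \<le> vcount i"
  using assms by (auto simp: PiE_iff)

lemma to_graph:
  assumes S: "S \<subseteq> {1..d}" and x: "x \<in> VN S"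
  shows to_graph_V: "to_graph S x \<in> VG S"
    and to_graph_rank: "i \<in> S \<Longrightarrow> r i (to_graph S x i) = x i"
    and to_graph_apply: "i \<in> S \<Longrightarrow> to_graph S x i = vx i (x i)"
proof -
  have *: "vx i (x i) \<in> verts (G i) \<and> r i (vx i (x i)) = x i" if "i \<in> S" for i
    using vx[of i "x i"] VN_range[OF x that] S that by blast
  show "to_graph S x \<in> VG S" using * unfolding to_graph_def by (simp add: PiE_iff)
  show "i \<in> S \<Longrightarrow> r i (to_graph S x i) = x i" using * unfolding to_graph_def by simp
  show "i \<in> S \<Longrightarrow> to_graph S x i = vx i (x i)" unfolding to_graph_def by simp
qed

lemma to_graph_inj: "S \<subseteq> {1..d} \<Longrightarrow> inj_on (to_graph S) (VN S)"
proof (rule inj_onI)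
  fix x y assume S: "S \<subseteq> {1..d}" and x: "x \<in> VN S" and y: "y \<in> VN S" and eq: "to_graph S x = to_graph S y"
  show "x = y"
  proof (rule PiE_ext[OF x y])
    show "x i = y i" if "i \<in> S" for i
      using to_graph_rank[OF S x that] to_graph_rank[OF S y that] eq by simp
  qed
qed

lemma to_graph_surj:
  assumes S: "S \<subseteq> {1..d}" and y: "y \<in> VG S"
  obtains x where "x \<in> VN S" "to_graph S x = y" "\<And>i. i \<in> S \<Longrightarrow> x i = r i (y i)"
proof
  define x where "x = (\<lambda>i\<in>S. r i (y i))"
  have *: "vx i (r i (y i)) = y i \<and> 1 \<le> r i (y i) \<and> r i (y i) \<le> vcount i" if "i \<in> S" for i
    using vx_rank[of i "y i"] y S that by (auto simp: PiE_iff)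
  show xV: "x \<in> VN S" unfolding x_def using * by (simp add: PiE_iff)
  show "to_graph S x = y"
  proof (rule PiE_ext[OF to_graph_V[OF S xV] y])
    show "to_graph S x i = y i" if "i \<in> S" for i using * that unfolding to_graph_def x_def by simp
  qed
  show "x i = r i (y i)" if "i \<in> S" for i unfolding x_def using that by simp
qed

lemma to_graph_restrict:
  "R \<subseteq> S \<Longrightarrow> to_graph R (restrict x R) = restrict (to_graph S x) R"
  unfolding to_graph_def by (rule ext) (auto simp: restrict_def)

lemma to_graph_upd:
  assumes S: "S \<subseteq> {1..d}" and i: "i \<in> S" and v: "v \<in> verts (G i)"
  shows "(to_graph S x)(i := v) = to_graph S (x(i := r i v))"
proof -
  have "vx i (r i v) = v" using vx_rank(1)[of i v] S i v by blast
  then show ?thesis unfolding to_graph_def using i by (intro ext) (auto simp: restrict_def)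
qed

lemma VN_upd:
  assumes "S \<subseteq> {1..d}" "x \<in> VN S" "i \<in> S" "v \<in> verts (G i)"
  shows "x(i := r i v) \<in> VN S"
proof -
  have "r i v \<in> {1..vcount i}" using vx_rank(2,3)[of i v] assms by auto
  then show ?thesis by (rule PiE_upd[OF assms(2,3)])
qed

lemma start_rank_to_graph: "S \<subseteq> {1..d} \<Longrightarrow> x \<in> VN S \<Longrightarrow> i \<in> S \<Longrightarrow> stv i (to_graph S x i) = start_rank i (x i)"
  unfolding start_rank_def to_graph_def by simp

lemma start_rank_mono:
  assumes "i \<in> {1..d}" "1 \<le> b" "b \<le> c" "c \<le> vcount i"
  shows "start_rank i b \<le> start_rank i c"
  unfolding start_rank_def
  using vx[OF assms(1), of b] vx[OF assms(1), of c] assms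
  by (intro ordered_partition.start_mono[OF factor[OF assms(1)]]) simp_all

lemma weight_delta:
  assumes i: "i \<in> {1..d}" and b: "1 \<le> b" "b \<le> vcount i"
  shows "weight i b = delta (G i) (start_rank i b)
     + delta (induced_subgraph (G i) (part_of (P i) (vx i b))) (b + 1 - start_rank i b)"
  unfolding weight_def start_rank_def
  using ordered_partition.back_degree_delta[OF factor[OF i] vx(1)[OF i b]] vx(2)[OF i b] by simp

lemma same_part:
  assumes i: "i \<in> {1..d}" and "1 \<le> b" "b \<le> vcount i" "1 \<le> c" "c \<le> vcount i"
  shows "start_rank i b = start_rank i c \<longleftrightarrow> part_of (P i) (vx i b) = part_of (P i) (vx i c)"
  unfolding start_rank_def
  by (rule ordered_partition.start_eq_iff[OF factor[OF i]]) (use vx[OF i] assms in auto)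

text \<open>Within a part the contribution of earlier parts is constant, and the other summand runs
  along the part's non-decreasing \<delta>-sequence.\<close>

lemma weight_nondecreasing:
  assumes j: "j \<in> {1..d}" "j \<noteq> d" and b: "1 \<le> b" "b \<le> c" "c \<le> vcount j"
    and eq: "start_rank j b = start_rank j c"
  shows "weight j b \<le> weight j c"
proof -
  interpret ordered_partition "G j" "r j" "P j" by (rule factor[OF j(1)])
  have b': "b \<le> vcount j" "1 \<le> c" using b by auto
  define Z where "Z = part_of (P j) (vx j b)"
  have Zc: "part_of (P j) (vx j c) = Z" using same_part[OF j(1) b(1) b'(1,2) b(3)] eq unfolding Z_def by simp
  note vb = vx[OF j(1) b(1) b'(1)] and vc = vx[OF j(1) b'(2) b(3)]
  have "Z \<in> set (P j)" unfolding Z_def by (rule part_of(1)[OF vb(1)])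
  then have "mono_on {1..card Z} (delta (induced_subgraph (G j) Z))"
    using nondecreasing[of j] j verts_induced_part
    unfolding nondecreasing_partition_def nondecreasing_delta_def by force
  moreover have "b + 1 - start_rank j b \<in> {1..card Z}" "c + 1 - start_rank j c \<in> {1..card Z}"
    using rank_in_part[OF vb(1)] rank_in_part[OF vc(1)] vb(2) vc(2) Zc unfolding Z_def start_rank_def by auto
  moreover have "b + 1 - start_rank j b \<le> c + 1 - start_rank j c" using eq b by simp
  ultimately have "delta (induced_subgraph (G j) Z) (b + 1 - start_rank j b) \<le> delta (induced_subgraph (G j) Z) (c + 1 - start_rank j c)"
    by (rule mono_onD)
  then show ?thesis
    unfolding weight_delta[OF j(1) b(1) b'(1)] weight_delta[OF j(1) b'(2) b(3)] Zc Z_def[symmetric] eq by simp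
qed

text \<open>Equal \<delta>-sequences make the inner summands of the first and last part agree. The
  offset \<open>l\<close> is \<open>delta\<close> at the start of the last part; for the first part
  the offset is \<open>delta (G j) 1 = 0\<close>.\<close>

lemma weight_regular:
  assumes j: "j \<in> {1..d}" "j \<noteq> 1" "j \<noteq> d"
  shows "\<exists>N l. N \<le> vcount j \<and> 0 \<le> l \<and> (\<forall>b\<in>{1..vcount j}. (start_rank j b = start_rank j 1 \<longleftrightarrow> b \<le> N) \<and>
        (start_rank j b = start_rank j (vcount j) \<longleftrightarrow> vcount j - N < b)) \<and>
      (\<forall>b\<in>{1..N}. weight j (vcount j - N + b) = l + weight j b)"
proof -
  interpret ordered_partition "G j" "r j" "P j" by (rule factor[OF j(1)])
  define m where "m = vcount j"
  have m1: "1 \<le> m" using N_pos unfolding m_def vcount_def .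
  have mm: "1 \<le> (1::nat)" "1 \<le> m" "m \<le> m" using m1 by auto
  note v1 = vx[OF j(1) mm(1) m1[unfolded m_def]] and vm = vx[OF j(1) m1[unfolded m_def] order_refl]
  define A B where "A = hd (P j)" and "B = last (P j)"
  have AB: "A \<in> set (P j)" "B \<in> set (P j)" unfolding A_def B_def using Q_ne by auto
  have pA: "part_of (P j) (vx j 1) = A"
    using part_of_eq[OF AB(1)] hd_interval[OF v1] unfolding A_def by blast
  have pB: "part_of (P j) (vx j m) = B"
  proof -
    have "r j (vx j m) = N" using vm(2) unfolding m_def by (simp add: vcount_def)
    then have "vx j m \<in> B" using last_interval vm(1) unfolding B_def m_def by blast
    then show ?thesis by (rule part_of_eq[OF AB(2)])
  qed
  have "j \<in> {2..d - 1}" using j by auto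
  then have "regular_partition (G j) (P j)"
    using collection unfolding regular_domination_collection_def by blast
  then have "equal_delta (induced_subgraph (G j) A) (induced_subgraph (G j) B)"
    unfolding regular_partition_def A_def B_def .
  then have cAB: "card A = card B" and dAB: "\<And>k. k \<in> {1..card A} \<Longrightarrow>
      delta (induced_subgraph (G j) A) k = delta (induced_subgraph (G j) B) k"
    unfolding equal_delta_def verts_induced_part[OF AB(1)] verts_induced_part[OF AB(2)] by blast+
  obtain \<beta> where "part_of (P j) (vx j 1) = {u \<in> U. start (vx j 1) \<le> r j u \<and> r j u \<le> \<beta>}" "\<beta> \<le> N"
    by (rule start_interval[OF v1(1)])
  then have \<beta>: "A = {u \<in> U. start (vx j 1) \<le> r j u \<and> r j u \<le> \<beta>}" "\<beta> \<le> N" unfolding pA .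
  have s1: "start (vx j 1) = 1" using rank_start_le[OF v1(1)] v1(2) by simp
  have cA: "card A = \<beta>" unfolding \<beta>(1) s1 using card_interval[of 1 \<beta>] \<beta>(2) by simp
  obtain \<gamma> where "part_of (P j) (vx j m) = {u \<in> U. start (vx j m) \<le> r j u \<and> r j u \<le> \<gamma>}" "\<gamma> \<le> N"
    unfolding m_def by (rule start_interval[OF vm(1)])
  then have \<gamma>: "B = {u \<in> U. start (vx j m) \<le> r j u \<and> r j u \<le> \<gamma>}" "\<gamma> \<le> N" unfolding pB .
  define s where "s = start (vx j m)"
  have s: "1 \<le> s" "s \<le> m" unfolding s_def m_def using rank_start_le[OF vm(1)] vm(2) by simp_all
  have "vx j m \<in> B" using part_of(2)[OF vm(1)] pB unfolding m_def by simp
  then have "m \<le> \<gamma>" using \<gamma>(1) vm(2) unfolding m_def by simp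
  then have \<gamma>m: "\<gamma> = m" using \<gamma>(2) unfolding m_def vcount_def by simp
  have cB: "card B = m + 1 - s" unfolding \<gamma>(1) s_def[symmetric] \<gamma>m
    by (rule card_interval[OF s(1)]) (simp add: m_def vcount_def)
  \<comment> \<open>The last part is the interval from \<open>s\<close> to \<open>m\<close> and has
    as many elements as the first, which ends at \<open>\<beta>\<close>.\<close>
  have \<beta>m: "\<beta> + s = m + 1" using cA cB cAB s by simp
  have stA: "start_rank j b = start_rank j 1 \<longleftrightarrow> b \<le> \<beta>" if b: "1 \<le> b" "b \<le> m" for b
  proof -
    note vb = vx[OF j(1) b[unfolded m_def]]
    have "start_rank j b = start_rank j 1 \<longleftrightarrow> part_of (P j) (vx j b) = A"
      using same_part[OF j(1) b[unfolded m_def] mm(1) m1[unfolded m_def]] pA by simp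
    also have "\<dots> \<longleftrightarrow> vx j b \<in> A" using part_of(2)[OF vb(1)] part_of_eq[OF AB(1)] by blast
    also have "\<dots> \<longleftrightarrow> b \<le> \<beta>" unfolding \<beta>(1) s1 using vb b by simp
    finally show ?thesis .
  qed
  have stB: "start_rank j b = start_rank j m \<longleftrightarrow> m - \<beta> < b" if b: "1 \<le> b" "b \<le> m" for b
  proof -
    note vb = vx[OF j(1) b[unfolded m_def]]
    have "start_rank j b = start_rank j m \<longleftrightarrow> part_of (P j) (vx j b) = B"
      using same_part[OF j(1) b[unfolded m_def] m1[unfolded m_def] order_refl] pB unfolding m_def by simp
    also have "\<dots> \<longleftrightarrow> vx j b \<in> B" using part_of(2)[OF vb(1)] part_of_eq[OF AB(2)] by blast
    also have "\<dots> \<longleftrightarrow> s \<le> b" unfolding \<gamma>(1) s_def[symmetric] \<gamma>m using vb b by simp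
    also have "\<dots> \<longleftrightarrow> m - \<beta> < b" using \<beta>m s by linarith
    finally show ?thesis .
  qed
  have \<beta>_le: "\<beta> \<le> m" using \<beta>m s by linarith
  have sr: "start_rank j 1 = 1" "start_rank j m = s" unfolding start_rank_def s_def by (rule s1, rule refl)
  have d1: "delta (G j) 1 = 0" unfolding delta_def by simp
  have w: "weight j (m - \<beta> + b) = delta (G j) s + weight j b" if b: "b \<in> {1..\<beta>}" for b
  proof -
    have b1: "1 \<le> b" "b \<le> m" "1 \<le> m - \<beta> + b" "m - \<beta> + b \<le> m" using b \<beta>_le by auto
    have e1: "start_rank j b = 1" using stA[OF b1(1,2)] b sr by simp
    have e2: "start_rank j (m - \<beta> + b) = s" using stB[OF b1(3,4)] b sr by simp
    have p1: "part_of (P j) (vx j b) = A"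
      using same_part[OF j(1) b1(1,2)[unfolded m_def] mm(1) m1[unfolded m_def]] pA e1 sr by simp
    have p2: "part_of (P j) (vx j (m - \<beta> + b)) = B"
      using same_part[OF j(1) b1(3,4)[unfolded m_def] m1[unfolded m_def] order_refl] pB e2 sr unfolding m_def by simp
    have "m - \<beta> + b + 1 - s = b" using \<beta>m s by linarith
    then have "weight j (m - \<beta> + b) = delta (G j) s + delta (induced_subgraph (G j) B) b"
      using weight_delta[OF j(1) b1(3,4)[unfolded m_def]] e2 p2 unfolding m_def by simp
    moreover have "weight j b = delta (induced_subgraph (G j) A) b"
      using weight_delta[OF j(1) b1(1,2)[unfolded m_def]] e1 p1 d1 by simp
    ultimately show ?thesis using dAB[of b] b cA by simp
  qed
  have "0 \<le> delta (G j) s" unfolding s_def m_def by (rule delta_start_nonneg[OF vm(1)])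
  then show ?thesis
    using \<beta>_le stA stB w unfolding m_def by (intro exI[of _ \<beta>] exI[of _ "delta (G j) s"]) auto
qed

lemma sum_to_graph:
  assumes "S \<subseteq> {1..d}" "X \<subseteq> VN S"
  shows "(\<Sum>y\<in>to_graph S ` X. F y) = (\<Sum>x\<in>X. F (to_graph S x))"
    and "card (to_graph S ` X) = card X"
proof -
  have "inj_on (to_graph S) X" using to_graph_inj[OF assms(1)] assms(2) by (rule inj_on_subset)
  then show "(\<Sum>y\<in>to_graph S ` X. F y) = (\<Sum>x\<in>X. F (to_graph S x))" "card (to_graph S ` X) = card X"
    by (simp_all add: sum.reindex card_image)
qed

text \<open>The hypothesis on two factors in terms of ranks: down-closed and initial sets correspond
  under \<open>to_graph\<close>, and \<open>optimal_order_down\<close> turns edge counts into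
  weights.\<close>

lemma weight_pair:
  assumes ij: "i \<in> {1..d}" "j \<in> {1..d}" "i < j" and X: "X \<subseteq> VN {i, j}"
    and dX: "\<And>x y. x \<in> X \<Longrightarrow> y \<in> VN {i, j} \<Longrightarrow> y i \<le> x i \<Longrightarrow> y j \<le> x j \<Longrightarrow> y \<in> X"
    and Y: "Y \<subseteq> VN {i, j}"
    and cY: "\<And>x y. x \<in> Y \<Longrightarrow> y \<in> VN {i, j} \<Longrightarrow> rank_less {i, j} y x \<Longrightarrow> y \<in> Y"
    and card: "card X = card Y"
  shows "(\<Sum>x\<in>X. \<Sum>k\<in>{i, j}. weight k (x k)) \<le> (\<Sum>x\<in>Y. \<Sum>k\<in>{i, j}. weight k (x k))"
proof -
  define S where "S = {i, j}"
  have S: "S \<subseteq> {1..d}" "S \<noteq> {}" "finite S" using ij unfolding S_def by auto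
  note X = X[folded S_def] and Y = Y[folded S_def] and dX = dX[folded S_def] and cY = cY[folded S_def]
  define A B where "A = to_graph S ` X" and "B = to_graph S ` Y"
  have le: "(\<Sum>x\<in>A. \<Sum>k\<in>S. back_degree (G k) (r k) (x k)) \<le> (\<Sum>x\<in>B. \<Sum>k\<in>S. back_degree (G k) (r k) (x k))"
  proof (rule optimal_order_down[where V = "VG S" and lt = "blx S"])
    show "finite S" by (rule S)
    show "simple_graph (G k)" if "k \<in> S" for k using simple S(1) that by blast
    show "inj_on (r k) (verts (G k))" if "k \<in> S" for k by (rule ordered_partition.rank_inj[OF factor_in[OF S(1) that]])
    show "optimal_order (cart_prod G S) (rank_in (blx S) (VG S))"
      using pairs[of i j] ij unfolding block_lex_order_def verts_cart_prod S_def by auto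
    show "\<not> blx S x x" if "x \<in> VG S" for x by (rule blx_irrefl[OF S(1) that])
    show "blx S x y \<or> blx S y x" if "x \<in> VG S" "y \<in> VG S" "x \<noteq> y" for x y by (rule blx_total[OF S(1,2) that])
    show "blx S x y" if "x \<in> VG S" "y \<in> VG S" "x \<noteq> y" "\<And>k. k \<in> S \<Longrightarrow> r k (x k) \<le> r k (y k)" for x y
      by (rule blx_mono[OF S(1,2) that])
    show "A \<subseteq> VG S" "B \<subseteq> VG S" unfolding A_def B_def using X Y to_graph_V[OF S(1)] by blast+
    show "card A = card B" unfolding A_def B_def using sum_to_graph(2)[OF S(1)] X Y card by simp
    show "x(k := v) \<in> A" if x: "x \<in> A" and k: "k \<in> S" and v: "v \<in> verts (G k)" "r k v < r k (x k)" for x k v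
    proof -
      obtain u where u: "u \<in> X" "x = to_graph S u" using x unfolding A_def by blast
      have uV: "u \<in> VN S" using u X by blast
      have "u(k := r k v) \<in> VN S" by (rule VN_upd[OF S(1) uV k v(1)])
      moreover have "(u(k := r k v)) l \<le> u l" for l
        using v(2) to_graph_rank[OF S(1) uV k] u(2) by (cases "l = k") simp_all
      ultimately have "u(k := r k v) \<in> X" using dX[OF u(1)] by blast
      then show ?thesis unfolding A_def u(2) to_graph_upd[OF S(1) k v(1)] by (rule imageI)
    qed
    show "y \<in> B" if x: "x \<in> B" and y: "y \<in> VG S" and lt: "blx S y x" for x y
    proof -
      obtain u where u: "u \<in> Y" "x = to_graph S u" using x unfolding B_def by blast
      obtain v where v: "v \<in> VN S" "to_graph S v = y" using to_graph_surj[OF S(1) y] by blast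
      have "v \<in> Y" using cY[OF u(1) v(1)] lt u(2) v(2) unfolding rank_less_def by simp
      then show ?thesis unfolding B_def v(2)[symmetric] by (rule imageI)
    qed
  qed (rule refl)
  have w: "(\<Sum>x\<in>Z. \<Sum>k\<in>S. weight k (x k)) = int (\<Sum>x\<in>to_graph S ` Z. \<Sum>k\<in>S. back_degree (G k) (r k) (x k))"
    if "Z \<subseteq> VN S" for Z
    unfolding sum_to_graph(1)[OF S(1) that] weight_def to_graph_def by simp
  show ?thesis
    unfolding S_def[symmetric] w[OF X] w[OF Y] of_nat_le_iff using le unfolding A_def B_def .
qed

text \<open>A block is a product of the graphs induced by parts, and its domination order is optimal
  there. Passing to the whole product adds the same constant to the weight of every element, which
  cancels because the two sets have equal size.\<close>

lemma weight_block:
  assumes S: "S \<subseteq> {1..d}" "S \<noteq> {}" and c: "c \<in> VN S"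
    and X: "X \<subseteq> {x \<in> VN S. \<forall>i\<in>S. start_rank i (x i) = start_rank i (c i)}"
    and dX: "\<And>x y. x \<in> X \<Longrightarrow> y \<in> VN S \<Longrightarrow> \<forall>i\<in>S. start_rank i (y i) = start_rank i (c i) \<Longrightarrow>
             \<forall>i\<in>S. y i \<le> x i \<Longrightarrow> y \<in> X"
    and Y: "Y \<subseteq> {x \<in> VN S. \<forall>i\<in>S. start_rank i (x i) = start_rank i (c i)}"
    and cY: "\<And>x y. x \<in> Y \<Longrightarrow> y \<in> VN S \<Longrightarrow> \<forall>i\<in>S. start_rank i (y i) = start_rank i (c i) \<Longrightarrow>
             rank_less S y x \<Longrightarrow> y \<in> Y"
    and card: "card X = card Y"
  shows "(\<Sum>x\<in>X. \<Sum>i\<in>S. weight i (x i)) \<le> (\<Sum>x\<in>Y. \<Sum>i\<in>S. weight i (x i))"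
proof -
  have finS: "finite S" by (rule finite_index[OF S(1)])
  define c' where "c' = to_graph S c"
  have c': "c' \<in> VG S" unfolding c'_def by (rule to_graph_V[OF S(1) c])
  define Z where "Z = block_of P S c'"
  define H where "H i = induced_subgraph (G i) (Z i)" for i
  have Zi: "Z i = part_of (P i) (c' i)" if "i \<in> S" for i using that unfolding Z_def block_of_eq by simp
  have c'i: "c' i \<in> verts (G i)" if "i \<in> S" for i using c' that by (simp add: PiE_iff)
  have Zset: "Z i \<in> set (P i)" if "i \<in> S" for i
    unfolding Zi[OF that] by (rule ordered_partition.part_of(1)[OF factor_in[OF S(1) that] c'i[OF that]])
  have vH: "verts (H i) = Z i" if "i \<in> S" for i
    unfolding H_def by (rule ordered_partition.verts_induced_part[OF factor_in[OF S(1) that] Zset[OF that]])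
  have V: "PiE S Z = (\<Pi>\<^sub>E i\<in>S. verts (H i))" using vH by (intro PiE_cong) simp
  have ZU: "Z i \<subseteq> verts (G i)" if "i \<in> S" for i
    by (rule ordered_partition.part_subset[OF factor_in[OF S(1) that] Zset[OF that]])
  have inZ: "to_graph S x \<in> PiE S Z \<longleftrightarrow> (\<forall>i\<in>S. start_rank i (x i) = start_rank i (c i))" if "x \<in> VN S" for x
    unfolding Z_def PiE_block_of[OF S(1) c']
    using to_graph_V[OF S(1) that] start_rank_to_graph[OF S(1) that] start_rank_to_graph[OF S(1) c]
    unfolding c'_def by simp
  have XV: "X \<subseteq> VN S" and YV: "Y \<subseteq> VN S" using X Y by auto
  define A B where "A = to_graph S ` X" and "B = to_graph S ` Y"
  have lt_iff: "blx S x y \<longleftrightarrow> block_less r p S Z x y" if "x \<in> PiE S Z" "y \<in> PiE S Z" for x y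
  proof -
    have x: "x \<in> VG S" "\<forall>i\<in>S. stv i (x i) = stv i (c' i)" and y: "y \<in> VG S" "\<forall>i\<in>S. stv i (y i) = stv i (c' i)"
      using that unfolding Z_def PiE_block_of[OF S(1) c'] by auto
    have "block_of P S x = Z" using same_block[OF S(1) x(1) c'] x(2) unfolding Z_def by simp
    then show ?thesis using x(2) y(2) unfolding blx_iff[OF S(1) x(1) y(1)] by simp
  qed
  have le: "(\<Sum>x\<in>A. \<Sum>k\<in>S. back_degree (H k) (r k) (x k)) \<le> (\<Sum>x\<in>B. \<Sum>k\<in>S. back_degree (H k) (r k) (x k))"
  proof (rule optimal_order_down[where V = "PiE S Z" and lt = "block_less r p S Z"])
    show "finite S" by (rule finS)
    show "simple_graph (H k)" if "k \<in> S" for k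
      unfolding H_def using simple S(1) that by (intro simple_induced) blast
    show "inj_on (r k) (verts (H k))" if "k \<in> S" for k
      using ordered_partition.rank_inj[OF factor_in[OF S(1) that]] ZU[OF that] unfolding vH[OF that] by (rule inj_on_subset)
    show "PiE S Z = (\<Pi>\<^sub>E i\<in>S. verts (H i))" by (rule V)
    show "optimal_order (cart_prod H S) (rank_in (block_less r p S Z) (PiE S Z))"
    proof -
      have "optimal_order (induced_subgraph (cart_prod G S) (PiE S Z)) (rank_in (block_less r p S Z) (PiE S Z))"
        unfolding Z_def by (rule collection_block(2)[OF S(2,1) block_of_blocks(1)[OF S(1) c']])
      moreover have "(\<lambda>i. induced_subgraph (G i) (Z i)) = H" unfolding H_def ..
      ultimately show ?thesis unfolding induced_cart_prod by simp
    qed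
    show "\<not> block_less r p S Z x x" for x by (rule block_less_irrefl)
    show "block_less r p S Z x y \<or> block_less r p S Z y x" if "x \<in> PiE S Z" "y \<in> PiE S Z" "x \<noteq> y" for x y
      using block_less_total[OF S c' that[unfolded Z_def]] unfolding Z_def .
    show "block_less r p S Z x y"
      if "x \<in> PiE S Z" "y \<in> PiE S Z" "x \<noteq> y" "\<And>k. k \<in> S \<Longrightarrow> r k (x k) \<le> r k (y k)" for x y
      using block_less_mono[OF S c' that[unfolded Z_def]] unfolding Z_def .
    have sub: "to_graph S ` W \<subseteq> PiE S Z" if "W \<subseteq> {x \<in> VN S. \<forall>i\<in>S. start_rank i (x i) = start_rank i (c i)}" for W
      using that inZ by blast
    show AZ: "A \<subseteq> PiE S Z" and BZ: "B \<subseteq> PiE S Z" unfolding A_def B_def by (rule sub[OF X], rule sub[OF Y])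
    show "card A = card B" unfolding A_def B_def using sum_to_graph(2)[OF S(1)] XV YV card by simp
    show "x(k := v) \<in> A" if x: "x \<in> A" and k: "k \<in> S" and v: "v \<in> verts (H k)" "r k v < r k (x k)" for x k v
    proof -
      obtain u where u: "u \<in> X" "x = to_graph S u" using x unfolding A_def by blast
      have uV: "u \<in> VN S" using u XV by blast
      have vZ: "v \<in> Z k" using v(1) vH[OF k] by simp
      have vG: "v \<in> verts (G k)" using vZ ZU[OF k] by blast
      have eq: "x(k := v) = to_graph S (u(k := r k v))" unfolding u(2) by (rule to_graph_upd[OF S(1) k vG])
      have uV': "u(k := r k v) \<in> VN S" by (rule VN_upd[OF S(1) uV k vG])
      have "x \<in> PiE S Z" using x AZ by blast
      then have "x(k := v) \<in> PiE S Z" using k vZ by (rule PiE_upd)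
      then have "\<forall>i\<in>S. start_rank i ((u(k := r k v)) i) = start_rank i (c i)" using inZ[OF uV'] eq by simp
      moreover have "(u(k := r k v)) l \<le> u l" for l
        using v(2) to_graph_rank[OF S(1) uV k] u(2) by (cases "l = k") simp_all
      ultimately have "u(k := r k v) \<in> X" using dX[OF u(1) uV'] by blast
      then show ?thesis unfolding A_def eq by (rule imageI)
    qed
    show "y \<in> B" if x: "x \<in> B" and y: "y \<in> PiE S Z" and lt: "block_less r p S Z y x" for x y
    proof -
      obtain u where u: "u \<in> Y" "x = to_graph S u" using x unfolding B_def by blast
      have "y \<in> VG S" using y unfolding Z_def PiE_block_of[OF S(1) c'] by simp
      then obtain v where v: "v \<in> VN S" "to_graph S v = y" using to_graph_surj[OF S(1)] by blast
      have "x \<in> PiE S Z" using x BZ by blast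
      then have "rank_less S v u" using lt lt_iff y u(2) v(2) unfolding rank_less_def by simp
      moreover have "\<forall>i\<in>S. start_rank i (v i) = start_rank i (c i)" using inZ[OF v(1)] v(2) y by simp
      ultimately have "v \<in> Y" using cY[OF u(1) v(1)] by blast
      then show ?thesis unfolding B_def v(2)[symmetric] by (rule imageI)
    qed
  qed
  have w: "(\<Sum>x\<in>W. \<Sum>k\<in>S. weight k (x k)) = int (card W) * (\<Sum>k\<in>S. delta (G k) (start_rank k (c k)))
      + int (\<Sum>x\<in>to_graph S ` W. \<Sum>k\<in>S. back_degree (H k) (r k) (x k))"
    if W: "W \<subseteq> {x \<in> VN S. \<forall>i\<in>S. start_rank i (x i) = start_rank i (c i)}" for W
  proof -
    have WV: "W \<subseteq> VN S" using W by auto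
    have "weight k (x k) = delta (G k) (start_rank k (c k)) + int (back_degree (H k) (r k) (to_graph S x k))"
      if x: "x \<in> W" and k: "k \<in> S" for x k
    proof -
      have xV: "x \<in> VN S" and st: "start_rank k (x k) = start_rank k (c k)" using x k W by auto
      have kd: "k \<in> {1..d}" using k S(1) by blast
      note rx = VN_range[OF xV k] and rc = VN_range[OF c k]
      have "part_of (P k) (vx k (x k)) = part_of (P k) (vx k (c k))" using same_part[OF kd rx rc] st by simp
      then have "part_of (P k) (vx k (x k)) = Z k" using Zi[OF k] to_graph_apply[OF S(1) c k] unfolding c'_def by simp
      then show ?thesis
        using ordered_partition.back_degree_split[OF factor[OF kd] vx(1)[OF kd rx]] st
        unfolding weight_def H_def to_graph_apply[OF S(1) xV k] start_rank_def by simp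
    qed
    then have "(\<Sum>x\<in>W. \<Sum>k\<in>S. weight k (x k)) = (\<Sum>x\<in>W. (\<Sum>k\<in>S. delta (G k) (start_rank k (c k)))
        + (\<Sum>k\<in>S. int (back_degree (H k) (r k) (to_graph S x k))))"
      by (intro sum.cong refl) (simp add: sum.distrib)
    also have "\<dots> = int (card W) * (\<Sum>k\<in>S. delta (G k) (start_rank k (c k)))
        + (\<Sum>x\<in>W. \<Sum>k\<in>S. int (back_degree (H k) (r k) (to_graph S x k)))"
      by (simp add: sum.distrib)
    finally show ?thesis unfolding sum_to_graph(1)[OF S(1) WV] by simp
  qed
  show ?thesis
    unfolding w[OF X] w[OF Y] card add_le_cancel_left of_nat_le_iff using le unfolding A_def B_def .
qed

lemma rank_less_restrict:
  assumes S: "S \<subseteq> {1..d}" and j: "j \<in> S" "S - {j} \<noteq> {}" and x: "x \<in> VN S" and y: "y \<in> VN S"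
    and eq: "x j = y j" and lt: "rank_less S x y"
  shows "rank_less (S - {j}) (restrict x (S - {j})) (restrict y (S - {j}))"
proof -
  have "to_graph S x i = to_graph S y i" if "i \<in> S - (S - {j})" for i
    using that eq unfolding to_graph_def by auto
  then have "blx (S - {j}) (restrict (to_graph S x) (S - {j})) (restrict (to_graph S y) (S - {j}))"
    using lt j unfolding rank_less_def
    by (intro blx_restrict[OF j(2) _ S to_graph_V[OF S x] to_graph_V[OF S y]]) auto
  then show ?thesis unfolding rank_less_def to_graph_restrict[OF Diff_subset] .
qed

lemma rank_less_block:
  assumes S: "S \<subseteq> {1..d}" and x: "x \<in> VN S" and y: "y \<in> VN S" and k: "k \<in> S"
    and lt: "start_rank k (x k) < start_rank k (y k)"
    and eq: "\<And>i. i \<in> S \<Longrightarrow> i < k \<Longrightarrow> start_rank i (x i) = start_rank i (y i)"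
  shows "rank_less S x y"
proof -
  note st = start_rank_to_graph[OF S x] start_rank_to_graph[OF S y]
  have ne: "\<not> (\<forall>i\<in>S. stv i (to_graph S x i) = stv i (to_graph S y i))" using k lt st by (metis less_irrefl)
  show ?thesis
    unfolding rank_less_def blx_iff[OF S to_graph_V[OF S x] to_graph_V[OF S y]] if_not_P[OF ne]
    using k lt eq st by (intro bexI[of _ k]) auto
qed

lemma grid: "rank_grid {1..d} vcount start_rank weight rank_less"
proof (rule rank_grid.intro)
  have MM: "Min {1..d} = 1" "Max {1..d} = d" using d3 by (auto intro: Min_eqI Max_eqI)
  show "finite {1..d}" by simp
  show "1 \<le> vcount i" if "i \<in> {1..d}" for i
    unfolding vcount_def by (rule ordered_partition.N_pos[OF factor[OF that]])
  show "start_rank i b \<le> start_rank i c" if "i \<in> {1..d}" "1 \<le> b" "b \<le> c" "c \<le> vcount i" for i b c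
    by (rule start_rank_mono[OF that])
  show "\<not> rank_less S x x" if "S \<subseteq> {1..d}" "S \<noteq> {}" "x \<in> VN S" for S x
    unfolding rank_less_def by (rule blx_irrefl[OF that(1) to_graph_V[OF that(1,3)]])
  show "rank_less S x u" if "S \<subseteq> {1..d}" "S \<noteq> {}" "x \<in> VN S" "y \<in> VN S" "u \<in> VN S"
    "rank_less S x y" "rank_less S y u" for S x y u
    using that(6,7) unfolding rank_less_def
    by (rule blx_trans[OF that(1) to_graph_V[OF that(1,3)] to_graph_V[OF that(1,4)] to_graph_V[OF that(1,5)]])
  show "rank_less S x y \<or> rank_less S y x" if "S \<subseteq> {1..d}" "S \<noteq> {}" "x \<in> VN S" "y \<in> VN S" "x \<noteq> y" for S x y
  proof -
    have "to_graph S x \<noteq> to_graph S y" using to_graph_inj[OF that(1)] that(3-5) unfolding inj_on_def by blast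
    then show ?thesis
      unfolding rank_less_def by (rule blx_total[OF that(1,2) to_graph_V[OF that(1,3)] to_graph_V[OF that(1,4)]])
  qed
  show "rank_less (S - {j}) (restrict x (S - {j})) (restrict y (S - {j}))"
    if "S \<subseteq> {1..d}" "j \<in> S" "S - {j} \<noteq> {}" "x \<in> VN S" "y \<in> VN S" "x j = y j" "rank_less S x y" for S x y j
    by (rule rank_less_restrict[OF that])
  show "rank_less S x y" if "S \<subseteq> {1..d}" "S \<noteq> {}" "x \<in> VN S" "y \<in> VN S" "x \<noteq> y"
    "\<And>i. i \<in> S \<Longrightarrow> x i \<le> y i" for S x y
  proof -
    have "to_graph S x \<noteq> to_graph S y" using to_graph_inj[OF that(1)] that(3-5) unfolding inj_on_def by blast
    then show ?thesis
      unfolding rank_less_def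
      by (rule blx_mono[OF that(1,2) to_graph_V[OF that(1,3)] to_graph_V[OF that(1,4)]])
        (simp add: to_graph_rank[OF that(1,3)] to_graph_rank[OF that(1,4)] that(6))
  qed
  show "rank_less S x y" if "S \<subseteq> {1..d}" "x \<in> VN S" "y \<in> VN S" "k \<in> S" "start_rank k (x k) < start_rank k (y k)"
    "\<And>i. i \<in> S \<Longrightarrow> i < k \<Longrightarrow> start_rank i (x i) = start_rank i (y i)" for S x y k
    by (rule rank_less_block[OF that])
  show "weight j b \<le> weight j c" if "j \<in> {1..d}" "j \<noteq> Max {1..d}" "1 \<le> b" "b \<le> c" "c \<le> vcount j"
    "start_rank j b = start_rank j c" for j b c
    using that unfolding MM by (rule weight_nondecreasing)
  show "\<exists>N l. N \<le> vcount j \<and> 0 \<le> l \<and> (\<forall>b\<in>{1..vcount j}. (start_rank j b = start_rank j 1 \<longleftrightarrow> b \<le> N) \<and>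
        (start_rank j b = start_rank j (vcount j) \<longleftrightarrow> vcount j - N < b)) \<and>
      (\<forall>b\<in>{1..N}. weight j (vcount j - N + b) = l + weight j b)"
    if "j \<in> {1..d}" "j \<noteq> Min {1..d}" "j \<noteq> Max {1..d}" for j
    using that unfolding MM by (rule weight_regular)
qed (rule weight_block weight_pair; assumption)+


section \<open>Initial segments of the block-lexicographic order and compression\<close>

definition initial :: "nat set \<Rightarrow> (nat \<Rightarrow> 'a) set \<Rightarrow> bool" where
  "initial S B \<longleftrightarrow> B \<subseteq> VG S \<and> (\<forall>x\<in>B. \<forall>y\<in>VG S. blx S y x \<longrightarrow> y \<in> B)"

lemma initial_down:
  assumes S: "S \<subseteq> {1..d}" "S \<noteq> {}" and B: "initial S B"
    and x: "x \<in> B" "i \<in> S" "v \<in> verts (G i)" "r i v < r i (x i)"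
  shows "x(i := v) \<in> B"
proof -
  have xV: "x \<in> VG S" using x B unfolding initial_def by blast
  have V': "x(i := v) \<in> VG S" using xV x by (intro PiE_upd) auto
  have "(x(i := v)) i \<noteq> x i" using x(4) by auto
  then have "x(i := v) \<noteq> x" by metis
  then have "blx S (x(i := v)) x" using x(4) by (intro blx_mono[OF S V' xV]) auto
  then show ?thesis using B x(1) V' unfolding initial_def by blast
qed

text \<open>Compression over the single coordinate \<open>i\<close> forces this; \<open>{i}\<close>
  is a proper subset of the index set since \<open>d\<close> is at least 3.\<close>

lemma strongly_compressed_down:
  assumes A: "A \<subseteq> VG {1..d}" "strongly_compressed d G r P p A"
    and x: "x \<in> A" "i \<in> {1..d}" "v \<in> verts (G i)" "r i v < r i (x i)"
  shows "x(i := v) \<in> A"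
proof -
  define q where "q = block_lex_order G r P p {i}"
  define y where "y = x(i := v)"
  have "{i} \<noteq> {1..d}"
  proof
    assume "{i} = {1..d}"
    then have "card {1..d} = 1" by (metis card_1_singleton_iff One_nat_def)
    then show False using d3 by simp
  qed
  then have "{i} \<subset> {1..d}" using x(2) by blast
  then have c: "compression d G {i} q A = A"
    using A(2) unfolding strongly_compressed_def q_def by blast
  then obtain w where w: "w \<in> verts (cart_prod G ({1..d} - {i}))" "x \<in> graph_section d G {i} w"
    "q (restrict x {i}) \<le> card (A \<inter> graph_section d G {i} w)"
    using x(1) unfolding compression_def by blast
  have xV: "x \<in> VG {1..d}" using x A by blast
  have yV: "y \<in> VG {1..d}" unfolding y_def by (rule PiE_upd[OF xV x(2,3)])
  have ys: "y \<in> graph_section d G {i} w"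
    using w(2) yV unfolding graph_section_def verts_cart_prod y_def by simp
  have I: "{i} \<subseteq> {1..d}" "{i} \<noteq> {}" using x(2) by auto
  have V: "restrict x {i} \<in> VG {i}" "restrict y {i} \<in> VG {i}" using xV yV x(2) by (auto simp: PiE_iff)
  have "restrict y {i} i \<noteq> restrict x {i} i" using x(4) unfolding y_def by auto
  then have ne: "restrict y {i} \<noteq> restrict x {i}" by metis
  have lt: "blx {i} (restrict y {i}) (restrict x {i})"
    using x(4) by (intro blx_mono[OF I V(2,1) ne]) (simp add: y_def)
  have "{u \<in> VG {i}. blx {i} u (restrict y {i})} \<subseteq> {u \<in> VG {i}. blx {i} u (restrict x {i})}"
    using blx_trans[OF I(1) _ V(2,1) _ lt] by blast
  moreover have "finite (VG {i})" by (intro finite_PiE finite_verts simple) (use x(2) in auto)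
  ultimately have "q (restrict y {i}) \<le> q (restrict x {i})"
    unfolding q_def block_lex_order_def rank_in_def verts_cart_prod by (simp add: card_mono)
  then have "y \<in> compression d G {i} q A" using w ys unfolding compression_def by fastforce
  then show ?thesis unfolding c y_def .
qed

text \<open>Under \<open>to_graph\<close> the set \<open>A\<close> comes from a down-closed set of
  rank tuples, whose weight \<open>opt_all\<close> bounds by that of an initial segment. Both sets
  are down-closed in the graph product, so the two weights are edge counts.\<close>

lemma exists_initial:
  assumes A: "A \<subseteq> VG {1..d}"
    and down: "\<And>x i v. x \<in> A \<Longrightarrow> i \<in> {1..d} \<Longrightarrow> v \<in> verts (G i) \<Longrightarrow> r i v < r i (x i) \<Longrightarrow> x(i := v) \<in> A"
  shows "\<exists>B. initial {1..d} B \<and> card B = card A \<and>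
    card (inner_edges (cart_prod G {1..d}) A) \<le> card (inner_edges (cart_prod G {1..d}) B)"
proof -
  interpret rg: rank_grid "{1..d}" vcount start_rank weight rank_less by (rule grid)
  define I where "I = {1..d}"
  have I: "I \<subseteq> {1..d}" "I \<noteq> {}" "2 \<le> card I" "finite I" using d3 unfolding I_def by auto
  have VI: "rg.V I = VN I" unfolding rg.V_def ..
  define X where "X = {x \<in> VN I. to_graph I x \<in> A}"
  have XV: "X \<subseteq> VN I" unfolding X_def by auto
  have imX: "to_graph I ` X = A"
  proof
    show "to_graph I ` X \<subseteq> A" unfolding X_def by auto
    show "A \<subseteq> to_graph I ` X"
    proof
      fix y assume y: "y \<in> A"
      then obtain x where "x \<in> VN I" "to_graph I x = y" using to_graph_surj[OF I(1)] A unfolding I_def by blast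
      then show "y \<in> to_graph I ` X" using y unfolding X_def by blast
    qed
  qed
  have step: "x(i := k) \<in> X" if x: "x \<in> X" and i: "i \<in> I" and k: "1 \<le> k" "k < x i" for x i k
  proof -
    have xV: "x \<in> VN I" using x XV by blast
    have id: "i \<in> {1..d}" using i I by blast
    have kv: "k \<le> vcount i" using VN_range(2)[OF xV i] k by simp
    note v = vx[OF id k(1) kv]
    have "(to_graph I x)(i := vx i k) \<in> A"
    proof (rule down[OF _ id v(1)])
      show "to_graph I x \<in> A" using x unfolding X_def by simp
      show "r i (vx i k) < r i (to_graph I x i)" using to_graph_rank[OF I(1) xV i] v(2) k(2) by simp
    qed
    moreover have "x(i := k) \<in> VN I" using xV i k(1) kv by (intro PiE_upd) auto
    ultimately show ?thesis using to_graph_upd[OF I(1) i v(1), of x] v(2) unfolding X_def by simp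
  qed
  have "y \<in> X" if xy: "x \<in> X" "y \<in> VN I" "\<forall>i\<in>I. y i \<le> x i" for x y
  proof -
    \<comment> \<open>The hypothesis lowers one coordinate at a time, while \<open>rg.down\<close>
      lowers all at once; \<open>J\<close> collects the coordinates already lowered.\<close>
    have "(\<lambda>i. if i \<in> J then y i else x i) \<in> X" if "finite J" "J \<subseteq> I" for J
      using that
    proof (induction J rule: finite_induct)
      case empty
      then show ?case using xy(1) by simp
    next
      case (insert j J)
      define u where "u = (\<lambda>i. if i \<in> J then y i else x i)"
      have uX: "u \<in> X" using insert unfolding u_def by blast
      have uj: "u j = x j" using insert(2) unfolding u_def by simp
      have jI: "j \<in> I" using insert by blast
      have eq: "(\<lambda>i. if i \<in> insert j J then y i else x i) = u(j := y j)" unfolding u_def by auto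
      show ?case
      proof (cases "y j = x j")
        case True
        then show ?thesis unfolding eq using uX uj by (metis fun_upd_triv)
      next
        case False
        then have "y j < u j" using xy(3) jI uj by (simp add: le_neq_implies_less)
        then show ?thesis unfolding eq using step[OF uX jI] VN_range(1)[OF xy(2) jI] by blast
      qed
    qed
    from this[OF I(4) subset_refl] have *: "(\<lambda>i. if i \<in> I then y i else x i) \<in> X" .
    have "(\<lambda>i. if i \<in> I then y i else x i) = y"
      using xy XV by (intro ext) (auto simp: PiE_iff extensional_def)
    then show ?thesis using * by simp
  qed
  then have dX: "rg.down I X" unfolding rg.down_def VI using XV by blast
  have "rg.opt I" by (rule rg.opt_all[OF I(1,3)])
  define Y where "Y = rg.init I (card X)"
  have WXY: "rg.W I X \<le> rg.W I Y" using \<open>rg.opt I\<close> dX unfolding rg.opt_def Y_def by blast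
  have YV: "Y \<subseteq> VN I" unfolding Y_def VI[symmetric] by (rule rg.init_subset)
  have "finite (VN I)" using I(4) by (intro finite_PiE) auto
  then have "card X \<le> card (rg.V I)" unfolding VI using XV by (rule card_mono)
  then have cY: "card Y = card X" unfolding Y_def by (rule rg.card_init[OF I(1,2)])
  define B where "B = to_graph I ` Y"
  have BV: "B \<subseteq> VG I" unfolding B_def using YV to_graph_V[OF I(1)] by blast
  have B: "initial I B"
    unfolding initial_def
  proof (intro conjI BV ballI impI)
    fix x y assume x: "x \<in> B" and y: "y \<in> VG I" and lt: "blx I y x"
    obtain u where u: "u \<in> Y" "x = to_graph I u" using x unfolding B_def by blast
    obtain v where v: "v \<in> VN I" "to_graph I v = y" using to_graph_surj[OF I(1) y] by blast
    have "v \<in> Y" unfolding Y_def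
    proof (rule rg.init_closed[OF I(1,2)])
      show "u \<in> rg.init I (card X)" using u(1) unfolding Y_def .
      show "v \<in> rg.V I" using v(1) unfolding VI .
      show "rank_less I v u" using lt u(2) v(2) unfolding rank_less_def by simp
    qed
    then show "y \<in> B" unfolding B_def v(2)[symmetric] by (rule imageI)
  qed
  have AV: "A \<subseteq> VG I" using A unfolding I_def .
  have w: "rg.W I Z = int (\<Sum>x\<in>to_graph I ` Z. \<Sum>k\<in>I. back_degree (G k) (r k) (x k))" if "Z \<subseteq> VN I" for Z
    unfolding rg.W_def sum_to_graph(1)[OF I(1) that] weight_def to_graph_def by simp
  have sG: "simple_graph (G k)" "inj_on (r k) (verts (G k))" if "k \<in> I" for k
    using simple I(1) that ordered_partition.rank_inj[OF factor_in[OF I(1) that]] by blast+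
  have "card (inner_edges (cart_prod G I) A) = (\<Sum>x\<in>A. \<Sum>k\<in>I. back_degree (G k) (r k) (x k))"
    by (rule card_inner_edges_down[OF I(4) sG]) (use AV down I_def in \<open>simp_all add: verts_cart_prod\<close>)
  moreover have "card (inner_edges (cart_prod G I) B) = (\<Sum>x\<in>B. \<Sum>k\<in>I. back_degree (G k) (r k) (x k))"
    by (rule card_inner_edges_down[OF I(4) sG])
      (use BV initial_down[OF I(1,2) B] in \<open>simp_all add: verts_cart_prod\<close>)
  ultimately have "card (inner_edges (cart_prod G I) A) \<le> card (inner_edges (cart_prod G I) B)"
    using WXY unfolding w[OF XV] w[OF YV] imX B_def[symmetric] of_nat_le_iff by simp
  moreover have "card B = card A"
    unfolding B_def imX[symmetric] sum_to_graph(2)[OF I(1) XV] sum_to_graph(2)[OF I(1) YV] by (rule cY)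
  ultimately show ?thesis using B unfolding I_def by blast
qed

text \<open>On a section over \<open>S\<close> the order of the full product restricts to that of
  the subproduct. So \<open>B\<close> meets every section in an initial segment, which compression
  leaves unchanged.\<close>

lemma initial_strongly_compressed:
  assumes B: "initial {1..d} B"
  shows "strongly_compressed d G r P p B"
  unfolding strongly_compressed_def
proof (intro allI impI)
  fix S assume S: "S \<noteq> {} \<and> S \<subset> {1..d}"
  then have SI: "S \<subseteq> {1..d}" and S0: "S \<noteq> {}" by auto
  define q where "q = block_lex_order G r P p S"
  define \<sigma> where "\<sigma> w = graph_section d G S w" for w
  have \<sigma>: "v \<in> \<sigma> w \<longleftrightarrow> v \<in> VG {1..d} \<and> (\<forall>j\<in>{1..d} - S. v j = w j)" for v w
    unfolding \<sigma>_def graph_section_def verts_cart_prod by simp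
  have BV: "B \<subseteq> VG {1..d}" using B unfolding initial_def by simp
  have finV: "finite (VG S)"
    by (intro finite_PiE finite_verts simple) (use SI finite_subset in auto)
  have sec: "q (restrict v S) \<le> card (B \<inter> \<sigma> w) \<longleftrightarrow> v \<in> B" if v: "v \<in> \<sigma> w" for v w
  proof -
    have inj: "u = v" if "u \<in> \<sigma> w" "v \<in> \<sigma> w" "restrict u S = restrict v S" for u v
    proof (rule PiE_ext)
      show "u \<in> VG {1..d}" "v \<in> VG {1..d}" using that \<sigma> by blast+
      show "u j = v j" if "j \<in> {1..d}" for j
      proof (cases "j \<in> S")
        case True
        then show ?thesis using fun_cong[OF \<open>restrict u S = restrict v S\<close>, of j] by simp
      next
        case False
        then show ?thesis using \<open>u \<in> \<sigma> w\<close> \<open>v \<in> \<sigma> w\<close> that \<sigma> by simp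
      qed
    qed
    define C where "C = (\<lambda>v. restrict v S) ` (B \<inter> \<sigma> w)"
    have rV: "restrict u S \<in> VG S" if "u \<in> VG {1..d}" for u using that SI by (auto simp: PiE_iff)
    have CV: "C \<subseteq> VG S" unfolding C_def using BV rV by blast
    have closed: "y \<in> C" if x: "x \<in> C" and y: "y \<in> VG S" and lt: "blx S y x" for x y
    proof -
      obtain u where u: "u \<in> B" "u \<in> \<sigma> w" "x = restrict u S" using x unfolding C_def by blast
      have uV: "u \<in> VG {1..d}" using u(1) BV by blast
      \<comment> \<open>Lifts \<open>y\<close> back into the section that contains
        \<open>u\<close>.\<close>
      define t where "t = (\<lambda>j. if j \<in> S then y j else u j)"
      have tV: "t \<in> VG {1..d}" using y uV SI unfolding t_def PiE_iff extensional_def by auto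
      have tS: "restrict t S = y" using y unfolding t_def by (intro ext) (auto simp: PiE_iff extensional_def)
      have "blx S (restrict t S) (restrict u S)" using lt tS u(3) by simp
      moreover have "t j = u j" if "j \<in> {1..d} - S" for j using that unfolding t_def by simp
      ultimately have "blx {1..d} t u" using blx_restrict_iff[of S "{1..d}" t u] S tV uV by blast
      then have "t \<in> B" using B u(1) tV unfolding initial_def by blast
      moreover have "t \<in> \<sigma> w" using u(2) tV unfolding \<sigma> t_def by simp
      ultimately have "restrict t S \<in> C" unfolding C_def by (intro imageI IntI)
      then show ?thesis unfolding tS .
    qed
    have "card C = card (B \<inter> \<sigma> w)"
      unfolding C_def by (intro card_image inj_onI, rule inj) simp_all
    moreover have "rank_in (blx S) (VG S) (restrict v S) \<le> card C \<longleftrightarrow> restrict v S \<in> C"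
    proof (rule ord_interval_rank_in(1)[OF finV _ CV, of "cart_prod G S"])
      show "verts (cart_prod G S) = VG S" by (rule verts_cart_prod)
      show "\<not> blx S x x" if "x \<in> VG S" for x by (rule blx_irrefl[OF SI that])
      show "blx S x y \<or> blx S y x" if "x \<in> VG S" "y \<in> VG S" "x \<noteq> y" for x y by (rule blx_total[OF SI S0 that])
      show "y \<in> C" if "x \<in> C" "y \<in> VG S" "blx S y x" for x y by (rule closed[OF that])
      show "restrict v S \<in> VG S" by (rule rV) (use v in \<open>simp add: \<sigma>\<close>)
    qed
    moreover have "restrict v S \<in> C \<longleftrightarrow> v \<in> B"
    proof
      assume "restrict v S \<in> C"
      then obtain u where u: "u \<in> B" "u \<in> \<sigma> w" "restrict v S = restrict u S" unfolding C_def by blast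
      have "u = v" by (rule inj[OF u(2) v u(3)[symmetric]])
      then show "v \<in> B" using u(1) by simp
    next
      assume "v \<in> B"
      then show "restrict v S \<in> C" unfolding C_def using v by blast
    qed
    ultimately show ?thesis unfolding q_def block_lex_order_def verts_cart_prod by simp
  qed
  have "compression d G S q B = B"
  proof (rule set_eqI, rule iffI)
    fix v assume "v \<in> compression d G S q B"
    then obtain w where "v \<in> \<sigma> w" "q (restrict v S) \<le> card (B \<inter> \<sigma> w)"
      unfolding compression_def \<sigma>_def by blast
    then show "v \<in> B" using sec by simp
  next
    fix v assume v: "v \<in> B"
    define w where "w = restrict v ({1..d} - S)"
    have vV: "v \<in> VG {1..d}" using v BV by blast
    have "w \<in> verts (cart_prod G ({1..d} - S))"
      using vV unfolding w_def verts_cart_prod by (auto simp: PiE_iff)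
    moreover have v\<sigma>: "v \<in> \<sigma> w" using vV unfolding \<sigma> w_def by simp
    moreover have "q (restrict v S) \<le> card (B \<inter> \<sigma> w)" using sec[OF v\<sigma>] v by simp
    ultimately show "v \<in> compression d G S q B" unfolding compression_def \<sigma>_def by blast
  qed
  then show "compression d G S (block_lex_order G r P p S) B = B" unfolding q_def .
qed

text \<open>Members of different blocks compare as the starts of these blocks do, so an element of
  \<open>B\<close> in \<open>R\<close> pulls in all blocks before \<open>R\<close>.\<close>

lemma initial_block_compressed:
  assumes B: "initial {1..d} B"
  shows "block_compressed d r P p B"
  unfolding block_compressed_def compressed_along_def
proof (intro ballI impI)
  define I where "I = {1..d}"
  have I: "I \<subseteq> {1..d}" unfolding I_def by simp
  have Zi: "Z i \<in> set (P i)" if "Z \<in> blocks P I" "i \<in> I" for Z i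
    using that unfolding blocks_def by (simp add: PiE_iff)
  have sub: "y \<in> VG I \<and> (\<forall>i\<in>I. part_of (P i) (y i) = Z i)" if Z: "Z \<in> blocks P I" and y: "y \<in> PiE I Z" for y Z
  proof -
    have "y i \<in> verts (G i) \<and> part_of (P i) (y i) = Z i" if i: "i \<in> I" for i
    proof -
      have yi: "y i \<in> Z i" using y i by (simp add: PiE_iff)
      show ?thesis
        using ordered_partition.part_subset[OF factor_in[OF I i] Zi[OF Z i]]
          ordered_partition.part_of_eq[OF factor_in[OF I i] Zi[OF Z i] yi] yi by blast
    qed
    then show ?thesis using y by (simp add: PiE_iff)
  qed
  have start: "block_start r I Z \<in> PiE I Z" if "Z \<in> blocks P I" for Z
    using ordered_partition.part_start(1)[OF factor_in[OF I] Zi[OF that]] unfolding block_start_def by (simp add: PiE_iff)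
  fix R Z
  assume R: "R \<in> blocks P {1..d}" and Z: "Z \<in> blocks P {1..d}" and pre: "block_precedes d r P p Z R"
    and "B \<inter> PiE {1..d} R \<noteq> {} \<and> (\<forall>Z\<in>blocks P {1..d}. block_precedes d r P p R Z \<longrightarrow> B \<inter> PiE {1..d} Z = {})"
  then obtain x where x: "x \<in> B" "x \<in> PiE I R" unfolding I_def by blast
  note R = R[folded I_def] and Z = Z[folded I_def]
  define s t where "s = block_start r I Z" and "t = block_start r I R"
  have s: "s \<in> VG I" "\<forall>i\<in>I. part_of (P i) (s i) = Z i" using sub[OF Z start[OF Z], folded s_def] by blast+
  have t: "t \<in> VG I" "\<forall>i\<in>I. part_of (P i) (t i) = R i" using sub[OF R start[OF R], folded t_def] by blast+
  have x': "x \<in> VG I" "\<forall>i\<in>I. part_of (P i) (x i) = R i" using sub[OF R x(2)] by blast+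
  have lt: "blx I s t" using pre unfolding block_precedes_def s_def t_def I_def .
  have st: "stv i (y i) = stv i (u i)" if "i \<in> I" "part_of (P i) (y i) = part_of (P i) (u i)" for i y u
    using that(2) ordered_partition.start_def[OF factor_in[OF I that(1)]] by simp
  \<comment> \<open>If the starts lay in one block, then \<open>Z\<close> and \<open>R\<close> would
    coincide and a start would precede itself.\<close>
  have ne: "\<not> (\<forall>i\<in>I. stv i (s i) = stv i (t i))"
  proof
    assume "\<forall>i\<in>I. stv i (s i) = stv i (t i)"
    then have eqb: "block_of P I s = block_of P I t" using same_block[OF I s(1) t(1)] by blast
    have "part_of (P i) (s i) = part_of (P i) (t i)" if "i \<in> I" for i
      using fun_cong[OF eqb, of i] that unfolding block_of_eq by simp
    then have "Z i = R i" if "i \<in> I" for i using s(2) t(2) that by simp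
    then have "Z = R" using Z R unfolding blocks_def by (intro PiE_ext[of Z I _ R])
    then show False using lt blx_irrefl[OF I s(1)] unfolding s_def t_def by simp
  qed
  show "PiE {1..d} Z \<subseteq> B"
  proof
    fix z assume "z \<in> PiE {1..d} Z"
    then have z: "z \<in> VG I" "\<forall>i\<in>I. part_of (P i) (z i) = Z i" using sub[OF Z, of z] unfolding I_def by blast+
    have eqs: "stv i (z i) = stv i (s i)" "stv i (x i) = stv i (t i)" if "i \<in> I" for i
      using st[of i z s] st[of i x t] that z(2) s(2) t(2) x'(2) by simp_all
    have ne': "\<not> (\<forall>i\<in>I. stv i (z i) = stv i (x i))" using ne eqs by simp
    have "blx I z x"
      using lt eqs unfolding blx_iff[OF I z(1) x'(1)] blx_iff[OF I s(1) t(1)] if_not_P[OF ne] if_not_P[OF ne']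
      by (simp cong: bex_cong)
    then show "z \<in> B" using B x(1) z(1) unfolding initial_def I_def by blast
  qed
qed

end

theorem theorem11:
  fixes d :: nat
    and G :: "nat \<Rightarrow> 'a sgraph"
    and r :: "nat \<Rightarrow> 'a \<Rightarrow> nat"
    and P :: "nat \<Rightarrow> 'a set list"
    and p :: "'a perm_assignment"
    and A :: "(nat \<Rightarrow> 'a) set"
  assumes "d \<ge> 3"
    and "\<And>i. i \<in> {1..d} \<Longrightarrow> simple_graph (G i)"
    and "\<And>i. i \<in> {1..d} \<Longrightarrow> optimal_order (G i) (r i)"
    and "\<And>i. i \<in> {1..d} \<Longrightarrow> isoperimetric_partition (G i) (r i) (P i)"
    and "regular_domination_collection d G r P p"
    and "\<And>i. i \<in> {1..d - 1} \<Longrightarrow> nondecreasing_partition (G i) (P i)"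
    and "\<And>i j. 1 \<le> i \<Longrightarrow> i < j \<Longrightarrow> j \<le> d \<Longrightarrow>
           optimal_order (cart_prod G {i, j}) (block_lex_order G r P p {i, j})"
    and "A \<subseteq> verts (cart_prod G {1..d})"
    and "strongly_compressed d G r P p A"
    and "slice_compressed d r P p A"
  shows "\<exists>B. B \<subseteq> verts (cart_prod G {1..d}) \<and>
           strongly_compressed d G r P p B \<and>
           block_compressed d r P p B \<and>
           card B = card A \<and>
           card (inner_edges (cart_prod G {1..d}) A) \<le> card (inner_edges (cart_prod G {1..d}) B)"
proof -
  interpret domination_setup d G r P p
    by (rule domination_setup.intro) (fact assms)+
  have A: "A \<subseteq> VG {1..d}" using assms(8) unfolding verts_cart_prod .
  obtain B where B: "initial {1..d} B" "card B = card A"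
    "card (inner_edges (cart_prod G {1..d}) A) \<le> card (inner_edges (cart_prod G {1..d}) B)"
    using exists_initial[OF A strongly_compressed_down[OF A assms(9)]] by blast
  moreover have "B \<subseteq> verts (cart_prod G {1..d})" using B(1) unfolding initial_def verts_cart_prod by simp
  ultimately show ?thesis using initial_strongly_compressed initial_block_compressed by blast
qed

end
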